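(* Let $(\mathbf u,p,\Sigma(t),\Phi,\Gamma)$ be a sufficiently smooth solution on $[0,T]$ of the dimensionless two-dimensional system (two-phase Navier–Stokes equations, interface conditions, boundary conditions, contact angle conditions and surfactant transport equations) described in the context, with $\Phi>0$ and $0<\Gamma<1$. Define the total energy $$W(t)=\sum_{i=1,2}\int_{\Omega_i(t)}\tfrac12\rho_i|\mathbf u|^2\,dA+\frac{1}{We\cdot Da}\int_{\Omega_1(t)}f(\Phi)\,dA+\frac1{We}\int_{\Sigma(t)}g(\Gamma)\,ds-\frac{\cos\theta_Y}{We}\,|\Sigma_1(t)|,$$ where $|\Sigma_1(t)|=x_r(t)-x_l(t)$ is the length of $\Sigma_1(t)$ and $$f(\Phi)=E\,\Phi\bigl(\ln(\lambda\Phi)-1\bigr),\qquad g(\Gamma)=1+E\bigl(\Gamma\ln\Gamma+(1-\Gamma)\ln(1-\Gamma)\bigr).$$ Then the system obeys the dissipation law $$\frac{d}{dt}W(t)=\dot F_k+\dot F_\Phi+\dot F_w+\dot F_\Gamma+\dot F_S+\dot F_\Lambda,$$ where $$\dot F_k=-\sum_{i=1,2}\frac1{Re}\int_{\Omega_i(t)}2\eta_i\|D(\mathbf u)\|_F^2\,dA,\qquad \dot F_\Phi=-\frac{1}{We\cdot Da\cdot Pe_\Phi}\int_{\Omega_1(t)}f''(\Phi)|\nabla\Phi|^2\,dA,$$ $$\dot F_w=-\sum_{i=1,2}\frac{1}{Re\cdot l_s}\int_{\Sigma_i(t)}\beta_i|u_s|^2\,ds,\qquad \dot F_\Gamma=-\frac{1}{We\cdot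 Pe_\Gamma}\int_{\Sigma(t)}g''(\Gamma)|\nabla_s\Gamma|^2\,ds,$$ $$\dot F_S=-\frac1{We}\int_{\Sigma(t)}\bigl(f'(\Phi)-g'(\Gamma)\bigr)S(\Phi,\Gamma)\,ds,\qquad \dot F_\Lambda=-\frac{\beta^*}{Re}\bigl(\dot x_l^2+\dot x_r^2\bigr),$$ with $f'(\Phi)-g'(\Gamma)=E\ln\!\left(\frac{\lambda\Phi(1-\Gamma)}{\Gamma}\right)$, $f''(\Phi)=\frac{E}{\Phi}$ and $g''(\Gamma)=\frac{E}{\Gamma(1-\Gamma)}$. Furthermore, the total mass of the surfactants is conserved: $$\frac{d}{dt}\left(\int_{\Omega_1(t)}\Phi\,dA+Da\int_{\Sigma(t)}\Gamma\,ds\right)\equiv0 .$$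
   Context: Geometry. $\Omega=[-L_x,L_x]\times[0,L_y]$ is split at each time $t$ into a droplet $\Omega_1(t)$ sitting on the bottom wall $\{y=0\}$ and the outer fluid $\Omega_2(t)$, separated by an open interface curve $\Sigma(t)$, which meets the wall at the left and right contact points $(x_l(t),0)$ and $(x_r(t),0)$, with $-L_x<x_l(t)<x_r(t)<L_x$, and otherwise lies in the interior of $\Omega$. $\Sigma_1(t)=\{y=0,\ x_l<x<x_r\}$ is the part of the wall in contact with $\Omega_1(t)$, so $\partial\Omega_1(t)=\overline{\Sigma(t)\cup\Sigma_1(t)}$; $\Sigma_2(t)$ is the rest of the bottom wall; $\Sigma_4=\{y=L_y\}$ is the upper wall; the lateral sides are $x=\pm L_x$. $\mathbf t_w=(1,0)^T$ and $\mathbf n_w=(0,-1)^T$ are the tangent and the outward normal of the bottom wall. $\Sigma(t)$ is parameterized by $\mathbf X$ running from the left to the right contact point, with arclength $s$ and unit tangent $\mathbf t=\partial_s\mathbf X$; $\mathbf n$ is the unit normal of $\Sigma(t)$ pointing into $\Omega_2(t)$. The dynamic contact angles $\theta_d^{l},\theta_d^{r}$ (measured inside the droplet) satisfy $\cos\theta_d^{l,r}=\mathbf t\cdot\mathbf t_w$ at the left/right contact point. $dA$ is area measure and $ds$ is arclength measure. Notation. $[\cdot]_1^2$ is the jump across $\Sigma$ (value from fluid 2 minus value from fluid 1). $\nabla_s=(\mathbf I-\mathbf n\otimes\mathbf n)\nabla$ is the surface gradient, $\nabla_s\cdot$ the surface divergence and $\nabla_s^2$ the surface Laplacian on $\Sigma(t)$.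 $\frac{D}{Dt}$ is the material derivative with respect to $\mathbf u$, i.e. the time derivative along fluid trajectories ($\partial_t+\mathbf u\cdot\nabla$ applied to any smooth extension). $D(\mathbf u)=\frac12(\nabla\mathbf u+(\nabla\mathbf u)^T)$; $\|\cdot\|_F$ is the Frobenius norm. $u_s=\mathbf u\cdot\mathbf t_w$ on the bottom wall. Constants: $\rho_i,\eta_i,\beta_i>0$ ($i=1,2$; with $\rho_1=\eta_1=\beta_1=1$ after scaling), $\beta^*>0$, $Re,Ca,l_s,Da,Bi,E,Pe_\Phi,Pe_\Gamma,\lambda>0$, $We=Re\cdot Ca$, and the Young angle $\theta_Y\in(0,\pi)$. $\gamma(\Gamma)=1+E\ln(1-\Gamma)$, and $\Gamma_{l},\Gamma_r$ are the values of $\Gamma$ at the left and right contact points. $S(\Phi,\Gamma)=Bi\,(\lambda\Phi(1-\Gamma)-\Gamma)$. Fluid equations in $\Omega_i(t)$, $i=1,2$: $$\rho_i(\partial_t\mathbf u+\mathbf u\cdot\nabla\mathbf u)+\nabla\cdot\mathbf T=\mathbf 0,\qquad \nabla\cdot\mathbf u=0,\qquad \mathbf T=p\mathbf I-\tfrac1{Re}\sigma_i,\quad \sigma_i=\eta_i(\nabla\mathbf u+(\nabla\mathbf u)^T).$$ Conditions on $\Sigma(t)$: $[\mathbf u]_1^2=\mathbf 0$; $We\,[\mathbf T]_1^2\cdot\mathbf n=-\gamma(\Gamma)\kappa\,\mathbf n+\nabla_s\gamma(\Gamma)$; the normal velocity of the interface is $v_n=\mathbf u\cdot\mathbf n$;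 the curvature is $\kappa=-\partial_{ss}\mathbf X\cdot\mathbf n$. On $\Sigma_1(t)\cup\Sigma_2(t)$: $\mathbf u\cdot\mathbf n_w=0$ and $l_s(\mathbf t_w\cdot\sigma_i\cdot\mathbf n_w)=-\beta_iu_s$ on $\Sigma_i(t)$. At the contact points (which move with the fluid velocity, $\dot x_{l,r}=\mathbf u\cdot\mathbf t_w$ there): $$\tfrac1{Ca}\bigl(\gamma(\Gamma_l)\cos\theta_d^l-\cos\theta_Y\bigr)=\beta^*\dot x_l,\qquad \tfrac1{Ca}\bigl(\gamma(\Gamma_r)\cos\theta_d^r-\cos\theta_Y\bigr)=-\beta^*\dot x_r .$$ Periodicity: $\mathbf u(-L_x,y,t)=\mathbf u(L_x,y,t)$ and $\mathbf T(-L_x,y,t)=\mathbf T(L_x,y,t)$. No-slip $\mathbf u=\mathbf 0$ on $\Sigma_4$. Surfactant equations, for the bulk concentration $\Phi$ on $\Omega_1(t)$ and the interfacial concentration $\Gamma$ on $\Sigma(t)$ (values in $[0,1]$): $$\partial_t\Phi+\mathbf u\cdot\nabla\Phi-\tfrac1{Pe_\Phi}\nabla^2\Phi=0\ \text{ in }\Omega_1(t),\qquad \tfrac{D\Gamma}{Dt}+\Gamma\,\nabla_s\cdot\mathbf u-\tfrac1{Pe_\Gamma}\nabla_s^2\Gamma=S(\Phi,\Gamma)\ \text{ on }\Sigma(t),$$ with $\tfrac1{Pe_\Phi}\mathbf n\cdot\nabla\Phi=-Da\,S(\Phi,\Gamma)$ on $\Sigma(t)$, $\mathbf n_w\cdot\nabla\Phi=0$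 on $\Sigma_1(t)$, and $\mathbf t\cdot\nabla_s\Gamma=0$ at both contact points. *)

theory Defs
  imports "HOL-Analysis.Analysis"
begin

fun Ck :: "nat \<Rightarrow> ('a::euclidean_space \<Rightarrow> 'b::euclidean_space) \<Rightarrow> bool" where
  "Ck 0 f \<longleftrightarrow> continuous_on UNIV f"
| "Ck (Suc k) f \<longleftrightarrow>
     (\<forall>x. f differentiable (at x)) \<and> (\<forall>v. Ck k (\<lambda>x. frechet_derivative f (at x) v))"

abbreviation pt :: "real \<Rightarrow> real \<Rightarrow> real^2" where
  "pt x y \<equiv> vector [x, y]"

definition t_w :: "real^2" where "t_w = pt 1 0"
definition n_w :: "real^2" where "n_w = pt 0 (-1)"

text \<open>Differential operators in the plane. \<open>jacobian u (at x)\<close> has entries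
  \<open>(i, j) \<mapsto> d u_i / d x_j\<close>, so \<open>(u . grad) u = jacobian u (at x) *v u x\<close>.\<close>

definition grad :: "(real^2 \<Rightarrow> real) \<Rightarrow> real^2 \<Rightarrow> real^2" where
  "grad f x = (\<chi> i. frechet_derivative f (at x) (axis i 1))"

definition dvg :: "(real^2 \<Rightarrow> real^2) \<Rightarrow> real^2 \<Rightarrow> real" where
  "dvg v x = trace (jacobian v (at x))"

definition tensor_dvg :: "(real^2 \<Rightarrow> real^2^2) \<Rightarrow> real^2 \<Rightarrow> real^2" where
  "tensor_dvg A x = (\<chi> i. dvg (\<lambda>y. A y $ i) x)"

definition laplacian :: "(real^2 \<Rightarrow> real) \<Rightarrow> real^2 \<Rightarrow> real" where
  "laplacian f x = dvg (grad f) x"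

definition dt :: "(real \<Rightarrow> real^2 \<Rightarrow> 'b::real_normed_vector) \<Rightarrow> real \<Rightarrow> real^2 \<Rightarrow> 'b" where
  "dt f t x = vector_derivative (\<lambda>s. f s x) (at t)"

definition material_derivative ::
  "(real \<Rightarrow> real^2 \<Rightarrow> real^2) \<Rightarrow> (real \<Rightarrow> real^2 \<Rightarrow> real) \<Rightarrow> real \<Rightarrow> real^2 \<Rightarrow> real" where
  "material_derivative u f t x = dt f t x + u t x \<bullet> grad (f t) x"

text \<open>The norm of the type \<open>real^2^2\<close> is the Frobenius norm.\<close>

definition strain :: "(real^2 \<Rightarrow> real^2) \<Rightarrow> real^2 \<Rightarrow> real^2^2" where
  "strain u x = (1/2) *\<^sub>R (jacobian u (at x) + transpose (jacobian u (at x)))"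

text \<open>Surface operators of a curve with unit normal \<open>n\<close>, for functions and vector fields given on a
  neighbourhood of the curve.\<close>

definition tan_proj :: "real^2 \<Rightarrow> real^2^2" where
  "tan_proj n = mat 1 - (\<chi> i j. n $ i * n $ j)"

definition sgrad :: "real^2 \<Rightarrow> (real^2 \<Rightarrow> real) \<Rightarrow> real^2 \<Rightarrow> real^2" where
  "sgrad n f x = tan_proj n *v grad f x"

definition sdvg :: "real^2 \<Rightarrow> (real^2 \<Rightarrow> real^2) \<Rightarrow> real^2 \<Rightarrow> real" where
  "sdvg n v x = trace (tan_proj n ** jacobian v (at x))"

text \<open>For a regular curve \<open>c\<close> with an arbitrary parameter: derivative along \<open>c\<close> with respect to
  arclength of a quantity \<open>h\<close> given as a function of the parameter, the unit tangent, the unit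
  normal to the left of the tangent, and the integral over the curve.\<close>

definition d_arc :: "(real \<Rightarrow> real^2) \<Rightarrow> (real \<Rightarrow> 'b::real_normed_vector) \<Rightarrow> real \<Rightarrow> 'b" where
  "d_arc c h a = (1 / norm (vector_derivative c (at a))) *\<^sub>R vector_derivative h (at a)"

definition tangent :: "(real \<Rightarrow> real^2) \<Rightarrow> real \<Rightarrow> real^2" where
  "tangent c a = d_arc c c a"

definition normal :: "(real \<Rightarrow> real^2) \<Rightarrow> real \<Rightarrow> real^2" where
  "normal c a = pt (- (tangent c a $ 2)) (tangent c a $ 1)"

definition curvature :: "(real \<Rightarrow> real^2) \<Rightarrow> real \<Rightarrow> real" where
  "curvature c a = - (d_arc c (tangent c) a \<bullet> normal c a)"

definition arc_integral :: "(real \<Rightarrow> real^2) \<Rightarrow> (real \<Rightarrow> real) \<Rightarrow> real" where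
  "arc_integral c h = (LINT a:{0..1}|lborel. h a * norm (vector_derivative c (at a)))"

text \<open>The surface gradient of \<open>f\<close> is a vector field on the curve only. The surface divergence of
  such a field \<open>v\<close> is \<open>t . dv/ds\<close>, which by \<open>sdvg_eq_d_arc\<close> below is \<open>sdvg\<close> of any extension.\<close>

definition slaplacian :: "(real \<Rightarrow> real^2) \<Rightarrow> (real^2 \<Rightarrow> real) \<Rightarrow> real \<Rightarrow> real" where
  "slaplacian c f a = d_arc c (\<lambda>b. sgrad (normal c b) f (c b)) a \<bullet> tangent c a"

lemma sdvg_eq_d_arc:
  assumes c: "c differentiable (at a)" and reg: "vector_derivative c (at a) \<noteq> 0"
    and v: "v differentiable (at (c a))"
  shows "sdvg (normal c a) v (c a) = d_arc c (\<lambda>b. v (c b)) a \<bullet> tangent c a"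
proof -
  define w where "w = vector_derivative c (at a)"
  define J where "J = jacobian v (at (c a))"
  define s where "s = 1 / norm w"
  have tan: "tangent c a = s *\<^sub>R w"
    by (simp add: tangent_def d_arc_def w_def s_def)
  have "(c has_derivative (\<lambda>h. h *\<^sub>R w)) (at a)"
    using c by (simp add: w_def vector_derivative_works has_vector_derivative_def)
  moreover have "(v has_derivative (\<lambda>h. J *v h)) (at (c a))"
    using v by (simp add: J_def jacobian_works)
  ultimately have "(v \<circ> c has_derivative (\<lambda>h. J *v (h *\<^sub>R w))) (at a)"
    using diff_chain_at[of c "\<lambda>h. h *\<^sub>R w" a v "\<lambda>h. J *v h"] by (simp add: o_def)
  then have "(v \<circ> c has_vector_derivative (J *v w)) (at a)"
    by (simp add: has_vector_derivative_def matrix_vector_mult_scaleR)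
  then have vd: "vector_derivative (\<lambda>b. v (c b)) (at a) = J *v w"
    using vector_derivative_at by (fastforce simp: o_def)
  have nw: "(w $ 1)\<^sup>2 + (w $ 2)\<^sup>2 = (norm w)\<^sup>2"
    by (simp only: power2_norm_eq_inner) (simp add: inner_vec_def sum_2 power2_eq_square)
  have s2: "s\<^sup>2 * ((w $ 1)\<^sup>2 + (w $ 2)\<^sup>2) = 1"
    using reg unfolding nw by (simp add: s_def w_def[symmetric] power_divide)
  have e1: "1 - s\<^sup>2 * (w $ 2)\<^sup>2 = s\<^sup>2 * (w $ 1)\<^sup>2" and e2: "1 - s\<^sup>2 * (w $ 1)\<^sup>2 = s\<^sup>2 * (w $ 2)\<^sup>2"
    using s2 by (simp_all add: algebra_simps)
  have "sdvg (normal c a) v (c a)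
      = (1 - s\<^sup>2 * (w $ 2)\<^sup>2) * J$1$1 + s\<^sup>2 * w$1 * w$2 * (J$1$2 + J$2$1)
        + (1 - s\<^sup>2 * (w $ 1)\<^sup>2) * J$2$2"
    by (simp add: sdvg_def tan_proj_def normal_def tan J_def[symmetric] trace_def
        matrix_matrix_mult_def sum_2 mat_def vector_2 power2_eq_square algebra_simps)
  also have "\<dots> = d_arc c (\<lambda>b. v (c b)) a \<bullet> tangent c a"
    unfolding e1 e2
    by (simp add: tan d_arc_def vd w_def[symmetric] s_def[symmetric] inner_vec_def sum_2
        matrix_vector_mult_def power2_eq_square algebra_simps)
  finally show ?thesis .
qed

record params =
  Lx :: real
  Ly :: real
  rho :: "nat \<Rightarrow> real"
  eta :: "nat \<Rightarrow> real"
  beta :: "nat \<Rightarrow> real"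
  beta_star :: real
  Rey :: real
  Ca :: real
  ls :: real
  Da :: real
  Bi :: real
  El :: real
  Pe_Phi :: real
  Pe_Gamma :: real
  lam :: real
  theta_Y :: real

definition We :: "params \<Rightarrow> real" where
  "We P = Rey P * Ca P"

definition admissible :: "params \<Rightarrow> bool" where
  "admissible P \<longleftrightarrow>
     Lx P > 0 \<and> Ly P > 0 \<and>
     (\<forall>i\<in>{1,2}. rho P i > 0 \<and> eta P i > 0 \<and> beta P i > 0) \<and>
     rho P 1 = 1 \<and> eta P 1 = 1 \<and> beta P 1 = 1 \<and>
     beta_star P > 0 \<and> Rey P > 0 \<and> Ca P > 0 \<and> ls P > 0 \<and> Da P > 0 \<and> Bi P > 0 \<and> El P > 0 \<and>
     Pe_Phi P > 0 \<and> Pe_Gamma P > 0 \<and> lam P > 0 \<and> 0 < theta_Y P \<and> theta_Y P < pi"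

definition surface_tension :: "params \<Rightarrow> real \<Rightarrow> real" where
  "surface_tension P G = 1 + El P * ln (1 - G)"

definition S_ads :: "params \<Rightarrow> real \<Rightarrow> real \<Rightarrow> real" where
  "S_ads P c G = Bi P * (lam P * c * (1 - G) - G)"

definition f_bulk :: "params \<Rightarrow> real \<Rightarrow> real" where
  "f_bulk P c = El P * c * (ln (lam P * c) - 1)"

definition g_surf :: "params \<Rightarrow> real \<Rightarrow> real" where
  "g_surf P G = 1 + El P * (G * ln G + (1 - G) * ln (1 - G))"

text \<open>The fields of a flow. \<open>vel i\<close> and \<open>pres i\<close> are the velocity and the pressure of fluid \<open>i\<close>.
  All fields are total functions of time and space and stand for smooth extensions of the physical
  fields: only their values for times in \<open>[0, T]\<close> and on the closure of the fluid region (for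
  \<open>vel\<close>, \<open>pres\<close>, \<open>Phi\<close>) or on the interface (for \<open>Gam\<close>) matter. \<open>X t\<close> on \<open>[0, 1]\<close> is a
  parameterization of the interface from the left to the right contact point; its parameter need
  be neither arclength nor a Lagrangian label.\<close>

record flow =
  vel :: "nat \<Rightarrow> real \<Rightarrow> real^2 \<Rightarrow> real^2"
  pres :: "nat \<Rightarrow> real \<Rightarrow> real^2 \<Rightarrow> real"
  X :: "real \<Rightarrow> real \<Rightarrow> real^2"
  Phi :: "real \<Rightarrow> real^2 \<Rightarrow> real"
  Gam :: "real \<Rightarrow> real^2 \<Rightarrow> real"

definition x_l :: "flow \<Rightarrow> real \<Rightarrow> real" where "x_l F t = X F t 0 $ 1"
definition x_r :: "flow \<Rightarrow> real \<Rightarrow> real" where "x_r F t = X F t 1 $ 1"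

definition Sigma_int :: "flow \<Rightarrow> real \<Rightarrow> (real^2) set" where
  "Sigma_int F t = X F t ` {0..1}"

text \<open>The parts of the bottom wall, as sets of \<open>x\<close>-coordinates.\<close>

definition wall :: "params \<Rightarrow> flow \<Rightarrow> nat \<Rightarrow> real \<Rightarrow> real set" where
  "wall P F i t =
     (if i = 1 then {x_l F t <..< x_r F t} else {- Lx P ..< x_l F t} \<union> {x_r F t <.. Lx P})"

text \<open>\<open>Omega P F 1 t\<close> is the region enclosed by the Jordan curve made of the interface and the
  wetted part of the wall.\<close>

definition Omega :: "params \<Rightarrow> flow \<Rightarrow> nat \<Rightarrow> real \<Rightarrow> (real^2) set" where
  "Omega P F i t =
     (let D = inside (Sigma_int F t \<union> (\<lambda>x. pt x 0) ` {x_l F t .. x_r F t})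
      in if i = 1 then D else box (pt (- Lx P) 0) (pt (Lx P) (Ly P)) - closure D)"

definition sigma_visc :: "params \<Rightarrow> flow \<Rightarrow> nat \<Rightarrow> real \<Rightarrow> real^2 \<Rightarrow> real^2^2" where
  "sigma_visc P F i t x =
     eta P i *\<^sub>R (jacobian (vel F i t) (at x) + transpose (jacobian (vel F i t) (at x)))"

definition stress :: "params \<Rightarrow> flow \<Rightarrow> nat \<Rightarrow> real \<Rightarrow> real^2 \<Rightarrow> real^2^2" where
  "stress P F i t x = pres F i t x *\<^sub>R mat 1 - (1 / Rey P) *\<^sub>R sigma_visc P F i t x"

definition theta_l :: "flow \<Rightarrow> real \<Rightarrow> real" where
  "theta_l F t = arccos (tangent (X F t) 0 \<bullet> t_w)"

definition theta_r :: "flow \<Rightarrow> real \<Rightarrow> real" where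
  "theta_r F t = arccos (tangent (X F t) 1 \<bullet> t_w)"

definition smooth_fields :: "flow \<Rightarrow> bool" where
  "smooth_fields F \<longleftrightarrow>
     (\<forall>i\<in>{1,2}. Ck 2 (\<lambda>(t, x). vel F i t x) \<and> Ck 1 (\<lambda>(t, x). pres F i t x)) \<and>
     Ck 2 (\<lambda>(t, a). X F t a) \<and> Ck 2 (\<lambda>(t, x). Phi F t x) \<and> Ck 2 (\<lambda>(t, x). Gam F t x)"

text \<open>The last condition says that \<open>normal\<close> is the unit normal pointing into fluid 2.\<close>

definition geometry :: "params \<Rightarrow> flow \<Rightarrow> real \<Rightarrow> bool" where
  "geometry P F t \<longleftrightarrow>
     inj_on (X F t) {0..1} \<and>
     (\<forall>a\<in>{0..1}. vector_derivative (X F t) (at a) \<noteq> 0) \<and>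
     X F t 0 $ 2 = 0 \<and> X F t 1 $ 2 = 0 \<and>
     - Lx P < x_l F t \<and> x_l F t < x_r F t \<and> x_r F t < Lx P \<and>
     (\<forall>a\<in>{0<..<1}. X F t a \<in> box (pt (- Lx P) 0) (pt (Lx P) (Ly P))) \<and>
     (\<forall>a\<in>{0<..<1}. \<forall>\<^sub>F h in at_right 0. X F t a + h *\<^sub>R normal (X F t) a \<in> Omega P F 2 t)"

definition fluid_eqs :: "params \<Rightarrow> flow \<Rightarrow> real \<Rightarrow> bool" where
  "fluid_eqs P F t \<longleftrightarrow>
     (\<forall>i\<in>{1,2}. \<forall>x\<in>Omega P F i t.
        rho P i *\<^sub>R (dt (vel F i) t x + jacobian (vel F i t) (at x) *v vel F i t x)
          + tensor_dvg (stress P F i t) x = 0 \<and>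
        dvg (vel F i t) x = 0)"

definition interface_conditions :: "params \<Rightarrow> flow \<Rightarrow> real \<Rightarrow> bool" where
  "interface_conditions P F t \<longleftrightarrow>
     (\<forall>a\<in>{0..1}. let x = X F t a; n = normal (X F t) a in
        vel F 2 t x - vel F 1 t x = 0 \<and>
        We P *\<^sub>R ((stress P F 2 t x - stress P F 1 t x) *v n)
          = - (surface_tension P (Gam F t x) * curvature (X F t) a) *\<^sub>R n
            + sgrad n (\<lambda>y. surface_tension P (Gam F t y)) x \<and>
        vector_derivative (\<lambda>s. X F s a) (at t) \<bullet> n = vel F 1 t x \<bullet> n)"

definition boundary_conditions :: "params \<Rightarrow> flow \<Rightarrow> real \<Rightarrow> bool" where
  "boundary_conditions P F t \<longleftrightarrow>
     (\<forall>i\<in>{1,2}. \<forall>x\<in>wall P F i t.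
        vel F i t (pt x 0) \<bullet> n_w = 0 \<and>
        ls P * (t_w \<bullet> (sigma_visc P F i t (pt x 0) *v n_w))
          = - beta P i * (vel F i t (pt x 0) \<bullet> t_w)) \<and>
     (\<forall>y\<in>{0..Ly P}.
        vel F 2 t (pt (- Lx P) y) = vel F 2 t (pt (Lx P) y) \<and>
        stress P F 2 t (pt (- Lx P) y) = stress P F 2 t (pt (Lx P) y)) \<and>
     (\<forall>x\<in>{- Lx P..Lx P}. vel F 2 t (pt x (Ly P)) = 0)"

definition contact_conditions :: "params \<Rightarrow> flow \<Rightarrow> real \<Rightarrow> bool" where
  "contact_conditions P F t \<longleftrightarrow>
     deriv (x_l F) t = vel F 1 t (X F t 0) \<bullet> t_w \<and>
     deriv (x_r F) t = vel F 1 t (X F t 1) \<bullet> t_w \<and>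
     (1 / Ca P) * (surface_tension P (Gam F t (X F t 0)) * cos (theta_l F t) - cos (theta_Y P))
       = beta_star P * deriv (x_l F) t \<and>
     (1 / Ca P) * (surface_tension P (Gam F t (X F t 1)) * cos (theta_r F t) - cos (theta_Y P))
       = - beta_star P * deriv (x_r F) t"

definition surfactant_eqs :: "params \<Rightarrow> flow \<Rightarrow> real \<Rightarrow> bool" where
  "surfactant_eqs P F t \<longleftrightarrow>
     (\<forall>x\<in>closure (Omega P F 1 t). 0 \<le> Phi F t x \<and> Phi F t x \<le> 1) \<and>
     (\<forall>x\<in>Sigma_int F t. 0 \<le> Gam F t x \<and> Gam F t x \<le> 1) \<and>
     (\<forall>x\<in>Omega P F 1 t.
        dt (Phi F) t x + vel F 1 t x \<bullet> grad (Phi F t) x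
          - (1 / Pe_Phi P) * laplacian (Phi F t) x = 0) \<and>
     (\<forall>a\<in>{0..1}. let x = X F t a; n = normal (X F t) a in
        material_derivative (vel F 1) (Gam F) t x + Gam F t x * sdvg n (vel F 1 t) x
          - (1 / Pe_Gamma P) * slaplacian (X F t) (Gam F t) a
          = S_ads P (Phi F t x) (Gam F t x) \<and>
        (1 / Pe_Phi P) * (n \<bullet> grad (Phi F t) x) = - Da P * S_ads P (Phi F t x) (Gam F t x)) \<and>
     (\<forall>x\<in>wall P F 1 t. n_w \<bullet> grad (Phi F t) (pt x 0) = 0) \<and>
     (\<forall>a\<in>{0,1}. tangent (X F t) a \<bullet> sgrad (normal (X F t) a) (Gam F t) (X F t a) = 0)"

definition smooth_solution :: "params \<Rightarrow> flow \<Rightarrow> real \<Rightarrow> bool" where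
  "smooth_solution P F T \<longleftrightarrow>
     smooth_fields F \<and>
     (\<forall>t\<in>{0..T}. geometry P F t \<and> fluid_eqs P F t \<and> interface_conditions P F t \<and>
        boundary_conditions P F t \<and> contact_conditions P F t \<and> surfactant_eqs P F t)"

definition energy :: "params \<Rightarrow> flow \<Rightarrow> real \<Rightarrow> real" where
  "energy P F t =
     (\<Sum>i\<in>{1,2}. LINT x:Omega P F i t|lborel. (1/2) * rho P i * (norm (vel F i t x))\<^sup>2)
     + 1 / (We P * Da P) * (LINT x:Omega P F 1 t|lborel. f_bulk P (Phi F t x))
     + 1 / We P * arc_integral (X F t) (\<lambda>a. g_surf P (Gam F t (X F t a)))
     - cos (theta_Y P) / We P * (x_r F t - x_l F t)"

definition F_k :: "params \<Rightarrow> flow \<Rightarrow> real \<Rightarrow> real" where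
  "F_k P F t =
     - (\<Sum>i\<in>{1,2}. 1 / Rey P *
          (LINT x:Omega P F i t|lborel. 2 * eta P i * (norm (strain (vel F i t) x))\<^sup>2))"

definition F_Phi :: "params \<Rightarrow> flow \<Rightarrow> real \<Rightarrow> real" where
  "F_Phi P F t =
     - (1 / (We P * Da P * Pe_Phi P)) *
       (LINT x:Omega P F 1 t|lborel.
          deriv (deriv (f_bulk P)) (Phi F t x) * (norm (grad (Phi F t) x))\<^sup>2)"

definition F_w :: "params \<Rightarrow> flow \<Rightarrow> real \<Rightarrow> real" where
  "F_w P F t =
     - (\<Sum>i\<in>{1,2}. 1 / (Rey P * ls P) *
          (LINT x:wall P F i t|lborel. beta P i * \<bar>vel F i t (pt x 0) \<bullet> t_w\<bar>\<^sup>2))"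

definition F_Gamma :: "params \<Rightarrow> flow \<Rightarrow> real \<Rightarrow> real" where
  "F_Gamma P F t =
     - (1 / (We P * Pe_Gamma P)) *
       arc_integral (X F t) (\<lambda>a. deriv (deriv (g_surf P)) (Gam F t (X F t a)) *
          (norm (sgrad (normal (X F t) a) (Gam F t) (X F t a)))\<^sup>2)"

definition F_S :: "params \<Rightarrow> flow \<Rightarrow> real \<Rightarrow> real" where
  "F_S P F t =
     - (1 / We P) *
       arc_integral (X F t) (\<lambda>a. let x = X F t a in
          (deriv (f_bulk P) (Phi F t x) - deriv (g_surf P) (Gam F t x)) *
          S_ads P (Phi F t x) (Gam F t x))"

definition F_Lambda :: "params \<Rightarrow> flow \<Rightarrow> real \<Rightarrow> real" where
  "F_Lambda P F t = - (beta_star P / Rey P) * ((deriv (x_l F) t)\<^sup>2 + (deriv (x_r F) t)\<^sup>2)"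

definition surfactant_mass :: "params \<Rightarrow> flow \<Rightarrow> real \<Rightarrow> real" where
  "surfactant_mass P F t =
     (LINT x:Omega P F 1 t|lborel. Phi F t x)
     + Da P * arc_integral (X F t) (\<lambda>a. Gam F t (X F t a))"

end

(* Everything is reduced to Green's theorem for the droplet, which is proved without cutting the
   domain into pieces, so that tangential contact angles need no special care. For a test function
   g of class C1 with compact support the identity of Cauchy and Pompeiu,
   integral of grad g (z - w) . w / |w|^2 dw = 2 pi g(z), together with Fubini's theorem gives
   integral of (d_x g) theta = 2 pi (line integral of g dy), where theta(z) is the angle under which
   the closed curve formed by interface and wall is seen from z. By the Jordan curve theorem theta
   is 2 pi times the winding number, which is constant inside and zero outside.

   Since the wall is horizontal, the area integral of phi is the line integral of V dy over the
   interface alone, where d_x V = phi. Differentiating it in time and applying Green's theorem once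
   more yields the Reynolds transport theorem.

   For the energy, the divergence theorem is applied to the flux (rho |u|^2 / 2) u + T u in each
   fluid and to f(Phi) u - f'(Phi) grad Phi / Pe in the droplet. On the interface
   g - Gamma g' = gamma, so the remaining surface term (integral of gamma div_s u) is the work of the
   surface tension up to boundary terms at the contact points, where the contact angle conditions
   turn them into the dissipation of the contact lines. *)
theory Submission
  imports Defs "HOL-Complex_Analysis.Complex_Analysis" "HOL-Probability.Sinc_Integral"
begin

(* the coefficient notation of power series hides that of vector components *)
no_notation fps_nth (infixl "$" 75)

section \<open>Functions of class Ck\<close>

text \<open>Exchanging the integrals needs only that 1/|w| is locally integrable in the plane; the
  shape of the droplet near the contact points never enters. For a single arc the exchange leaves
  the difference of one function at its two ends, and these differences cancel around a closed
  curve. The Jordan curve theorem gives the winding number up to sign only, so the orientation is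
  settled separately. Three features of the model shape the rest. The interface parameter is
  arbitrary, so the velocity of the parameterization differs from that of the fluid by a tangential
  slip, which has to integrate to zero. The equations hold only for times in [0, T], so time
  derivatives are taken within that interval. The fields are extensions with arbitrary values off
  the fluid, while \<open>f_bulk\<close> is singular at 0 and the transport theorem is applied to C2
  functions on the whole space. Therefore \<open>Phi\<close> is bounded below by one positive
  constant on the closed droplets of all times, by compactness in space and time, and
  \<open>f_bulk\<close> is replaced by a C2 function that agrees with it above that bound.\<close>

lemma Ck_imp_continuous_on: "Ck k f \<Longrightarrow> continuous_on A f"
  by (cases k) (auto simp: continuous_at_imp_continuous_on differentiable_imp_continuous_within
      intro: continuous_on_subset)

lemma Ck_Suc_imp: "Ck (Suc k) f \<Longrightarrow> Ck k f"
proof (induction k arbitrary: f)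
  case 0
  then show ?case using Ck_imp_continuous_on Ck.simps(1) by blast
next
  case (Suc k)
  then show ?case by (metis Ck.simps(2))
qed

lemma Ck_mono: "Ck k f \<Longrightarrow> j \<le> k \<Longrightarrow> Ck j f"
proof (induction k)
  case (Suc k)
  then show ?case using Ck_Suc_imp le_Suc_eq by metis
qed simp

lemma Ck_SucI:
  assumes "\<And>x. (f has_derivative f' x) (at x)" "\<And>v. Ck k (\<lambda>x. f' x v)"
  shows "Ck (Suc k) f"
proof -
  have "frechet_derivative f (at x) = f' x" for x
    using assms(1) frechet_derivative_at by metis
  then show ?thesis
    using assms by (auto simp: differentiable_def)
qed

lemma Ck_Suc_has_derivative:
  "Ck (Suc k) f \<Longrightarrow> (f has_derivative frechet_derivative f (at x)) (at x)"
  by (simp add: frechet_derivative_works)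

lemma Ck_frechet: "Ck (Suc k) f \<Longrightarrow> Ck k (\<lambda>x. frechet_derivative f (at x) v)"
  by simp

declare Ck.simps(2) [simp del]

lemma Ck_const: "Ck k (\<lambda>x. c)"
proof (induction k arbitrary: c)
  case (Suc k)
  show ?case by (rule Ck_SucI[where f'="\<lambda>x v. 0"]) (use Suc in auto)
qed auto

lemma Ck_bounded_linear: "bounded_linear L \<Longrightarrow> Ck k L"
proof (cases k)
  case (Suc j)
  then show "bounded_linear L \<Longrightarrow> Ck k L"
    using Ck_SucI[OF bounded_linear_imp_has_derivative Ck_const] by blast
qed (simp add: linear_continuous_on)

lemma Ck_add: "Ck k f \<Longrightarrow> Ck k g \<Longrightarrow> Ck k (\<lambda>x. f x + g x)"
proof (induction k arbitrary: f g)
  case (Suc k)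
  show ?case
    by (rule Ck_SucI[OF has_derivative_add[OF Suc.prems[THEN Ck_Suc_has_derivative]]])
      (intro Suc.IH Suc.prems Ck_frechet)
qed (auto intro: continuous_on_add)

lemma Ck_bilinear: "bounded_bilinear B \<Longrightarrow> Ck k f \<Longrightarrow> Ck k g \<Longrightarrow> Ck k (\<lambda>x. B (f x) (g x))"
proof (induction k arbitrary: f g)
  case 0
  then show ?case by (auto intro: bounded_bilinear.continuous_on)
next
  case (Suc k)
  show ?case
    by (rule Ck_SucI[OF bounded_bilinear.FDERIV[OF Suc.prems(1) Suc.prems(2,3)[THEN Ck_Suc_has_derivative]]])
      (intro Ck_add Suc.IH Suc.prems Ck_frechet Ck_Suc_imp)
qed

lemmas Ck_scaleR = Ck_bilinear[OF bounded_bilinear_scaleR]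
  and Ck_mult = Ck_bilinear[OF bounded_bilinear_mult]
  and Ck_inner = Ck_bilinear[OF bounded_bilinear_inner]

lemma Ck_sum: "(\<And>i. i \<in> I \<Longrightarrow> Ck k (f i)) \<Longrightarrow> Ck k (\<lambda>x. \<Sum>i\<in>I. f i x)"
  by (induction I rule: infinite_finite_induct) (simp_all add: Ck_const Ck_add)

lemma Ck_compose: "Ck k f \<Longrightarrow> Ck k g \<Longrightarrow> Ck k (\<lambda>x. f (g x))"
proof (induction k arbitrary: f g)
  case 0
  then show ?case by (auto intro: continuous_on_compose2)
next
  case (Suc k)
  let ?Df = "\<lambda>x. frechet_derivative f (at x)" and ?Dg = "\<lambda>x. frechet_derivative g (at x)"
  have Df: "(f has_derivative ?Df x) (at x)" for x using Suc.prems(1) by (rule Ck_Suc_has_derivative)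
  have 1: "((\<lambda>x. f (g x)) has_derivative (\<lambda>v. ?Df (g x) (?Dg x v))) (at x)" for x
    by (rule has_derivative_compose[OF Ck_Suc_has_derivative[OF Suc.prems(2)] Df])
  \<comment> \<open>The chain rule applies the derivative of \<open>f\<close> in a direction that
    varies with \<open>x\<close>, while \<open>Ck\<close> speaks of fixed directions; expanding that
    direction in the basis reduces it to fixed ones.\<close>
  have 2: "?Df (g x) (?Dg x v) = (\<Sum>b\<in>Basis. (?Dg x v \<bullet> b) *\<^sub>R ?Df (g x) b)" for x v
  proof -
    have lin: "linear (?Df (g x))" using Df has_derivative_linear by blast
    have "?Df (g x) (?Dg x v) = ?Df (g x) (\<Sum>b\<in>Basis. (?Dg x v \<bullet> b) *\<^sub>R b)"
      by (simp add: euclidean_representation)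
    then show ?thesis by (simp add: linear_sum[OF lin] linear_scale[OF lin])
  qed
  have "Ck k (\<lambda>x. ?Df (g x) b)" for b
    using Suc.IH[OF Ck_frechet[OF Suc.prems(1)] Ck_Suc_imp[OF Suc.prems(2)]] .
  moreover have "Ck k (\<lambda>x. ?Dg x v \<bullet> b)" for v b
    by (intro Ck_inner Ck_const Ck_frechet Suc.prems)
  ultimately show ?case
    by (intro Ck_SucI[OF 1]) (auto simp: 2 intro!: Ck_sum Ck_scaleR)
qed

lemma Ck_linear_compose: "bounded_linear L \<Longrightarrow> Ck k f \<Longrightarrow> Ck k (\<lambda>x. L (f x))"
  using Ck_compose Ck_bounded_linear by blast

lemmas Ck_fst = Ck_linear_compose[OF bounded_linear_fst]
  and Ck_snd = Ck_linear_compose[OF bounded_linear_snd]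
  and Ck_vec_nth = Ck_linear_compose[OF bounded_linear_vec_nth]
  and Ck_minus = Ck_linear_compose[OF bounded_linear_minus[OF bounded_linear_ident]]
  and Ck_id = Ck_bounded_linear[OF bounded_linear_ident]

lemma Ck_diff: "Ck k f \<Longrightarrow> Ck k g \<Longrightarrow> Ck k (\<lambda>x. f x - g x)"
  using Ck_add[OF _ Ck_minus, of k f g] by simp

lemma Ck_Pair: "Ck k f \<Longrightarrow> Ck k g \<Longrightarrow> Ck k (\<lambda>x. (f x, g x))"
  using Ck_add[OF Ck_linear_compose[of "\<lambda>y. (y, 0)" k f] Ck_linear_compose[of "\<lambda>y. (0, y)" k g]]
  by (simp add: bounded_linear_Pair bounded_linear_ident bounded_linear_zero)

lemma Ck_componentwise:
  assumes "\<And>b. b \<in> Basis \<Longrightarrow> Ck k (\<lambda>x. f x \<bullet> b)"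
  shows "Ck k f"
proof -
  have "Ck k (\<lambda>x. \<Sum>b\<in>Basis. (f x \<bullet> b) *\<^sub>R b)"
    by (intro Ck_sum Ck_scaleR Ck_const assms)
  then show ?thesis by (simp add: euclidean_representation)
qed

lemma Ck_power: "Ck k f \<Longrightarrow> Ck k (\<lambda>x. (f x :: real) ^ n)"
  by (induction n) (simp_all add: Ck_const Ck_mult)

lemma Ck_real_SucI:
  fixes f :: "real \<Rightarrow> real"
  assumes "\<And>x. (f has_real_derivative f' x) (at x)" "Ck k f'"
  shows "Ck (Suc k) f"
  by (rule Ck_SucI[OF assms(1)[unfolded has_field_derivative_def]]) (intro Ck_mult Ck_const assms)

lemmas Ck_intros = Ck_const Ck_id Ck_add Ck_diff Ck_minus Ck_mult Ck_scaleR Ck_inner Ck_power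
  Ck_fst Ck_snd Ck_vec_nth Ck_Pair Ck_sum

section \<open>Parameter integrals and mixed partial derivatives\<close>

lemma continuous_on_Pair_const: "continuous_on A (Pair x)"
  using continuous_on_Pair[OF continuous_on_const continuous_on_id, of A x] by simp

text \<open>Differentiation under the integral, repeated by induction: each directional derivative
  is again a parameter integral of the same shape, one class lower. It makes the primitive in
  \<open>exists_primitive\<close> jointly smooth in time and space.\<close>

lemma Ck_integral:
  fixes f :: "'a::euclidean_space \<Rightarrow> real \<Rightarrow> 'b::euclidean_space"
  assumes "Ck k (\<lambda>(x, s). f x s)"
  shows "Ck k (\<lambda>x. integral {a..b} (f x))"
  using assms
proof (induction k arbitrary: f)
  case 0
  then have "continuous_on (UNIV \<times> cbox a b) (\<lambda>(x, s). f x s)"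
    using continuous_on_subset by (auto simp: split_def)
  from integral_continuous_on_param[OF this] show ?case by simp
next
  case (Suc k)
  let ?D = "\<lambda>x s v. frechet_derivative (\<lambda>(x, s). f x s) (at (x, s)) (v, 0)"
  have D: "((\<lambda>x. f x s) has_derivative ?D x s) (at x)" for x s
    using has_derivative_compose[OF _ Ck_Suc_has_derivative[OF Suc.prems], of "\<lambda>x. (x, s)" "\<lambda>v. (v, 0)" x UNIV]
    by (simp add: has_derivative_Pair has_derivative_ident has_derivative_const)
  have CD: "Ck k (\<lambda>(x, s). ?D x s v)" for v
    using Ck_frechet[OF Suc.prems, of "(v, 0)"] by (simp add: split_def)
  have cont: "continuous_on UNIV (\<lambda>(x, s). ?D x s v)" for v
    using CD[of v] by (rule Ck_imp_continuous_on)
  have bl: "bounded_linear (?D x s)" for x s using D has_derivative_bounded_linear by blast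
  \<comment> \<open>\<open>leibniz_rule\<close> takes the derivative as a continuous function into
    the bounded linear maps; in finite dimension continuity in each direction suffices.\<close>
  let ?B = "\<lambda>x s. Blinfun (?D x s)"
  have app: "blinfun_apply (?B x s) = ?D x s" for x s
    using bl by (simp add: bounded_linear_Blinfun_apply)
  have contB: "continuous_on UNIV (\<lambda>z. ?B (fst z) (snd z))"
  proof (rule continuous_on_blinfun_componentwise)
    fix i :: 'a
    show "continuous_on UNIV (\<lambda>z. blinfun_apply (?B (fst z) (snd z)) i)"
      unfolding app using cont[of i] by (simp add: split_def)
  qed
  have int: "f x integrable_on cbox a b" for x
    using continuous_on_compose2[OF Ck_imp_continuous_on[OF Suc.prems, of UNIV], of "{a..b}" "\<lambda>s. (x, s)"]
    by (intro integrable_continuous) (auto intro!: continuous_on_Pair_const)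
  have H1: "((\<lambda>x. integral (cbox a b) (f x)) has_derivative integral (cbox a b) (?B x)) (at x within UNIV)" for x
  proof (rule leibniz_rule[OF _ int])
    show "((\<lambda>x. f x t) has_derivative blinfun_apply (?B x t)) (at x within UNIV)" for x t
      unfolding app using D by simp
    show "continuous_on (UNIV \<times> cbox a b) (\<lambda>(x, s). ?B x s)"
      using continuous_on_subset[OF contB subset_UNIV] by (simp only: split_def)
  qed simp_all
  have H2: "blinfun_apply (integral (cbox a b) (?B x)) v = integral {a..b} (\<lambda>s. ?D x s v)" for x v
  proof -
    have "?B x integrable_on cbox a b"
      using continuous_on_compose2[OF contB continuous_on_Pair_const[of "cbox a b" x]]
      by (intro integrable_continuous) simp
    then show ?thesis by (simp add: blinfun_apply_integral app)
  qed
  have "((\<lambda>x. integral {a..b} (f x)) has_derivative (\<lambda>v. integral {a..b} (\<lambda>s. ?D x s v))) (at x)" for x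
  proof -
    have "blinfun_apply (integral (cbox a b) (?B x)) = (\<lambda>v. integral {a..b} (\<lambda>s. ?D x s v))"
      using H2 by (intro ext)
    from has_derivative_eq_rhs[OF H1 this] show ?thesis by (simp only: box_real)
  qed
  then show ?case
    by (rule Ck_SucI) (intro Suc.IH CD)
qed

lemma Ck_has_vector_derivative_comp:
  assumes "Ck (Suc k) f" "(c has_vector_derivative c') (at a within S)"
  shows "((\<lambda>s. f (c s)) has_vector_derivative frechet_derivative f (at (c a)) c') (at a within S)"
proof -
  have "(f has_derivative frechet_derivative f (at (c a))) (at (c a) within c ` S)"
    using Ck_Suc_has_derivative[OF assms(1)] has_derivative_at_withinI by blast
  from vector_derivative_diff_chain_within[OF assms(2) this] show ?thesis by (simp add: o_def)
qed

text \<open>Schwarz's theorem from the fundamental theorem of calculus: write \<open>f s y\<close>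
  as \<open>f s a\<close> plus the integral of its derivative in the second argument, differentiate
  in \<open>s\<close> under the integral, then in \<open>y\<close>.\<close>

lemma Ck_mixed_partials:
  fixes f :: "real \<Rightarrow> real \<Rightarrow> 'a::euclidean_space"
  assumes "Ck 2 (\<lambda>(s, r). f s r)"
  shows "((\<lambda>r. vector_derivative (\<lambda>s. f s r) (at s)) has_vector_derivative
      vector_derivative (\<lambda>s. vector_derivative (\<lambda>r. f s r) (at r)) (at s)) (at r)"
proof -
  let ?f = "\<lambda>(s, r). f s r"
  let ?D = "\<lambda>v z. frechet_derivative ?f (at z) v"
  have C: "Ck (Suc (Suc 0)) ?f" using assms by (simp add: numeral_2_eq_2)
  have C1: "Ck (Suc 0) (?D v)" for v using Ck_frechet[OF C] by simp
  have hs: "((\<lambda>s. h (s, r)) has_vector_derivative frechet_derivative h (at (s, r)) (1, 0)) (at s)"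
    and hr: "((\<lambda>r. h (s, r)) has_vector_derivative frechet_derivative h (at (s, r)) (0, 1)) (at r)"
    if "Ck (Suc k) h" for h :: "real \<times> real \<Rightarrow> 'a" and s r k
    using Ck_has_vector_derivative_comp[OF that, of "\<lambda>s'. (s', r)" "(1, 0)" s UNIV]
      Ck_has_vector_derivative_comp[OF that, of "\<lambda>r'. (s, r')" "(0, 1)" r UNIV]
    by (simp_all add: has_vector_derivative_def has_derivative_Pair has_derivative_ident has_derivative_const)
  define fs where "fs = (\<lambda>s r. vector_derivative (\<lambda>s. f s r) (at s))"
  define fr where "fr = (\<lambda>s r. vector_derivative (\<lambda>r. f s r) (at r))"
  define frs where "frs = (\<lambda>s r. vector_derivative (\<lambda>s. fr s r) (at s))"
  have fs_D: "fs s r = ?D (1, 0) (s, r)" and fr_eq: "fr s r = ?D (0, 1) (s, r)" for s r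
    using hs[OF C, of r s] hr[OF C, of s r] by (auto simp: fs_def fr_def intro: vector_derivative_at)
  have fs: "((\<lambda>s. f s r) has_vector_derivative fs s r) (at s)"
    and fr: "((\<lambda>r. f s r) has_vector_derivative fr s r) (at r)" for s r
    using hs[OF C, of r s] hr[OF C, of s r] by (auto simp: fs_D fr_eq)
  have "(\<lambda>(s, r). fr s r) = ?D (0, 1)" by (auto simp: fr_eq)
  then have Cfr: "Ck (Suc 0) (\<lambda>(s, r). fr s r)" using C1 by (simp only:)
  have frs: "((\<lambda>s. fr s r) has_vector_derivative frs s r) (at s)"
    and frs_eq: "frs s r = frechet_derivative (\<lambda>(s, r). fr s r) (at (s, r)) (1, 0)" for s r
  proof -
    show eq: "frs s r = frechet_derivative (\<lambda>(s, r). fr s r) (at (s, r)) (1, 0)" for s r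
      using hs[OF Cfr, of r s] by (auto simp: frs_def intro: vector_derivative_at)
    show "((\<lambda>s. fr s r) has_vector_derivative frs s r) (at s)"
      using hs[OF Cfr, of r s] by (simp add: eq)
  qed
  have cfrs: "continuous_on A (\<lambda>(s, r). frs s r)" for A
    using Ck_imp_continuous_on[OF Ck_frechet[OF Cfr], of A "(1, 0)"] by (simp only: frs_eq split_def prod.collapse)
  have cfr: "continuous_on A (\<lambda>(s, r). fr s r)" for A
    using Cfr by (rule Ck_imp_continuous_on)
  \<comment> \<open>Any base point below \<open>r\<close> serves; it makes \<open>r\<close> interior
    to \<open>{a..r+1}\<close>, so that the derivative of the integral within this interval is
    two-sided.\<close>
  define a where "a = r - 1"
  have FTC: "f s y = f s a + integral {a..y} (fr s)" if "a \<le> y" for s y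
  proof -
    have "(fr s has_integral (f s y - f s a)) {a..y}"
      by (rule fundamental_theorem_of_calculus[OF that]) (use fr has_vector_derivative_at_within in blast)
    then show ?thesis by (simp add: integral_unique)
  qed
  have sec: "continuous_on B (h s)" if "continuous_on UNIV (\<lambda>(s, r). h s r)" for h :: "real \<Rightarrow> real \<Rightarrow> 'a" and s B
    using continuous_on_compose2[OF that continuous_on_Pair_const] by simp
  have int: "fr s integrable_on cbox a y" for s y
    by (intro integrable_continuous sec cfr)
  have L: "((\<lambda>s. integral (cbox a y) (fr s)) has_vector_derivative integral (cbox a y) (frs s)) (at s within UNIV)" for s y
    by (rule leibniz_rule_vector_derivative[OF _ int]) (use frs cfrs in auto)
  have fs_eq: "fs s y = fs s a + integral {a..y} (frs s)" if "a \<le> y" for s y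
  proof -
    have "((\<lambda>s. f s a + integral {a..y} (fr s)) has_vector_derivative fs s a + integral {a..y} (frs s)) (at s)"
      using has_vector_derivative_add[OF fs L[of y s]] by simp
    then have "((\<lambda>s. f s y) has_vector_derivative fs s a + integral {a..y} (frs s)) (at s)"
      using FTC[OF that] by (simp only:)
    with fs[of y s] show ?thesis by (rule vector_derivative_unique_at)
  qed
  have "((\<lambda>y. integral {a..y} (frs s)) has_vector_derivative frs s r) (at r within {a..r+1})"
    by (rule integral_has_vector_derivative[OF sec[OF cfrs]]) (simp add: a_def)
  moreover have "at r within {a..r+1} = at r"
    by (rule at_within_interior) (simp add: a_def)
  ultimately have "((\<lambda>y. integral {a..y} (frs s)) has_vector_derivative frs s r) (at r)"
    by simp
  from has_vector_derivative_add[OF has_vector_derivative_const[of "fs s a"] this]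
  have "((\<lambda>y. fs s a + integral {a..y} (frs s)) has_vector_derivative frs s r) (at r)"
    by simp
  then have "(fs s has_vector_derivative frs s r) (at r)"
    by (rule has_vector_derivative_transform_within_open[of _ _ _ "{a<..}"])
      (use fs_eq[symmetric] in \<open>simp_all add: a_def\<close>)
  then show ?thesis by (simp add: fs_def frs_def fr_def)
qed

section \<open>The planar logarithmic kernel\<close>

text \<open>\<open>ker1\<close> and \<open>ker2\<close> are the partial derivatives of ln |w|,
  equivalently the real part and minus the imaginary part of 1/w. At the origin both are 0, since
  division by zero gives 0.\<close>

definition ker1 :: "real \<times> real \<Rightarrow> real" where "ker1 w = fst w / ((fst w)\<^sup>2 + (snd w)\<^sup>2)"
definition ker2 :: "real \<times> real \<Rightarrow> real" where "ker2 w = snd w / ((fst w)\<^sup>2 + (snd w)\<^sup>2)"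

lemma borel_measurable_ker [measurable]:
  "ker1 \<in> borel_measurable borel" "ker2 \<in> borel_measurable borel"
  unfolding ker1_def[abs_def] ker2_def[abs_def] borel_prod[symmetric] by measurable

lemma has_bochner_integral_inverse_1_plus_square:
  "has_bochner_integral lborel (\<lambda>t::real. inverse (1 + t\<^sup>2)) pi"
  using integrable_inverse_1_plus_square LBINT_inverse_1_plus_square
  by (simp add: has_bochner_integral_iff interval_lebesgue_integral_def set_integrable_def
      set_lebesgue_integral_def)

lemma ker1_slope: "x \<noteq> 0 \<Longrightarrow> \<bar>x\<bar> * ker1 (x, x * t) = sgn x * inverse (1 + t\<^sup>2)"
proof -
  assume x: "x \<noteq> 0"
  have "1 + t\<^sup>2 > 0" by (rule add_pos_nonneg) simp_all
  moreover have "x\<^sup>2 + (x * t)\<^sup>2 = x\<^sup>2 * (1 + t\<^sup>2)" by (simp add: power_mult_distrib algebra_simps)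
  ultimately show ?thesis
    using x by (auto simp: ker1_def divide_simps sgn_if power2_eq_square)
qed

lemma ker2_slope: "x \<noteq> 0 \<Longrightarrow> ker2 (x, x * t) = t * ker1 (x, x * t)"
  by (simp add: ker1_def ker2_def)

text \<open>The substitution y = x t turns the integral over each vertical line into that of 1/(1 +
  t^2), whatever \<open>x\<close> is.\<close>

lemma nn_integral_ker1_fibre:
  assumes "x \<noteq> 0"
  shows "(\<integral>\<^sup>+y. ennreal \<bar>ker1 (x, y)\<bar> \<partial>lborel) = ennreal pi"
proof -
  have "(\<integral>\<^sup>+y. ennreal \<bar>ker1 (x, y)\<bar> \<partial>lborel) = \<bar>x\<bar> * (\<integral>\<^sup>+t. ennreal \<bar>ker1 (x, 0 + x * t)\<bar> \<partial>lborel)"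
    by (rule nn_integral_real_affine[OF _ assms])
      (intro measurable_compose[OF _ measurable_ennreal] borel_measurable_abs
        measurable_compose[OF borel_measurable_continuous_onI[OF continuous_on_Pair_const] borel_measurable_ker(1)])
  also have "\<dots> = (\<integral>\<^sup>+t. ennreal (inverse (1 + t\<^sup>2)) \<partial>lborel)"
  proof (subst nn_integral_cmult[symmetric])
    have "\<bar>x\<bar> * \<bar>ker1 (x, x * t)\<bar> = inverse (1 + t\<^sup>2)" for t
    proof -
      have "\<bar>x\<bar> * \<bar>ker1 (x, x * t)\<bar> = \<bar>sgn x * inverse (1 + t\<^sup>2)\<bar>"
        unfolding ker1_slope[OF assms, symmetric] by (simp add: abs_mult)
      also have "\<dots> = inverse (1 + t\<^sup>2)"
        using assms by (simp add: abs_mult abs_sgn_eq_1 abs_of_nonneg)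
      finally show ?thesis .
    qed
    note eq = this
    show "(\<lambda>t. ennreal \<bar>ker1 (x, 0 + x * t)\<bar>) \<in> borel_measurable lborel"
      unfolding measurable_lborel2
      by (intro measurable_compose[OF _ measurable_ennreal] borel_measurable_abs
        measurable_compose[OF _ borel_measurable_ker(1)]
        borel_measurable_continuous_onI continuous_intros)
    from eq show "(\<integral>\<^sup>+t. ennreal \<bar>x\<bar> * ennreal \<bar>ker1 (x, 0 + x * t)\<bar> \<partial>lborel) = (\<integral>\<^sup>+t. ennreal (inverse (1 + t\<^sup>2)) \<partial>lborel)"
      by (simp add: ennreal_mult[symmetric])
  qed
  also have "\<dots> = ennreal pi"
    using has_bochner_integral_inverse_1_plus_square
    by (subst nn_integral_eq_integral) (auto simp: has_bochner_integral_iff)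
  finally show ?thesis .
qed

text \<open>Every vertical line but one carries the same mass pi, so a strip of finite width has
  finite mass although it is unbounded and the kernel is singular at the origin.\<close>

lemma integrable_ker1_strip:
  "integrable lborel (\<lambda>w. indicator {-R..R} (fst w) * ker1 w)"
proof (rule integrableI_bounded)
  show m [measurable]: "(\<lambda>w. indicator {-R..R} (fst w) * ker1 w) \<in> borel_measurable lborel"
  proof -
    have "(\<lambda>w :: real \<times> real. indicator {-R..R} (fst w) :: real) \<in> borel_measurable borel"
      by (rule measurable_compose[of fst borel borel])
        (auto intro!: borel_measurable_continuous_onI continuous_intros)
    from borel_measurable_times[OF this borel_measurable_ker(1)] show ?thesis by simp
  qed
  have "(\<integral>\<^sup>+w. norm (indicator {-R..R} (fst w) * ker1 w) \<partial>lborel)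
      = (\<integral>\<^sup>+x. \<integral>\<^sup>+y. norm (indicator {-R..R} x * ker1 (x, y)) \<partial>lborel \<partial>lborel)"
    by (subst lborel_prod[symmetric], subst lborel.nn_integral_fst[symmetric])
      (use m in \<open>simp_all add: borel_prod lborel_prod\<close>)
  also have "\<dots> = (\<integral>\<^sup>+x. indicator {-R..R} x * ennreal pi \<partial>lborel)"
  proof (rule nn_integral_cong_AE)
    show "AE x in lborel. (\<integral>\<^sup>+y. norm (indicator {-R..R} x * ker1 (x, y)) \<partial>lborel) = indicator {-R..R} x * ennreal pi"
      using AE_lborel_singleton[of 0]
      by eventually_elim (simp add: nn_integral_ker1_fibre indicator_def)
  qed
  also have "\<dots> < \<infinity>"
    using emeasure_lborel_box_finite[of "-R" R]
    by (simp add: nn_integral_multc ennreal_mult_less_top emeasure_lborel_Icc_eq)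
  finally show "(\<integral>\<^sup>+w. norm (indicator {-R..R} (fst w) * ker1 w) \<partial>lborel) < \<infinity>" .
qed

lemma integrable_lborel_swap:
  fixes f :: "real \<times> real \<Rightarrow> real"
  assumes "integrable lborel f" shows "integrable lborel (\<lambda>(x, y). f (y, x))"
  using lborel_pair.integrable_product_swap[of f] assms by (simp add: lborel_prod)

lemma integral_lborel_swap:
  fixes f :: "real \<times> real \<Rightarrow> real"
  assumes "f \<in> borel_measurable borel" shows "(LINT (x, y)|lborel. f (y, x)) = (LINT z|lborel. f z)"
  using lborel_pair.integral_product_swap[of f] assms by (simp add: lborel_prod)

lemma integrable_ker2_strip:
  "integrable lborel (\<lambda>w. indicator {-R..R} (snd w) * ker2 w)"
  using integrable_lborel_swap[OF integrable_ker1_strip[of R]]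
  by (simp add: ker1_def ker2_def split_def add.commute)

lemma integral_lborel_reflect:
  fixes f :: "'a::euclidean_space \<Rightarrow> 'b::{banach, second_countable_topology}"
  assumes [measurable]: "f \<in> borel_measurable borel"
  shows "(LINT w|lborel. f (c - w)) = (LINT z|lborel. f z)"
proof -
  have "(lborel :: 'a measure) = distr lborel borel (\<lambda>w. c - w)"
    using lborel_affine[of "-1" c] by (simp add: density_1)
  then have "(LINT z|lborel. f z) = (LINT z|distr lborel borel (\<lambda>w. c - w). f z)" by simp
  also have "\<dots> = (LINT w|lborel. f (c - w))" by (rule integral_distr) simp_all
  finally show ?thesis by simp
qed

lemma nn_integral_lborel_reflect:
  fixes f :: "'a::euclidean_space \<Rightarrow> ennreal"
  assumes [measurable]: "f \<in> borel_measurable borel"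
  shows "(\<integral>\<^sup>+w. f (c - w) \<partial>lborel) = (\<integral>\<^sup>+z. f z \<partial>lborel)"
proof -
  have "(lborel :: 'a measure) = distr lborel borel (\<lambda>w. c - w)"
    using lborel_affine[of "-1" c] by (simp add: density_1)
  then have "(\<integral>\<^sup>+z. f z \<partial>lborel) = (\<integral>\<^sup>+z. f z \<partial>distr lborel borel (\<lambda>w. c - w))" by simp
  also have "\<dots> = (\<integral>\<^sup>+w. f (c - w) \<partial>lborel)" by (rule nn_integral_distr) simp_all
  finally show ?thesis by simp
qed

section \<open>Pompeiu's formula for compactly supported functions\<close>

locale plane_test =
  fixes g gx gy :: "real \<times> real \<Rightarrow> real" and R :: real
  assumes deriv: "\<And>z. (g has_derivative (\<lambda>h. gx z * fst h + gy z * snd h)) (at z)"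
    and cont: "continuous_on UNIV gx" "continuous_on UNIV gy"
    and supp: "\<And>z. \<bar>fst z\<bar> > R \<or> \<bar>snd z\<bar> > R \<Longrightarrow> g z = 0 \<and> gx z = 0 \<and> gy z = 0"
begin

lemma cont_g: "continuous_on UNIV g"
  using deriv by (meson continuous_at_imp_continuous_on has_derivative_continuous)

lemma meas [measurable]: "g \<in> borel_measurable borel" "gx \<in> borel_measurable borel" "gy \<in> borel_measurable borel"
  using cont cont_g borel_measurable_continuous_onI by blast+

lemma bounded_all: obtains M where "\<And>z. \<bar>g z\<bar> \<le> M" "\<And>z. \<bar>gx z\<bar> \<le> M" "\<And>z. \<bar>gy z\<bar> \<le> M" "0 \<le> M"
proof -
  let ?h = "\<lambda>z. \<bar>g z\<bar> + \<bar>gx z\<bar> + \<bar>gy z\<bar>"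
  have "continuous_on UNIV ?h" by (intro continuous_intros cont cont_g)
  then have "compact (?h ` cbox (-R, -R) (R, R))"
    using compact_continuous_image[OF continuous_on_subset compact_cbox] by blast
  then have "bounded (?h ` cbox (-R, -R) (R, R))" by (rule compact_imp_bounded)
  then obtain M where M: "\<And>z. z \<in> cbox (-R, -R) (R, R) \<Longrightarrow> \<bar>?h z\<bar> \<le> M"
    unfolding bounded_iff by auto
  have "?h z \<le> \<bar>M\<bar>" for z
  proof (cases "z \<in> cbox (-R, -R) (R, R)")
    case True then show ?thesis using M[OF True] by linarith
  next
    case False
    then have "\<bar>fst z\<bar> > R \<or> \<bar>snd z\<bar> > R" by (cases z) (auto simp: cbox_Pair_eq)
    then show ?thesis using supp by auto
  qed
  note h = this
  have "\<bar>g z\<bar> \<le> \<bar>M\<bar>" "\<bar>gx z\<bar> \<le> \<bar>M\<bar>" "\<bar>gy z\<bar> \<le> \<bar>M\<bar>" for z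
    using h[of z] by linarith+
  then show ?thesis by (rule that[of "\<bar>M\<bar>"]) simp
qed

text \<open>The bounded support of \<open>h\<close> cuts the kernel down to a strip, vertical for
  \<open>ker1\<close> and horizontal for \<open>ker2\<close>, on which it is integrable.\<close>

lemma integrable_comp_ker:
  assumes h: "h \<in> {g, gx, gy}" and k: "k \<in> {ker1, ker2}"
  shows "integrable lborel (\<lambda>w. h (z - w) * k w)"
proof -
  obtain M where M: "\<And>z. \<bar>h z\<bar> \<le> M" "0 \<le> M" using bounded_all h by (metis insertE singletonD)
  define R' where "R' = R + \<bar>fst z\<bar> + \<bar>snd z\<bar>"
  have [measurable]: "h \<in> borel_measurable borel" "k \<in> borel_measurable borel" using h k meas borel_measurable_ker by auto
  have s: "h (z - w) = 0" if "\<bar>fst w\<bar> > R' \<or> \<bar>snd w\<bar> > R'" for w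
  proof -
    have "\<bar>fst (z - w)\<bar> > R \<or> \<bar>snd (z - w)\<bar> > R" using that by (auto simp: R'_def abs_if split: if_splits)
    then show ?thesis using supp[of "z - w"] h by auto
  qed
  have "integrable lborel (\<lambda>w. M * (indicator {-R'..R'} (fst w) * ker1 w))"
    "integrable lborel (\<lambda>w. M * (indicator {-R'..R'} (snd w) * ker2 w))"
    using integrable_ker1_strip integrable_ker2_strip by auto
  note int = this
  have m: "(\<lambda>w. h (z - w) * k w) \<in> borel_measurable lborel" by simp
  have b1: "\<bar>h (z - w) * k w\<bar> \<le> \<bar>M * (indicator {-R'..R'} (fst w) * k w)\<bar>" for w
  proof (cases "\<bar>fst w\<bar> > R'")
    case False
    then show ?thesis using mult_right_mono[OF M(1)[of "z - w"], of "\<bar>k w\<bar>"] M(2)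
      by (auto simp: abs_mult abs_le_iff indicator_def)
  qed (simp add: s)
  have b2: "\<bar>h (z - w) * k w\<bar> \<le> \<bar>M * (indicator {-R'..R'} (snd w) * k w)\<bar>" for w
  proof (cases "\<bar>snd w\<bar> > R'")
    case False
    then show ?thesis using mult_right_mono[OF M(1)[of "z - w"], of "\<bar>k w\<bar>"] M(2)
      by (auto simp: abs_mult abs_le_iff indicator_def)
  qed (simp add: s)
  show ?thesis
  proof (cases "k = ker1")
    case True
    show ?thesis by (rule Bochner_Integration.integrable_bound[OF int(1) m]) (use b1 True in simp)
  next
    case False
    then have "k = ker2" using k by simp
    then show ?thesis by (intro Bochner_Integration.integrable_bound[OF int(2) m]) (use b2 in simp)
  qed
qed

text \<open>Along the line through \<open>z\<close> of slope \<open>t\<close> the bracket is minus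
  the derivative of g(z - (x, x t)) in x. By compact support each of the two half-lines contributes
  \<open>g z\<close>, with equal signs thanks to \<open>sgn x\<close>.\<close>

lemma ray_integral:
  "has_bochner_integral lborel (\<lambda>x. sgn x * (gx (z - (x, x * t)) + t * gy (z - (x, x * t)))) (2 * g z)"
proof -
  define G where "G x = g (z - (x, x * t))" for x
  define G' where "G' x = - (gx (z - (x, x * t)) + t * gy (z - (x, x * t)))" for x
  have dG: "DERIV G x :> G' x" for x
  proof -
    have "((\<lambda>x. z - (x, x * t)) has_derivative (\<lambda>h. - (h, h * t))) (at x)"
      by (auto intro!: derivative_eq_intros)
    from has_derivative_compose[OF this deriv] show ?thesis
      unfolding G_def G'_def has_field_derivative_def
      by (rule has_derivative_eq_rhs) (auto simp: fun_eq_iff algebra_simps)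
  qed
  have cG: "isCont G' x" for x
    unfolding G'_def
  proof -
    have "continuous_on UNIV (\<lambda>x. - (gx (z - (x, x * t)) + t * gy (z - (x, x * t))))"
      by (intro continuous_intros continuous_on_compose2[OF cont(1)] continuous_on_compose2[OF cont(2)]) auto
    then show "isCont (\<lambda>x. - (gx (z - (x, x * t)) + t * gy (z - (x, x * t)))) x"
      by (simp add: continuous_on_eq_continuous_at)
  qed
  \<comment> \<open>Beyond \<open>N\<close> the first coordinate alone leaves the support square;
    the absolute value keeps \<open>N\<close> nonnegative whatever the sign of
    \<open>R\<close>.\<close>
  define N where "N = \<bar>R\<bar> + \<bar>fst z\<bar> + 1"
  have N: "N \<ge> 0" by (simp add: N_def)
  have out: "G' x = 0" "G x = 0" if "\<bar>x\<bar> \<ge> N" for x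
    using that supp[of "z - (x, x * t)"] by (simp_all add: G_def G'_def N_def abs_if split: if_splits)
  have I: "has_bochner_integral lborel (\<lambda>x. - (G' x * indicator {0..N} x) + G' x * indicator {-N..0} x)
      (- (G N - G 0) + (G 0 - G (-N)))"
    by (intro has_bochner_integral_add has_bochner_integral_minus has_bochner_integral_FTC_Icc_real dG cG)
      (use N in auto)
  have V: "- (G N - G 0) + (G 0 - G (-N)) = 2 * g z"
    using out(2)[of N] out(2)[of "-N"] N by (simp add: G_def zero_prod_def[symmetric])
  have AE: "AE x in lborel. - (G' x * indicator {0..N} x) + G' x * indicator {-N..0} x
      = sgn x * (gx (z - (x, x * t)) + t * gy (z - (x, x * t)))"
    using AE_lborel_singleton[of 0]
  proof eventually_elim
    case (elim x)
    have "gx (z - (x, x * t)) + t * gy (z - (x, x * t)) = - G' x" by (simp add: G'_def)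
    then show ?case using out(1)[of x] elim by (auto simp: indicator_def sgn_if)
  qed
  have "(\<lambda>x. - (G' x * indicator {0..N} x) + G' x * indicator {-N..0} x) \<in> borel_measurable lborel"
    "(\<lambda>x. sgn x * (gx (z - (x, x * t)) + t * gy (z - (x, x * t)))) \<in> borel_measurable lborel"
  proof -
    have c: "continuous_on UNIV G'" using cG by (simp add: continuous_on_eq_continuous_at)
    have [measurable]: "G' \<in> borel_measurable borel" using c by (rule borel_measurable_continuous_onI)
    show "(\<lambda>x. - (G' x * indicator {0..N} x) + G' x * indicator {-N..0} x) \<in> borel_measurable lborel" by simp
    have "(\<lambda>x. sgn x * (gx (z - (x, x * t)) + t * gy (z - (x, x * t)))) = (\<lambda>x. sgn x * - G' x)"
      unfolding G'_def minus_minus ..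
    then show "(\<lambda>x. sgn x * (gx (z - (x, x * t)) + t * gy (z - (x, x * t)))) \<in> borel_measurable lborel"
      by simp
  qed
  note m = this
  show ?thesis
    using I unfolding V has_bochner_integral_cong_AE[OF m AE] .
qed

lemma integrable_grad_ker:
  "integrable lborel (\<lambda>w. gx (z - w) * ker1 w + gy (z - w) * ker2 w)"
  by (intro Bochner_Integration.integrable_add integrable_comp_ker) auto

text \<open>The substitution \<open>y = x t\<close> plays the role of polar coordinates: on each ray through the
  origin the integrand is an exact derivative.\<close>

lemma integral_grad_ker:
  "(LINT w|lborel. gx (z - w) * ker1 w + gy (z - w) * ker2 w) = 2 * pi * g z"
proof -
  define H where "H w = gx (z - w) * ker1 w + gy (z - w) * ker2 w" for w
  have [measurable]: "H \<in> borel_measurable borel" unfolding H_def[abs_def] by measurable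
  have intH: "integrable (lborel \<Otimes>\<^sub>M lborel) H"
    using integrable_grad_ker by (simp add: lborel_prod H_def[abs_def])
  \<comment> \<open>The factor \<open>\<bar>x\<bar>\<close> is the Jacobian of the substitution y =
    x t.\<close>
  define Q where "Q = (\<lambda>(x, t). \<bar>x\<bar> * H (x, x * t))"
  have Qm [measurable]: "Q \<in> borel_measurable (lborel \<Otimes>\<^sub>M lborel)"
  proof -
    have "(\<lambda>p :: real \<times> real. (fst p, fst p * snd p)) \<in> borel_measurable borel"
      by (intro borel_measurable_continuous_onI continuous_intros)
    from measurable_compose[OF this, of H borel]
    have "(\<lambda>p. \<bar>fst p\<bar> * H (fst p, fst p * snd p)) \<in> borel_measurable borel"
      by (intro borel_measurable_times borel_measurable_continuous_onI[of "\<lambda>p. \<bar>fst p\<bar>"] continuous_intros) auto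
    then show ?thesis by (simp add: Q_def split_def lborel_prod)
  qed
  have Hsec: "H \<circ> Pair x \<in> borel_measurable borel" for x
    unfolding o_def
    by (rule measurable_compose[of "Pair x" borel borel H])
      (auto intro!: borel_measurable_continuous_onI continuous_on_Pair_const)
  \<comment> \<open>The substitution acts on each vertical line separately. Tonelli's theorem
    carries integrability over from \<open>H\<close> to \<open>Q\<close>, and this permits
    exchanging the integrals in x and t.\<close>
  have intQ: "integrable (lborel \<Otimes>\<^sub>M lborel) Q"
  proof (rule integrableI_bounded[OF Qm])
    have "(\<integral>\<^sup>+p. norm (Q p) \<partial>(lborel \<Otimes>\<^sub>M lborel)) = (\<integral>\<^sup>+x. \<integral>\<^sup>+t. norm (Q (x, t)) \<partial>lborel \<partial>lborel)"
      by (subst lborel.nn_integral_fst[symmetric]) simp_all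
    also have "\<dots> = (\<integral>\<^sup>+x. \<integral>\<^sup>+y. norm (H (x, y)) \<partial>lborel \<partial>lborel)"
    proof (rule nn_integral_cong_AE)
      show "AE x in lborel. (\<integral>\<^sup>+t. norm (Q (x, t)) \<partial>lborel) = (\<integral>\<^sup>+y. norm (H (x, y)) \<partial>lborel)"
        using AE_lborel_singleton[of 0]
      proof eventually_elim
        case (elim x)
        have m: "(\<lambda>y. ennreal (norm (H (x, y)))) \<in> borel_measurable borel"
          using Hsec[of x] by (simp add: o_def)
        have m': "(\<lambda>t. ennreal (norm (H (x, x * t)))) \<in> borel_measurable lborel"
          using measurable_compose[OF _ m, of "\<lambda>t. x * t" lborel] by simp
        show ?case
          unfolding Q_def
          using nn_integral_real_affine[OF m elim, of 0] nn_integral_cmult[OF m', of "ennreal \<bar>x\<bar>"]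
          by (simp add: abs_mult ennreal_mult)
      qed
    qed
    also have "\<dots> = (\<integral>\<^sup>+p. norm (H p) \<partial>(lborel \<Otimes>\<^sub>M lborel))"
      by (subst lborel.nn_integral_fst[symmetric]) (simp_all add: lborel_prod)
    also have "\<dots> < \<infinity>" using intH by (simp add: integrable_iff_bounded)
    finally show "(\<integral>\<^sup>+p. norm (Q p) \<partial>(lborel \<Otimes>\<^sub>M lborel)) < \<infinity>" .
  qed
  have "(LINT w|lborel. H w) = (LINT x|lborel. LINT y|lborel. H (x, y))"
    using lborel_pair.integral_fst'[OF intH] by (simp add: lborel_prod)
  also have "\<dots> = (LINT x|lborel. LINT t|lborel. Q (x, t))"
  proof (rule integral_cong_AE)
    show "AE x in lborel. (LINT y|lborel. H (x, y)) = (LINT t|lborel. Q (x, t))"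
      using AE_lborel_singleton[of 0]
    proof eventually_elim
      case (elim x)
      show ?case using lborel_integral_real_affine[OF elim, of "\<lambda>y. H (x, y)" 0] by (simp add: Q_def)
    qed
  qed (intro borel_measurable_integrable lborel_pair.integrable_fst' intH intQ)+
  also have "\<dots> = (LINT t|lborel. LINT x|lborel. Q (x, t))"
    using lborel_pair.Fubini_integral[of "\<lambda>x t. Q (x, t)"] intQ by simp
  also have "\<dots> = (LINT t|lborel. 2 * g z * inverse (1 + t\<^sup>2))"
  proof (rule Bochner_Integration.integral_cong)
    fix t :: real
    have "Q (x, t) = sgn x * (gx (z - (x, x * t)) + t * gy (z - (x, x * t))) * inverse (1 + t\<^sup>2)" for x
    proof (cases "x = 0")
      case False
      have "Q (x, t) = (gx (z - (x, x * t)) + t * gy (z - (x, x * t))) * (\<bar>x\<bar> * ker1 (x, x * t))"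
        unfolding Q_def H_def prod.case ker2_slope[OF False] by (simp add: algebra_simps)
      then show ?thesis using ker1_slope[OF False, of t] by simp
    qed (simp add: Q_def)
    then show "(LINT x|lborel. Q (x, t)) = 2 * g z * inverse (1 + t\<^sup>2)"
      using has_bochner_integral_mult_left[OF ray_integral[of z t], of "inverse (1 + t\<^sup>2)"]
      by (simp add: has_bochner_integral_iff)
  qed simp
  also have "\<dots> = 2 * pi * g z"
    using has_bochner_integral_inverse_1_plus_square by (simp add: has_bochner_integral_iff)
  finally show ?thesis by (simp add: H_def)
qed

end

section \<open>Integrals against the angle under which an arc is seen\<close>

lemma integrable_fibrewise_bound:
  fixes F :: "real \<times> (real \<times> real) \<Rightarrow> real"
  assumes F: "F \<in> borel_measurable borel" and B: "(\<integral>\<^sup>+w. B w \<partial>lborel) < (\<infinity> :: ennreal)"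
    and le: "\<And>a. (\<integral>\<^sup>+z. norm (F (a, z)) \<partial>lborel) \<le> indicator {0..1} a * (\<integral>\<^sup>+w. B w \<partial>lborel)"
  shows "integrable (lborel \<Otimes>\<^sub>M lborel) F"
proof (rule integrableI_bounded)
  show m: "F \<in> borel_measurable (lborel \<Otimes>\<^sub>M lborel)" using F by (simp add: lborel_prod)
  have "(\<integral>\<^sup>+p. norm (F p) \<partial>(lborel \<Otimes>\<^sub>M lborel)) = (\<integral>\<^sup>+a. \<integral>\<^sup>+z. norm (F (a, z)) \<partial>lborel \<partial>lborel)"
    using m by (subst lborel.nn_integral_fst[symmetric]) auto
  also have "\<dots> \<le> (\<integral>\<^sup>+a. indicator {0..1} (a::real) * (\<integral>\<^sup>+w. B w \<partial>lborel) \<partial>lborel)"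
    by (intro nn_integral_mono le)
  also have "\<dots> = (\<integral>\<^sup>+w. B w \<partial>lborel)" by (simp add: nn_integral_multc)
  finally show "(\<integral>\<^sup>+p. norm (F p) \<partial>(lborel \<Otimes>\<^sub>M lborel)) < \<infinity>" using B by simp
qed

text \<open>The angle under which the arc is seen from \<open>z\<close>, that is the imaginary part of the contour
  integral of \<open>1 / (\<zeta> - z)\<close>.\<close>

definition arc_angle :: "(real \<Rightarrow> real \<times> real) \<Rightarrow> (real \<Rightarrow> real \<times> real) \<Rightarrow> real \<times> real \<Rightarrow> real" where
  "arc_angle c c' z = (LINT a|lborel. indicator {0..1} a *
     (ker1 (c a - z) * snd (c' a) - ker2 (c a - z) * fst (c' a)))"

context plane_test
begin

text \<open>One integrable majorant for all base points in a compact set, here the trace of the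
  curve; this is what justifies Fubini's theorem along the curve.\<close>

lemma uniform_kernel_bound:
  assumes "compact K"
  obtains B where "integrable lborel B" "\<And>w. 0 \<le> B w"
    "\<And>z w h k. z \<in> K \<Longrightarrow> h \<in> {gx, gy} \<Longrightarrow> k \<in> {ker1, ker2} \<Longrightarrow> \<bar>h (z - w) * k w\<bar> \<le> B w"
proof -
  obtain M where M: "\<And>z. \<bar>gx z\<bar> \<le> M" "\<And>z. \<bar>gy z\<bar> \<le> M" "0 \<le> M" using bounded_all by metis
  obtain D where D: "\<And>z. z \<in> K \<Longrightarrow> norm z \<le> D"
    using assms compact_imp_bounded bounded_iff by metis
  define R' where "R' = R + D"
  define B where "B w = M * (indicator {-R'..R'} (fst w) * \<bar>ker1 w\<bar> + indicator {-R'..R'} (snd w) * \<bar>ker2 w\<bar>)" for w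
  have "integrable lborel (\<lambda>w. \<bar>indicator {-R'..R'} (fst w) * ker1 w\<bar>)"
    "integrable lborel (\<lambda>w. \<bar>indicator {-R'..R'} (snd w) * ker2 w\<bar>)"
    using integrable_ker1_strip integrable_ker2_strip by (intro integrable_abs; blast)+
  then have int: "integrable lborel B"
    unfolding B_def by (intro integrable_mult_right Bochner_Integration.integrable_add) (simp_all add: abs_mult)
  have pos: "0 \<le> B w" for w unfolding B_def using M(3) by simp
  have bound: "\<bar>h (z - w) * k w\<bar> \<le> B w" if z: "z \<in> K" and h: "h \<in> {gx, gy}" and k: "k \<in> {ker1, ker2}" for z w h k
  proof (cases "\<bar>fst w\<bar> > R' \<or> \<bar>snd w\<bar> > R'")
    case True
    have "\<bar>fst z\<bar> \<le> D" "\<bar>snd z\<bar> \<le> D" using D[OF z] norm_fst_le[of "fst z" "snd z"] norm_snd_le[of "snd z" "fst z"] by simp_all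
    then have "\<bar>fst (z - w)\<bar> > R \<or> \<bar>snd (z - w)\<bar> > R" using True by (auto simp: R'_def)
    then have "h (z - w) = 0" using supp[of "z - w"] h by auto
    then show ?thesis using pos by simp
  next
    case False
    then have "B w = M * (\<bar>ker1 w\<bar> + \<bar>ker2 w\<bar>)" by (auto simp: B_def indicator_def abs_le_iff)
    moreover have "\<bar>k w\<bar> \<le> \<bar>ker1 w\<bar> + \<bar>ker2 w\<bar>" using k by auto
    moreover have "\<bar>h (z - w)\<bar> \<le> M" using M(1,2)[of "z - w"] h by blast
    ultimately show ?thesis using M(3) by (auto simp: abs_mult intro: mult_mono)
  qed
  show ?thesis by (rule that[of B]) (fact int pos bound)+
qed

context
  fixes c c' :: "real \<Rightarrow> real \<times> real"
  assumes dc: "\<And>a. (c has_vector_derivative c' a) (at a)" and cc': "continuous_on UNIV c'"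
begin

lemma cont_c: "continuous_on UNIV c"
  using dc by (meson continuous_at_imp_continuous_on has_vector_derivative_continuous)

lemma c'_bound: obtains C where "0 \<le> C" "\<And>a. a \<in> {0..1} \<Longrightarrow> \<bar>fst (c' a)\<bar> \<le> C" "\<And>a. a \<in> {0..1} \<Longrightarrow> \<bar>snd (c' a)\<bar> \<le> C"
proof -
  have "compact (c' ` {0..1})" by (intro compact_continuous_image continuous_on_subset[OF cc']) auto
  then obtain C where C: "\<And>a. a \<in> {0..1} \<Longrightarrow> norm (c' a) \<le> C"
    by (metis bounded_iff compact_imp_bounded imageI)
  have "\<bar>fst (c' a)\<bar> \<le> C" "\<bar>snd (c' a)\<bar> \<le> C" if "a \<in> {0..1}" for a
    using C[OF that] norm_fst_le[of "fst (c' a)" "snd (c' a)"] norm_snd_le[of "snd (c' a)" "fst (c' a)"] by simp_all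
  moreover have "0 \<le> C" using C[of 0] norm_ge_zero[of "c' 0"] by (simp add: order_trans[OF norm_ge_zero])
  ultimately show ?thesis using that by blast
qed

text \<open>Apart from the factor \<open>ker2 w\<close>, this is the derivative of g(c a - w) along
  the curve, so it integrates to end values. \<open>angle_density\<close> is \<open>gx\<close> times
  the integrand of \<open>arc_angle\<close>.\<close>

definition slip_density where "slip_density = (\<lambda>(a, w). indicator {0..1} a * ((gx (c a - w) * fst (c' a) + gy (c a - w) * snd (c' a)) * ker2 w))"
definition angle_density where "angle_density = (\<lambda>(a, z). indicator {0..1} a * (gx z * (ker1 (c a - z) * snd (c' a) - ker2 (c a - z) * fst (c' a))))"

lemma meas_densities: "slip_density \<in> borel_measurable borel" "angle_density \<in> borel_measurable borel"
proof -
  have cf: "continuous_on UNIV (\<lambda>p :: real \<times> real \<times> real. c (fst p))"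
    by (rule continuous_on_compose2[OF cont_c]) (auto intro: continuous_intros)
  have cf': "continuous_on UNIV (\<lambda>p :: real \<times> real \<times> real. c' (fst p))"
    by (rule continuous_on_compose2[OF cc']) (auto intro: continuous_intros)
  have [measurable]: "(\<lambda>p :: real \<times> real \<times> real. indicator {0..1} (fst p) :: real) \<in> borel_measurable borel"
    by (rule measurable_compose[of fst borel borel]) (auto intro!: borel_measurable_continuous_onI continuous_intros)
  have [measurable]: "(\<lambda>p :: real \<times> real \<times> real. fst (c' (fst p))) \<in> borel_measurable borel"
    "(\<lambda>p :: real \<times> real \<times> real. snd (c' (fst p))) \<in> borel_measurable borel"
    by (intro borel_measurable_continuous_onI continuous_intros cf')+
  have d: "(\<lambda>p :: real \<times> real \<times> real. c (fst p) - snd p) \<in> borel_measurable borel"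
    by (intro borel_measurable_continuous_onI continuous_intros cf)
  have s: "(\<lambda>p :: real \<times> real \<times> real. snd p) \<in> borel_measurable borel"
    by (intro borel_measurable_continuous_onI continuous_intros)
  note [measurable] = measurable_compose[OF d meas(2)] measurable_compose[OF d meas(3)]
    measurable_compose[OF d borel_measurable_ker(1)] measurable_compose[OF d borel_measurable_ker(2)]
    measurable_compose[OF s borel_measurable_ker(2)] measurable_compose[OF s meas(2)]
  show "slip_density \<in> borel_measurable borel" "angle_density \<in> borel_measurable borel"
    unfolding slip_density_def angle_density_def split_def
    by (intro borel_measurable_times borel_measurable_add borel_measurable_diff; measurable)+
qed

lemma meas_sec: "F \<in> borel_measurable borel \<Longrightarrow> (\<lambda>z. F (a, z)) \<in> borel_measurable borel"
  for F :: "real \<times> real \<times> real \<Rightarrow> real"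
  by (rule measurable_compose[of "Pair a" borel borel F])
    (auto intro!: borel_measurable_continuous_onI continuous_on_Pair_const)

lemma integrable_densities: "integrable (lborel \<Otimes>\<^sub>M lborel) slip_density" "integrable (lborel \<Otimes>\<^sub>M lborel) angle_density"
proof -
  have "compact (c ` {0..1})" by (intro compact_continuous_image continuous_on_subset[OF cont_c]) auto
  then obtain B where B: "integrable lborel B" "\<And>w. 0 \<le> B w"
    "\<And>z w h k. z \<in> c ` {0..1} \<Longrightarrow> h \<in> {gx, gy} \<Longrightarrow> k \<in> {ker1, ker2} \<Longrightarrow> \<bar>h (z - w) * k w\<bar> \<le> B w"
    using uniform_kernel_bound by blast
  obtain C where C: "0 \<le> C" "\<And>a. a \<in> {0..1} \<Longrightarrow> \<bar>fst (c' a)\<bar> \<le> C" "\<And>a. a \<in> {0..1} \<Longrightarrow> \<bar>snd (c' a)\<bar> \<le> C"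
    using c'_bound by blast
  have le: "\<bar>x * f + y * s\<bar> \<le> 2 * C * b" if "\<bar>x\<bar> \<le> b" "\<bar>y\<bar> \<le> b" "\<bar>f\<bar> \<le> C" "\<bar>s\<bar> \<le> C" for x y f s b :: real
  proof -
    have "0 \<le> b" using that(1) by linarith
    then have "\<bar>x * f\<bar> \<le> b * C" "\<bar>y * s\<bar> \<le> b * C"
      unfolding abs_mult using that C(1) by (auto intro!: mult_mono)
    then show ?thesis by (simp add: algebra_simps abs_le_iff)
  qed
  have slip_density_le: "\<bar>slip_density (a, w)\<bar> \<le> indicator {0..1} a * (2 * C * B w)" for a w
  proof (cases "a \<in> {0..1}")
    case True
    then have "slip_density (a, w) = (gx (c a - w) * ker2 w) * fst (c' a) + (gy (c a - w) * ker2 w) * snd (c' a)"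
      by (simp add: slip_density_def algebra_simps)
    then show ?thesis using True le[OF B(3) B(3) C(2,3)[OF True]] by auto
  qed (simp add: slip_density_def)
  have angle_density_le: "\<bar>angle_density (a, c a - w)\<bar> \<le> indicator {0..1} a * (2 * C * B w)" for a w
  proof (cases "a \<in> {0..1}")
    case True
    then have "angle_density (a, c a - w) = (gx (c a - w) * ker1 w) * snd (c' a) + (gx (c a - w) * ker2 w) * (- fst (c' a))"
      by (simp add: angle_density_def algebra_simps)
    moreover have "\<bar>- fst (c' a)\<bar> \<le> C" using C(2)[OF True] by simp
    moreover have "\<bar>gx (c a - w) * ker1 w\<bar> \<le> B w" "\<bar>gx (c a - w) * ker2 w\<bar> \<le> B w" using B(3)[of "c a"] True by auto
    ultimately show ?thesis using True le[OF _ _ C(3)[OF True], of "gx (c a - w) * ker1 w" "B w" "gx (c a - w) * ker2 w" "- fst (c' a)"] by simp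
  qed (simp add: angle_density_def)
  have fin: "(\<integral>\<^sup>+w. ennreal (2 * C * B w) \<partial>lborel) < \<infinity>"
    using integrableD(2)[of lborel "\<lambda>w. 2 * C * B w"] B(1,2) C(1) by (auto simp: top.not_eq_extremum)
  have dom: "(\<integral>\<^sup>+w. norm (f w) \<partial>lborel) \<le> indicator {0..1} a * (\<integral>\<^sup>+w. ennreal (2 * C * B w) \<partial>lborel)"
    if "\<And>w. \<bar>f w\<bar> \<le> indicator {0..1} a * (2 * C * B w)" for f a
  proof (cases "a \<in> {0..1}")
    case True
    then show ?thesis using that by (auto intro!: nn_integral_mono ennreal_leI)
  next
    case False
    then have "f w = 0" for w using that[of w] by auto
    then show ?thesis by simp
  qed
  show "integrable (lborel \<Otimes>\<^sub>M lborel) slip_density"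
    by (rule integrable_fibrewise_bound[OF meas_densities(1) fin dom[OF slip_density_le]])
  \<comment> \<open>The singularity of \<open>angle_density\<close> sits at the moving point
    \<open>c a\<close>; this reflection moves it to the origin, where the uniform majorant
    applies.\<close>
  have refl: "(\<integral>\<^sup>+z. norm (angle_density (a, z)) \<partial>lborel) = (\<integral>\<^sup>+w. norm (angle_density (a, c a - w)) \<partial>lborel)" for a
    by (rule nn_integral_lborel_reflect[of "\<lambda>z. ennreal (norm (angle_density (a, z)))", symmetric])
      (intro measurable_compose[OF _ measurable_ennreal] measurable_compose[OF _ borel_measurable_norm] meas_sec meas_densities)
  show "integrable (lborel \<Otimes>\<^sub>M lborel) angle_density"
    by (rule integrable_fibrewise_bound[OF meas_densities(2) fin]) (simp only: refl dom[OF angle_density_le])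
qed

lemma gx_arc_angle: "gx z * arc_angle c c' z = (LINT a|lborel. angle_density (a, z))"
  unfolding arc_angle_def by (simp add: angle_density_def integral_mult_right_zero[symmetric] mult.left_commute del: integral_mult_right_zero)

lemma integrable_arc_angle: "integrable lborel (\<lambda>z. gx z * arc_angle c c' z)"
  unfolding gx_arc_angle using lborel_pair.integrable_snd[of "\<lambda>a z. angle_density (a, z)"] integrable_densities(2) by simp

text \<open>Pompeiu's formula at \<open>c a\<close> replaces the integral of \<open>gx\<close>
  against \<open>ker1\<close> by 2 pi g(c a) minus that of \<open>gy\<close> against
  \<open>ker2\<close>. The remainder is \<open>ker2\<close> times the derivative of \<open>g\<close>
  along the curve, which leaves the difference of one function at the two ends of the arc.\<close>

lemma integral_arc_angle:
  "(LINT z|lborel. gx z * arc_angle c c' z) = 2 * pi * (LINT a|lborel. indicator {0..1} a * (g (c a) * snd (c' a)))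
     - ((LINT w|lborel. g (c 1 - w) * ker2 w) - (LINT w|lborel. g (c 0 - w) * ker2 w))"
proof -
  have ik: "integrable lborel (\<lambda>w. h (z - w) * k w)" if "h \<in> {gx, gy, g}" "k \<in> {ker1, ker2}" for h k z
    using integrable_comp_ker[of h k z] that by blast
  have "(LINT z|lborel. gx z * arc_angle c c' z) = (LINT z|lborel. LINT a|lborel. angle_density (a, z))"
    by (simp only: gx_arc_angle)
  also have "\<dots> = (LINT a|lborel. LINT z|lborel. angle_density (a, z))"
    using lborel_pair.Fubini_integral[of "\<lambda>a z. angle_density (a, z)"] integrable_densities(2) by simp
  also have "\<dots> = (LINT a|lborel. 2 * pi * (indicator {0..1} a * (g (c a) * snd (c' a))) - (LINT w|lborel. slip_density (a, w)))"
  proof (rule Bochner_Integration.integral_cong[OF refl])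
    fix a :: real
    let ?I = "\<lambda>h k. LINT w|lborel. h (c a - w) * k w"
    have "(LINT z|lborel. angle_density (a, z)) = (LINT w|lborel. angle_density (a, c a - w))"
      by (rule integral_lborel_reflect[symmetric]) (intro meas_sec meas_densities)
    also have "\<dots> = (LINT w|lborel. indicator {0..1} a * ((gx (c a - w) * ker1 w) * snd (c' a) - (gx (c a - w) * ker2 w) * fst (c' a)))"
      by (intro Bochner_Integration.integral_cong) (auto simp: angle_density_def algebra_simps)
    also have "\<dots> = indicator {0..1} a * (?I gx ker1 * snd (c' a) - ?I gx ker2 * fst (c' a))"
      using ik by simp
    also have "?I gx ker1 = 2 * pi * g (c a) - ?I gy ker2"
      using integral_grad_ker[of "c a"] ik by simp
    finally have 1: "(LINT z|lborel. angle_density (a, z)) = indicator {0..1} a * ((2 * pi * g (c a) - ?I gy ker2) * snd (c' a) - ?I gx ker2 * fst (c' a))" .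
    have "(LINT w|lborel. slip_density (a, w)) = (LINT w|lborel. indicator {0..1} a * ((gx (c a - w) * ker2 w) * fst (c' a) + (gy (c a - w) * ker2 w) * snd (c' a)))"
      by (intro Bochner_Integration.integral_cong) (auto simp: slip_density_def algebra_simps)
    also have "\<dots> = indicator {0..1} a * (?I gx ker2 * fst (c' a) + ?I gy ker2 * snd (c' a))"
      using ik by simp
    finally show "(LINT z|lborel. angle_density (a, z)) = 2 * pi * (indicator {0..1} a * (g (c a) * snd (c' a))) - (LINT w|lborel. slip_density (a, w))"
      unfolding 1 by (simp add: algebra_simps)
  qed
  also have "\<dots> = 2 * pi * (LINT a|lborel. indicator {0..1} a * (g (c a) * snd (c' a))) - (LINT a|lborel. LINT w|lborel. slip_density (a, w))"
  proof -
    have "continuous_on {0..1} (\<lambda>a. g (c a) * snd (c' a))"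
      by (intro continuous_intros continuous_on_compose2[OF cont_g] continuous_on_subset[OF cont_c] continuous_on_subset[OF cc']) auto
    then have "integrable lborel (\<lambda>a. indicator {0..1} a * (g (c a) * snd (c' a)))"
      using borel_integrable_compact[of "{0..1::real}" "\<lambda>a. g (c a) * snd (c' a)"]
      by (auto simp: indicator_def if_distrib cong: if_cong)
    moreover have "integrable lborel (\<lambda>a. LINT w|lborel. slip_density (a, w))"
      by (rule lborel_pair.integrable_fst'[OF integrable_densities(1)])
    ultimately show ?thesis by simp
  qed
  \<comment> \<open>In the new order the inner integral runs along the curve for fixed
    \<open>w\<close> and is that of an exact derivative.\<close>
  also have "(LINT a|lborel. LINT w|lborel. slip_density (a, w)) = (LINT w|lborel. LINT a|lborel. slip_density (a, w))"
    using lborel_pair.Fubini_integral[of "\<lambda>a w. slip_density (a, w)"] integrable_densities(1) by simp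
  also have "\<dots> = (LINT w|lborel. g (c 1 - w) * ker2 w - g (c 0 - w) * ker2 w)"
  proof (rule Bochner_Integration.integral_cong[OF refl])
    fix w
    let ?G = "\<lambda>a. gx (c a - w) * fst (c' a) + gy (c a - w) * snd (c' a)"
    have d: "((\<lambda>a. g (c a - w)) has_real_derivative ?G a) (at a)" for a
    proof -
      have "((\<lambda>a. c a - w) has_derivative (\<lambda>h. h *\<^sub>R c' a)) (at a)"
        using dc[of a] by (auto simp: has_vector_derivative_def intro!: derivative_eq_intros)
      from has_derivative_compose[OF this deriv] show ?thesis
        unfolding has_field_derivative_def
        by (rule has_derivative_eq_rhs) (auto simp: fun_eq_iff algebra_simps)
    qed
    have "continuous_on UNIV ?G"
      by (intro continuous_intros continuous_on_compose2[OF cont(1)] continuous_on_compose2[OF cont(2)] cont_c cc') auto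
    then have "isCont ?G a" for a by (simp add: continuous_on_eq_continuous_at)
    then have "(LINT a|lborel. ?G a * indicator {0..1} a) = g (c 1 - w) - g (c 0 - w)"
      using integral_FTC_Icc_real[of 0 1 "\<lambda>a. g (c a - w)" ?G] d by simp
    moreover have "(LINT a|lborel. slip_density (a, w)) = (LINT a|lborel. ?G a * indicator {0..1} a) * ker2 w"
      by (subst integral_mult_left_zero[symmetric]) (simp add: slip_density_def mult_ac)
    ultimately show "(LINT a|lborel. slip_density (a, w)) = g (c 1 - w) * ker2 w - g (c 0 - w) * ker2 w"
      by (simp only: left_diff_distrib)
  qed
  also have "\<dots> = (LINT w|lborel. g (c 1 - w) * ker2 w) - (LINT w|lborel. g (c 0 - w) * ker2 w)"
    by (rule Bochner_Integration.integral_diff) (use ik in auto)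
  finally show ?thesis .
qed

end

end

section \<open>Coordinates\<close>

abbreviation to_pair :: "real^2 \<Rightarrow> real \<times> real" where "to_pair x \<equiv> (x $ 1, x $ 2)"
abbreviation to_complex :: "real^2 \<Rightarrow> complex" where "to_complex x \<equiv> Complex (x $ 1) (x $ 2)"
abbreviation of_pair :: "real \<times> real \<Rightarrow> real^2" where "of_pair z \<equiv> pt (fst z) (snd z)"

lemma pt_nth [simp]: "pt x y $ 1 = x" "pt x y $ 2 = y"
  by simp_all

lemma vec2_eq_iff: "x = y \<longleftrightarrow> x $ 1 = y $ 1 \<and> x $ 2 = y $ 2" for x y :: "'a^2"
  by (simp add: vec_eq_iff forall_2)

lemma pt_collapse [simp]: "pt (x $ 1) (x $ 2) = x"
  by (simp add: vec2_eq_iff)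

lemma inner_vec2: "x \<bullet> y = x $ 1 * y $ 1 + x $ 2 * y $ 2" for x y :: "real^2"
  by (simp add: inner_vec_def sum_2)

lemma pt_eq_axis: "pt x y = x *\<^sub>R axis 1 1 + y *\<^sub>R axis 2 1"
  by (simp add: vec2_eq_iff axis_def)

lemma bounded_linear_pt: "bounded_linear f \<Longrightarrow> bounded_linear g \<Longrightarrow> bounded_linear (\<lambda>z. pt (f z) (g z))"
  unfolding pt_eq_axis
  by (intro bounded_linear_add bounded_linear_compose[OF bounded_linear_scaleR_left])

lemma bounded_linear_of_pair: "bounded_linear of_pair"
  by (intro bounded_linear_pt bounded_linear_fst bounded_linear_snd)

lemma continuous_on_pt [continuous_intros]:
  "continuous_on A f \<Longrightarrow> continuous_on A g \<Longrightarrow> continuous_on A (\<lambda>z. pt (f z) (g z))"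
  unfolding pt_eq_axis by (intro continuous_intros)

lemma continuous_on_of_pair: "continuous_on A of_pair"
  by (intro continuous_intros)

lemma Basis_vec2: "(Basis :: (real^2) set) = {axis 1 1, axis 2 1}"
  by (auto simp: Basis_vec_def UNIV_2)

text \<open>Lebesgue measure is determined by boxes, and preimages of boxes under
  \<open>of_pair\<close> are boxes of the same area. This transfers Fubini's theorem from the
  product type to vectors.\<close>

lemma lborel_of_pair: "(lborel :: (real^2) measure) = distr lborel borel of_pair"
proof (rule lborel_eqI)
  fix l u :: "real^2"
  assume le: "\<And>b. b \<in> Basis \<Longrightarrow> l \<bullet> b \<le> u \<bullet> b"
  have m: "of_pair \<in> lborel \<rightarrow>\<^sub>M borel"
    unfolding measurable_lborel2 by (rule borel_measurable_continuous_onI[OF continuous_on_of_pair])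
  have "emeasure (distr lborel borel of_pair) (box l u) = emeasure lborel (of_pair -` box l u)"
    using emeasure_distr[OF m, of "box l u"] by simp
  also have "of_pair -` box l u = box (to_pair l) (to_pair u)"
    by (auto simp: box_def Basis_vec2 Basis_prod_def inner_axis split: prod.splits)
  also have "emeasure lborel \<dots> = (\<Prod>b\<in>Basis. (to_pair u - to_pair l) \<bullet> b)"
    using le[of "axis 1 1"] le[of "axis 2 1"]
    by (intro emeasure_lborel_box) (auto simp: Basis_vec2 Basis_prod_def inner_axis)
  also have "\<dots> = (\<Prod>b\<in>Basis. (u - l) \<bullet> b)"
    by (simp add: Basis_vec2 Basis_prod_def inner_axis prod.union_disjoint axis_eq_axis mult.commute)
  finally show "emeasure (distr lborel borel of_pair) (box l u) = (\<Prod>b\<in>Basis. (u - l) \<bullet> b)" .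
qed simp

lemma of_pair_measurable [measurable]: "of_pair \<in> lborel \<rightarrow>\<^sub>M borel"
  unfolding measurable_lborel2 by (rule borel_measurable_continuous_onI[OF continuous_on_of_pair])

lemma integral_of_pair:
  fixes f :: "real^2 \<Rightarrow> real"
  assumes "f \<in> borel_measurable borel"
  shows "(LINT x|lborel. f x) = (LINT z|lborel. f (of_pair z))"
  by (subst lborel_of_pair, rule integral_distr[OF of_pair_measurable assms])

lemma AE_of_pair:
  assumes "AE x in lborel. P (x :: real^2)"
  shows "AE z in lborel. P (of_pair z)"
  using assms by (subst (asm) lborel_of_pair) (rule AE_distrD[OF of_pair_measurable])

section \<open>Region bounded by an arc and a segment of the axis\<close>

text \<open>A point is inside when its component of the complement is bounded; the inverse takes
  connected sets to connected sets, and the linear map takes bounded sets to bounded sets. It serves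
  to move the Jordan curve theorem from the complex plane to \<open>real^2\<close>.\<close>

lemma inside_homeo_image_subset:
  fixes f :: "'a::euclidean_space \<Rightarrow> 'b::euclidean_space"
  assumes f: "bounded_linear f" and g: "continuous_on UNIV g"
    and gf: "\<And>x. g (f x) = x" and fg: "\<And>y. f (g y) = y"
  shows "f ` inside S \<subseteq> inside (f ` S)"
proof safe
  fix x assume x: "x \<in> inside S"
  have "connected_component_set (- f ` S) (f x) \<subseteq> f ` connected_component_set (- S) x"
  proof
    fix y assume "y \<in> connected_component_set (- f ` S) (f x)"
    then obtain U where U: "connected U" "U \<subseteq> - f ` S" "f x \<in> U" "y \<in> U"
      by (auto simp: connected_component_def)
    have "connected (g ` U)" using U(1) g by (meson connected_continuous_image continuous_on_subset subset_UNIV)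
    moreover have "g ` U \<subseteq> - S" using U(2) fg by (metis ComplD ComplI image_eqI image_subset_iff subsetD)
    moreover have "x \<in> g ` U" using U(3) gf by (metis image_eqI)
    ultimately have "g y \<in> connected_component_set (- S) x"
      using U(4) unfolding connected_component_def by blast
    then show "y \<in> f ` connected_component_set (- S) x" using fg by (metis image_eqI)
  qed
  moreover have "bounded (f ` connected_component_set (- S) x)"
    using x by (intro bounded_linear_image f) (simp add: inside_def)
  moreover have "f x \<notin> f ` S" using x gf by (auto simp: inside_def) (metis gf)
  ultimately show "f x \<in> inside (f ` S)" unfolding inside_def using bounded_subset by blast
qed

lemma inside_homeo_image:
  fixes f :: "'a::euclidean_space \<Rightarrow> 'b::euclidean_space"
  assumes f: "bounded_linear f" and g: "bounded_linear g"
    and gf: "\<And>x. g (f x) = x" and fg: "\<And>y. f (g y) = y"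
  shows "inside (f ` S) = f ` inside S"
proof
  show "f ` inside S \<subseteq> inside (f ` S)"
    by (rule inside_homeo_image_subset[OF f linear_continuous_on[OF g] gf fg])
  have "g ` inside (f ` S) \<subseteq> inside (g ` f ` S)"
    by (rule inside_homeo_image_subset[OF g linear_continuous_on[OF f] fg gf])
  then have "g ` inside (f ` S) \<subseteq> inside S" by (simp add: image_comp gf o_def)
  then have "f ` g ` inside (f ` S) \<subseteq> f ` inside S" by (rule image_mono)
  then show "inside (f ` S) \<subseteq> f ` inside S" by (simp add: image_comp fg o_def)
qed

lemma bounded_linear_to_complex: "bounded_linear to_complex"
  by (rule bounded_linear_intro[where K=1])
    (auto simp: complex_eq_iff norm_complex_def norm_vec_def L2_set_def sum_2)

lemma bounded_linear_of_complex: "bounded_linear (\<lambda>z. pt (Re z) (Im z))"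
  by (intro bounded_linear_pt bounded_linear_Re bounded_linear_Im)

lemma inside_to_complex: "inside (to_complex ` S) = to_complex ` inside S"
  by (rule inside_homeo_image[OF bounded_linear_to_complex bounded_linear_of_complex]) auto

section \<open>The closed curve of interface and wall, and its winding number\<close>

locale droplet =
  fixes c c' :: "real \<Rightarrow> real^2"
  assumes dc: "\<And>a. (c has_vector_derivative c' a) (at a)" and cont_c': "continuous_on UNIV c'"
    and inj: "inj_on c {0..1}"
    and ends: "c 0 $ 2 = 0" "c 1 $ 2 = 0" "c 0 $ 1 < c 1 $ 1"
    and above: "\<And>a. a \<in> {0<..<1} \<Longrightarrow> c a $ 2 > 0"
begin

definition bnd :: "(real^2) set" where "bnd = c ` {0..1} \<union> (\<lambda>x. pt x 0) ` {c 0 $ 1 .. c 1 $ 1}"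
definition D :: "(real^2) set" where "D = inside bnd"
text \<open>The wetted wall run from the right contact point back to the left one, which closes the
  interface to a loop.\<close>

definition seg :: "real \<Rightarrow> real^2" where "seg a = pt (c 1 $ 1 + a * (c 0 $ 1 - c 1 $ 1)) 0"
definition loop :: "real \<Rightarrow> complex" where
  "loop = (to_complex \<circ> c) +++ linepath (to_complex (c 1)) (to_complex (c 0))"

lemma cont_c: "continuous_on A c"
  using dc by (meson continuous_at_imp_continuous_on has_vector_derivative_continuous)

lemma linepath_eq: "linepath (to_complex (c 1)) (to_complex (c 0)) = to_complex \<circ> seg"
  using ends by (auto simp: linepath_def seg_def fun_eq_iff complex_eq_iff algebra_simps)

lemma seg_image: "seg ` {0..1} = (\<lambda>x. pt x 0) ` {c 0 $ 1 .. c 1 $ 1}"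
proof -
  have "(\<lambda>a. c 1 $ 1 + a * (c 0 $ 1 - c 1 $ 1)) ` {0..1} = {c 0 $ 1 .. c 1 $ 1}"
  proof (intro equalityI subsetI)
    fix x assume "x \<in> {c 0 $ 1 .. c 1 $ 1}"
    then show "x \<in> (\<lambda>a. c 1 $ 1 + a * (c 0 $ 1 - c 1 $ 1)) ` {0..1}"
      using ends(3) by (intro image_eqI[of _ _ "(c 1 $ 1 - x) / (c 1 $ 1 - c 0 $ 1)"]) (auto simp: field_simps)
  next
    fix x assume "x \<in> (\<lambda>a. c 1 $ 1 + a * (c 0 $ 1 - c 1 $ 1)) ` {0..1}"
    then obtain a where a: "a \<in> {0..1}" "x = c 1 $ 1 + a * (c 0 $ 1 - c 1 $ 1)" by auto
    have "a * (c 0 $ 1 - c 1 $ 1) \<le> 0" "(1 - a) * (c 0 $ 1 - c 1 $ 1) \<le> 0"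
      using a(1) ends(3) by (auto intro: mult_nonneg_nonpos)
    then show "x \<in> {c 0 $ 1 .. c 1 $ 1}" by (auto simp: a(2) algebra_simps)
  qed
  then have "(\<lambda>x. pt x 0) ` (\<lambda>a. c 1 $ 1 + a * (c 0 $ 1 - c 1 $ 1)) ` {0..1} = (\<lambda>x. pt x 0) ` {c 0 $ 1 .. c 1 $ 1}"
    by simp
  then show ?thesis by (simp add: image_comp o_def seg_def)
qed

lemma loop_image: "path_image loop = to_complex ` bnd"
proof -
  have "path_image loop = path_image (to_complex \<circ> c) \<union> path_image (to_complex \<circ> seg)"
    unfolding loop_def linepath_eq
    by (rule path_image_join) (simp add: pathfinish_def pathstart_def seg_def complex_eq_iff ends)
  then show ?thesis by (simp add: path_image_def bnd_def image_Un image_comp seg_image[symmetric])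
qed

lemma inj_to_complex: "inj to_complex"
  by (auto simp: inj_def vec2_eq_iff)

text \<open>Between its ends the arc lies strictly above the axis, so it meets the segment in the
  two contact points only.\<close>

lemma simple_loop: "simple_path loop" and closed_loop: "pathfinish loop = pathstart loop"
proof -
  have ne: "to_complex (c 1) \<noteq> to_complex (c 0)" using ends by auto
  have arc: "arc (to_complex \<circ> c)"
    unfolding arc_def path_def
    using continuous_on_compose[OF cont_c linear_continuous_on[OF bounded_linear_to_complex]]
      comp_inj_on[OF inj inj_on_subset[OF inj_to_complex]] by auto
  have "path_image (to_complex \<circ> c) \<inter> path_image (linepath (to_complex (c 1)) (to_complex (c 0)))
      \<subseteq> {to_complex (c 0), to_complex (c 1)}"
  proof
    fix z assume "z \<in> path_image (to_complex \<circ> c) \<inter> path_image (linepath (to_complex (c 1)) (to_complex (c 0)))"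
    then obtain a b where z: "a \<in> {0..1}" "z = to_complex (c a)" "z = to_complex (seg b)"
      unfolding linepath_eq by (auto simp: path_image_def)
    then have "c a $ 2 = 0" by (auto simp: seg_def)
    then have "a = 0 \<or> a = 1" using above[of a] z(1) by force
    then show "z \<in> {to_complex (c 0), to_complex (c 1)}" using z(2) by auto
  qed
  note I = this
  have e: "pathstart (to_complex \<circ> c) = to_complex (c 0)" "pathfinish (to_complex \<circ> c) = to_complex (c 1)"
    by (simp_all add: pathstart_def pathfinish_def)
  show "simple_path loop"
    unfolding loop_def
    by (rule simple_path_join_loop[OF arc arc_linepath[OF ne]]) (use I in \<open>simp_all only: e pathstart_linepath pathfinish_linepath\<close>)
  show "pathfinish loop = pathstart loop"
    by (simp add: loop_def pathstart_def pathfinish_def joinpaths_def linepath_def)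
qed

lemma to_complex_D: "to_complex ` D = inside (path_image loop)"
  by (simp add: D_def loop_image inside_to_complex)

lemma D_eq: "D = to_complex -` inside (path_image loop)"
  using to_complex_D inj_to_complex by (metis inj_vimage_image_eq)

lemma compact_bnd: "compact bnd"
proof -
  have "compact (c ` {0..1})" by (intro compact_continuous_image cont_c) auto
  moreover have "compact ((\<lambda>x. pt x 0) ` {c 0 $ 1 .. c 1 $ 1})"
    by (intro compact_continuous_image continuous_intros) auto
  ultimately show ?thesis unfolding bnd_def by (rule compact_Un)
qed

lemma open_D: "open D"
  unfolding D_def by (intro open_inside compact_imp_closed compact_bnd)

lemma bounded_D: "bounded D"
  unfolding D_def by (intro bounded_inside compact_imp_bounded compact_bnd)

lemma closure_D: "closure D = D \<union> bnd"
proof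
  have "closure D \<subseteq> - (outside bnd)"
    by (intro closure_minimal)
      (auto simp: D_def inside_Un_outside dest: inside_Int_outside[THEN equalityD1, THEN subsetD, OF IntI]
        intro: open_outside compact_imp_closed compact_bnd)
  then show "closure D \<subseteq> D \<union> bnd" unfolding D_def using inside_Un_outside[of bnd] by blast
  \<comment> \<open>This inclusion rests on the Jordan curve theorem: the frontier of the inside is
    the whole curve.\<close>
  have "to_complex ` bnd \<subseteq> closure (to_complex ` D)"
    using Jordan_inside_outside[OF simple_loop closed_loop] 
    unfolding to_complex_D loop_image[symmetric] by (metis frontier_def Diff_subset)
  also have "\<dots> = to_complex ` closure D"
    using closure_injective_linear_image[of to_complex D] inj_to_complex bounded_linear_to_complex
    by (simp add: bounded_linear.linear)
  finally have "bnd \<subseteq> closure D" using inj_to_complex by (simp add: inj_image_subset_iff)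
  then show "D \<union> bnd \<subseteq> closure D" using closure_subset by blast
qed

lemma compact_closure_D: "compact (closure D)"
  using bounded_D by simp

lemma seg_deriv: "(seg has_vector_derivative pt (c 0 $ 1 - c 1 $ 1) 0) (at a)"
  unfolding seg_def[abs_def] pt_eq_axis by (auto intro!: derivative_eq_intros simp: algebra_simps)

text \<open>A differentiable curve in the plane has measure zero; hence an identity for
  \<open>angle\<close> off the curve holds almost everywhere.\<close>

lemma null_bnd: "bnd \<in> null_sets lborel"
proof -
  have img: "negligible (f ` {0..1})" if "\<And>a. (f has_vector_derivative f' a) (at a)" for f f' :: "real \<Rightarrow> real^2"
  proof (rule negligible_differentiable_image_lowdim)
    show "f differentiable_on {0..1}"
      using that by (auto simp: differentiable_on_def has_vector_derivative_def differentiable_def intro: has_derivative_at_withinI)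
  qed simp
  have "negligible bnd"
    unfolding bnd_def seg_image[symmetric] using img[OF dc] img[OF seg_deriv] by (rule negligible_Un)
  then have "emeasure lebesgue bnd = 0" by (simp add: negligible_iff_null_sets null_setsD1)
  moreover have "bnd \<in> sets borel" using compact_bnd by (simp add: compact_imp_closed)
  ultimately show ?thesis by (auto simp: null_sets_def)
qed

text \<open>The half-plane is convex and contains the curve, so its complement belongs to the
  outside.\<close>

lemma halfplane: "D \<subseteq> {x. 0 \<le> x $ 2}"
proof -
  have "bnd \<subseteq> {x. 0 \<le> x $ 2}"
  proof
    fix x assume "x \<in> bnd"
    then consider a where "a \<in> {0..1}" "x = c a" | b where "x = pt b 0" by (auto simp: bnd_def)
    then show "x \<in> {x. 0 \<le> x $ 2}"
    proof cases
      case (1 a)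
      then consider "a = 0" | "a = 1" | "a \<in> {0<..<1}" by force
      then show ?thesis using 1 ends above[of a] by cases auto
    qed auto
  qed
  moreover have "convex {x :: real^2. 0 \<le> x $ 2}"
    using convex_halfspace_ge[of 0 "axis 2 1 :: real^2"] by (simp add: inner_axis')
  ultimately have "- {x. 0 \<le> x $ 2} \<subseteq> outside bnd" by (intro outside_subset_convex)
  then show ?thesis unfolding D_def using inside_Int_outside by blast
qed

definition angle :: "real^2 \<Rightarrow> real" where
  "angle x = arc_angle (to_pair \<circ> c) (to_pair \<circ> c') (to_pair x)
    + arc_angle (to_pair \<circ> seg) (\<lambda>a. (c 0 $ 1 - c 1 $ 1, 0)) (to_pair x)"

text \<open>With w = f - z, the imaginary part of w'/w is \<open>ker1\<close> times the second
  component of w' minus \<open>ker2\<close> times the first, which is the integrand of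
  \<open>arc_angle\<close>.\<close>

lemma arc_angle_contour:
  assumes d: "\<And>a. (f has_vector_derivative f' a) (at a)" and cf': "continuous_on UNIV f'"
    and z: "z \<notin> f ` {0..1}"
  obtains I where "((\<lambda>\<zeta>. 1 / (\<zeta> - to_complex z)) has_contour_integral I) (to_complex \<circ> f)"
    "Im I = arc_angle (to_pair \<circ> f) (to_pair \<circ> f') (to_pair z)"
proof -
  have cf: "continuous_on A f" for A
    using d by (meson continuous_at_imp_continuous_on has_vector_derivative_continuous)
  let ?h = "\<lambda>a. 1 / (to_complex (f a) - to_complex z) * to_complex (f' a)"
  have cc: "continuous_on {0..1} (\<lambda>a. to_complex (g a))" if "continuous_on {0..1} g" for g :: "real \<Rightarrow> real^2"
    using continuous_on_compose2[OF linear_continuous_on[OF bounded_linear_to_complex, of UNIV] that] by simp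
  have ne: "to_complex (f a) - to_complex z \<noteq> 0" if "a \<in> {0..1}" for a
  proof
    assume "to_complex (f a) - to_complex z = 0"
    then have "f a = z" by (simp add: complex_eq_iff vec2_eq_iff)
    then show False using z that by auto
  qed
  have ch: "continuous_on {0..1} ?h"
    by (intro continuous_intros cc cf continuous_on_subset[OF cf']) (use ne in auto)
  then have int: "(?h has_integral integral {0..1} ?h) {0..1}"
    by (intro integrable_integral integrable_continuous_interval)
  have vd: "vector_derivative (to_complex \<circ> f) (at a) = to_complex (f' a)" for a
  proof -
    have "((\<lambda>a. to_complex (f a)) has_vector_derivative to_complex (f' a)) (at a)"
      by (rule bounded_linear.has_vector_derivative[OF bounded_linear_to_complex d])
    then show ?thesis by (simp add: o_def vector_derivative_at)
  qed
  have Im: "Im (?h a) = ker1 (to_pair (f a) - to_pair z) * f' a $ 2 - ker2 (to_pair (f a) - to_pair z) * f' a $ 1" for a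
  proof -
    have "Im (1 / w * v) = Re w / ((Re w)\<^sup>2 + (Im w)\<^sup>2) * Im v - Im w / ((Re w)\<^sup>2 + (Im w)\<^sup>2) * Re v" for w v
      by (simp add: Re_divide Im_divide diff_divide_distrib mult.commute)
    from this[of "to_complex (f a) - to_complex z" "to_complex (f' a)"] show ?thesis
      by (simp add: ker1_def ker2_def)
  qed
  have "Im (integral {0..1} ?h) = integral {0..1} (\<lambda>a. Im (?h a))"
    using has_integral_linear[OF int bounded_linear_Im] by (simp add: o_def integral_unique)
  also have "\<dots> = (LINT a:{0..1}|lborel. Im (?h a))"
    by (intro set_borel_integral_eq_integral(2)[symmetric] borel_integrable_atLeastAtMost')
      (use ch in \<open>auto intro: continuous_intros\<close>)
  also have "\<dots> = arc_angle (to_pair \<circ> f) (to_pair \<circ> f') (to_pair z)"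
    unfolding Im arc_angle_def set_lebesgue_integral_def by simp
  finally show ?thesis
    using int by (intro that[of "integral {0..1} ?h"]) (simp_all add: has_contour_integral vd)
qed

lemma angle_winding:
  assumes "x \<notin> bnd"
  shows "angle x = 2 * pi * Re (winding_number loop (to_complex x))"
proof -
  have 1: "x \<notin> c ` {0..1}" and 2: "x \<notin> seg ` {0..1}" using assms by (auto simp: bnd_def seg_image)
  obtain I where I: "((\<lambda>\<zeta>. 1 / (\<zeta> - to_complex x)) has_contour_integral I) (to_complex \<circ> c)"
    "Im I = arc_angle (to_pair \<circ> c) (to_pair \<circ> c') (to_pair x)"
    using arc_angle_contour[OF dc cont_c' 1] by blast
  obtain J where J: "((\<lambda>\<zeta>. 1 / (\<zeta> - to_complex x)) has_contour_integral J) (to_complex \<circ> seg)"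
    "Im J = arc_angle (to_pair \<circ> seg) (\<lambda>a. (c 0 $ 1 - c 1 $ 1, 0)) (to_pair x)"
    using arc_angle_contour[OF seg_deriv continuous_on_const 2] by (auto simp: o_def)
  have "(\<lambda>a. to_complex (c a)) C1_differentiable_on {0..1}"
    unfolding C1_differentiable_on_def
  proof (intro exI conjI ballI)
    show "((\<lambda>a. to_complex (c a)) has_vector_derivative to_complex (c' a)) (at a)" for a
      by (rule bounded_linear.has_vector_derivative[OF bounded_linear_to_complex dc])
    show "continuous_on {0..1} (\<lambda>a. to_complex (c' a))"
      using continuous_on_compose2[OF linear_continuous_on[OF bounded_linear_to_complex, of UNIV]
          continuous_on_subset[OF cont_c' subset_UNIV]] by simp
  qed
  then have v1: "valid_path (to_complex \<circ> c)"
    by (simp add: valid_path_def C1_differentiable_imp_piecewise o_def)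
  have v2: "valid_path (to_complex \<circ> seg)" using valid_path_linepath[of "to_complex (c 1)" "to_complex (c 0)"] unfolding linepath_eq .
  have fin: "pathfinish (to_complex \<circ> c) = pathstart (to_complex \<circ> seg)"
    by (simp add: pathfinish_def pathstart_def seg_def ends complex_eq_iff)
  have vl: "valid_path loop" unfolding loop_def linepath_eq by (intro valid_path_join v1 v2 fin)
  have "((\<lambda>\<zeta>. 1 / (\<zeta> - to_complex x)) has_contour_integral (I + J)) loop"
    unfolding loop_def linepath_eq by (rule has_contour_integral_join[OF I(1) J(1) v1 v2])
  moreover have "to_complex x \<notin> path_image loop"
    using assms inj_to_complex by (auto simp: loop_image inj_def)
  then have "((\<lambda>\<zeta>. 1 / (\<zeta> - to_complex x)) has_contour_integral (2 * pi * \<i> * winding_number loop (to_complex x))) loop"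
    by (rule has_contour_integral_winding_number[OF vl])
  ultimately have "I + J = 2 * pi * \<i> * winding_number loop (to_complex x)"
    by (rule has_contour_integral_unique)
  then have "Im I + Im J = 2 * pi * Re (winding_number loop (to_complex x))"
    by (simp add: complex_eq_iff)
  then show ?thesis by (simp add: angle_def I(2) J(2))
qed

text \<open>The winding number of a simple closed curve is 1 or -1 throughout the inside and 0
  outside; which of the two signs occurs is decided in \<open>orientation\<close>.\<close>

lemma angle_const: obtains s where "s \<in> {-1, 1}" "\<And>x. x \<notin> bnd \<Longrightarrow> angle x = 2 * pi * s * indicator D x"
proof -
  have "\<exists>s\<in>{-1, 1}. \<forall>z\<in>inside (path_image loop). winding_number loop z = of_real s"
    using simple_closed_path_winding_number_inside[OF simple_loop] by auto
  then obtain s :: real where s: "s \<in> {-1, 1}" "\<And>z. z \<in> inside (path_image loop) \<Longrightarrow> winding_number loop z = of_real s"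
    by blast
  have "angle x = 2 * pi * s * indicator D x" if "x \<notin> bnd" for x
  proof (cases "x \<in> D")
    case True
    then have "to_complex x \<in> inside (path_image loop)" using D_eq by auto
    from s(2)[OF this] show ?thesis using angle_winding[OF that] True by simp
  next
    case False
    then have "to_complex x \<notin> inside (path_image loop)" using D_eq by auto
    moreover have "to_complex x \<notin> path_image loop" using that inj_to_complex by (auto simp: loop_image inj_def)
    ultimately have "to_complex x \<in> outside (path_image loop)" using inside_Un_outside by blast
    then have "winding_number loop (to_complex x) = 0"
      using simple_loop closed_loop by (intro winding_number_zero_in_outside) (auto simp: simple_path_def)
    then show ?thesis using angle_winding[OF that] False by simp
  qed
  then show ?thesis using s(1) that by blast
qed

end

section \<open>Green's theorem in the droplet\<close>

lemma arc_angle_swap: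
  "arc_angle (prod.swap \<circ> f) (prod.swap \<circ> f') (prod.swap z) = - arc_angle f f' z"
proof -
  have k: "ker1 (prod.swap u - prod.swap z) = ker2 (u - z)" "ker2 (prod.swap u - prod.swap z) = ker1 (u - z)" for u
    by (simp_all add: ker1_def ker2_def add.commute)
  have "arc_angle (prod.swap \<circ> f) (prod.swap \<circ> f') (prod.swap z)
      = (LINT a|lborel. - (indicator {0..1} a * (ker1 (f a - z) * snd (f' a) - ker2 (f a - z) * fst (f' a))))"
    unfolding arc_angle_def o_def k by (intro Bochner_Integration.integral_cong refl) (auto simp: algebra_simps)
  then show ?thesis unfolding arc_angle_def by simp
qed

lemma (in plane_test) plane_test_swap: "plane_test (\<lambda>z. g (prod.swap z)) (\<lambda>z. gy (prod.swap z)) (\<lambda>z. gx (prod.swap z)) R"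
proof
  have s: "continuous_on UNIV (prod.swap :: real \<times> real \<Rightarrow> _)"
    unfolding prod.swap_def by (intro continuous_intros)
  show "continuous_on UNIV (\<lambda>z. gy (prod.swap z))" "continuous_on UNIV (\<lambda>z. gx (prod.swap z))"
    using continuous_on_compose2[OF _ s] cont by auto
  fix z :: "real \<times> real"
  have "(prod.swap has_derivative prod.swap) (at z)"
    unfolding prod.swap_def by (auto intro!: derivative_eq_intros)
  from has_derivative_compose[OF this deriv]
  show "((\<lambda>z. g (prod.swap z)) has_derivative (\<lambda>h. gy (prod.swap z) * fst h + gx (prod.swap z) * snd h)) (at z)"
    by (rule has_derivative_eq_rhs) (auto simp: fun_eq_iff)
  show "\<bar>fst z\<bar> > R \<or> \<bar>snd z\<bar> > R \<Longrightarrow> g (prod.swap z) = 0 \<and> gy (prod.swap z) = 0 \<and> gx (prod.swap z) = 0"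
    using supp[of "prod.swap z"] by auto
qed

text \<open>The formula for the derivative in x is applied to the mirror image in the diagonal,
  which interchanges the coordinates and reverses the angle; hence the signs.\<close>

lemma (in plane_test) integral_arc_angle_swap:
  assumes dc: "\<And>a. (c has_vector_derivative c' a) (at a)" and cc': "continuous_on UNIV c'"
  shows "integrable lborel (\<lambda>z. gy z * arc_angle c c' z)"
    "(LINT z|lborel. gy z * arc_angle c c' z) = - (2 * pi * (LINT a|lborel. indicator {0..1} a * (g (c a) * fst (c' a))))
     + ((LINT w|lborel. g (c 1 - prod.swap w) * ker2 w) - (LINT w|lborel. g (c 0 - prod.swap w) * ker2 w))"
proof -
  interpret T: plane_test "\<lambda>z. g (prod.swap z)" "\<lambda>z. gy (prod.swap z)" "\<lambda>z. gx (prod.swap z)" R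
    by (rule plane_test_swap)
  have bl: "bounded_linear (prod.swap :: real \<times> real \<Rightarrow> _)"
    unfolding prod.swap_def by (intro bounded_linear_intros)
  have d: "((prod.swap \<circ> c) has_vector_derivative (prod.swap \<circ> c') a) (at a)" for a
    using bounded_linear.has_vector_derivative[OF bl dc] by (simp add: o_def)
  have cs: "continuous_on UNIV (prod.swap \<circ> c')"
    using continuous_on_compose[OF cc' linear_continuous_on[OF bl]] by simp
  let ?f = "\<lambda>z. gy (prod.swap z) * arc_angle (prod.swap \<circ> c) (prod.swap \<circ> c') z"
  have f: "integrable lborel ?f" by (rule T.integrable_arc_angle[OF d cs])
  have eq: "(\<lambda>(x, y). ?f (y, x)) = (\<lambda>z. - (gy z * arc_angle c c' z))"
    using arc_angle_swap[of c c'] by (auto simp: fun_eq_iff)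
  show "integrable lborel (\<lambda>z. gy z * arc_angle c c' z)"
    using integrable_lborel_swap[OF f] unfolding eq by simp
  have "- (LINT z|lborel. gy z * arc_angle c c' z) = (LINT z|lborel. ?f z)"
    using integral_lborel_swap[of ?f] f unfolding eq by simp
  also have "\<dots> = 2 * pi * (LINT a|lborel. indicator {0..1} a * (g (c a) * fst (c' a)))
     - ((LINT w|lborel. g (c 1 - prod.swap w) * ker2 w) - (LINT w|lborel. g (c 0 - prod.swap w) * ker2 w))"
  proof -
    have e: "prod.swap ((prod.swap \<circ> c) x - w) = c x - prod.swap w" for x w
      by (simp add: prod_eq_iff)
    show ?thesis unfolding T.integral_arc_angle[OF d cs] e by simp
  qed
  finally show "(LINT z|lborel. gy z * arc_angle c c' z) = - (2 * pi * (LINT a|lborel. indicator {0..1} a * (g (c a) * fst (c' a))))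
     + ((LINT w|lborel. g (c 1 - prod.swap w) * ker2 w) - (LINT w|lborel. g (c 0 - prod.swap w) * ker2 w))"
    by simp
qed

text \<open>The simplest C1 function that is zero on one half-line and positive on the other; the
  bump, the cutoff and the extension of the logarithmic density below are built from it.\<close>

definition sqplus :: "real \<Rightarrow> real" where "sqplus t = (max 0 t)\<^sup>2"

lemma DERIV_sqplus: "(sqplus has_real_derivative 2 * max 0 t) (at t)"
proof -
  consider "t < 0" | "t > 0" | "t = 0" by linarith
  then show ?thesis
  proof cases
    case 1
    have "((\<lambda>_. 0) has_real_derivative 0) (at t)" by simp
    then have "(sqplus has_real_derivative 0) (at t)"
      by (rule has_field_derivative_transform_within_open[of _ _ _ "{..<0}"]) (use 1 in \<open>auto simp: sqplus_def\<close>)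
    then show ?thesis using 1 by simp
  next
    case 2
    have "((\<lambda>t. t\<^sup>2) has_real_derivative 2 * t) (at t)" by (auto intro!: derivative_eq_intros)
    then have "(sqplus has_real_derivative 2 * t) (at t)"
      by (rule has_field_derivative_transform_within_open[of _ _ _ "{0<..}"]) (use 2 in \<open>auto simp: sqplus_def\<close>)
    then show ?thesis using 2 by simp
  next
    case 3
    have "((\<lambda>h. sqplus h / h) \<longlongrightarrow> 0) (at 0)"
    proof (rule Lim_null_comparison)
      show "\<forall>\<^sub>F h in at 0. norm (sqplus h / h) \<le> \<bar>h\<bar>"
        by (intro always_eventually allI) (auto simp: sqplus_def max_def power2_eq_square)
      show "((\<lambda>h::real. \<bar>h\<bar>) \<longlongrightarrow> 0) (at 0)"
        by (auto intro!: tendsto_eq_intros)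
    qed
    then show ?thesis unfolding 3 has_field_derivative_iff by (simp add: sqplus_def)
  qed
qed

lemma continuous_on_sqplus [continuous_intros]: "continuous_on A f \<Longrightarrow> continuous_on A (\<lambda>x. sqplus (f x))"
  unfolding sqplus_def by (intro continuous_intros)

lemma Ck_sqplus: "Ck (Suc 0) sqplus"
proof (rule Ck_real_SucI[OF DERIV_sqplus])
  show "Ck 0 (\<lambda>t::real. 2 * max 0 t)" by (auto intro!: continuous_intros)
qed

lemma affine_mem_Icc:
  fixes l u a :: real
  assumes "l < u" shows "u + (l - u) * a \<in> {l..u} \<longleftrightarrow> a \<in> {0..1}"
proof
  assume "a \<in> {0..1}"
  then have "0 \<le> (u - l) * a" "0 \<le> (u - l) * (1 - a)" using assms by auto
  then show "u + (l - u) * a \<in> {l..u}" by (simp add: algebra_simps)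
next
  assume "u + (l - u) * a \<in> {l..u}"
  then have "0 \<le> (u - l) * a" "0 \<le> (u - l) * (1 - a)" by (auto simp: algebra_simps)
  then show "a \<in> {0..1}" using assms by (auto simp: zero_le_mult_iff)
qed

context droplet
begin

lemma pair_deriv: "((to_pair \<circ> c) has_vector_derivative (to_pair \<circ> c') a) (at a)"
  unfolding o_def
  by (intro bounded_linear.has_vector_derivative[OF bounded_linear_Pair dc]
      bounded_linear_vec_nth)

lemma cont_pair': "continuous_on UNIV (to_pair \<circ> c')"
  unfolding o_def by (intro continuous_intros cont_c')

lemma seg_pair_deriv: "((to_pair \<circ> seg) has_vector_derivative (c 0 $ 1 - c 1 $ 1, 0)) (at a)"
proof -
  have "((\<lambda>a. to_pair (seg a)) has_vector_derivative to_pair (pt (c 0 $ 1 - c 1 $ 1) 0)) (at a)"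
    by (rule bounded_linear.has_vector_derivative[OF bounded_linear_Pair seg_deriv])
      (intro bounded_linear_vec_nth)+
  then show ?thesis by (simp add: o_def)
qed

lemma seg_ends: "seg 0 = c 1" "seg 1 = c 0"
  by (auto simp: seg_def vec2_eq_iff ends)

text \<open>The minus sign comes from \<open>seg\<close> running from right to left.\<close>

lemma integral_seg:
  fixes f :: "real^2 \<Rightarrow> real"
  shows "(LINT a|lborel. indicator {0..1} a * (f (seg a) * (c 0 $ 1 - c 1 $ 1)))
     = - (LINT x:{c 0 $ 1..c 1 $ 1}|lborel. f (pt x 0))"
proof -
  let ?k = "c 0 $ 1 - c 1 $ 1"
  have k: "?k \<noteq> 0" "\<bar>?k\<bar> = - ?k" using ends(3) by auto
  have ind: "indicator {c 0 $ 1..c 1 $ 1} (c 1 $ 1 + ?k * a) = (indicator {0..1} a :: real)" for a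
    unfolding indicator_def affine_mem_Icc[OF ends(3)] ..
  have "(LINT x:{c 0 $ 1..c 1 $ 1}|lborel. f (pt x 0))
      = \<bar>?k\<bar> * (LINT a|lborel. indicator {c 0 $ 1..c 1 $ 1} (c 1 $ 1 + ?k * a) * f (pt (c 1 $ 1 + ?k * a) 0))"
    unfolding set_lebesgue_integral_def real_scaleR_def
    by (subst lborel_integral_real_affine[OF k(1), of _ "c 1 $ 1"]) simp
  also have "\<dots> = - (?k * (LINT a|lborel. indicator {0..1} a * f (seg a)))"
    unfolding k(2) ind minus_mult_left by (simp only: seg_def mult.commute)
  also have "?k * (LINT a|lborel. indicator {0..1} a * f (seg a)) = (LINT a|lborel. indicator {0..1} a * (f (seg a) * ?k))"
    by (subst integral_mult_right_zero[symmetric]) (simp add: mult_ac)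
  finally show ?thesis by simp
qed

text \<open>The identities for the arc and for the segment are added. The end terms cancel because
  the segment starts where the arc stops and stops where it starts. The segment contributes nothing
  to the integral in dy and the wall integral to the one in dx.\<close>

lemma green_test:
  assumes pt: "plane_test g gx gy R" and s: "\<And>x. x \<notin> bnd \<Longrightarrow> angle x = 2 * pi * s * indicator D x"
  shows "s * (LINT z|lborel. indicator D (of_pair z) * gx z)
      = (LINT a|lborel. indicator {0..1} a * (g (to_pair (c a)) * c' a $ 2))" (is "s * ?X = ?x")
    and "s * (LINT z|lborel. indicator D (of_pair z) * gy z)
      = (LINT x:{c 0 $ 1..c 1 $ 1}|lborel. g (x, 0)) - (LINT a|lborel. indicator {0..1} a * (g (to_pair (c a)) * c' a $ 1))"
      (is "s * ?Y = ?w - ?y")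
proof -
  interpret plane_test g gx gy R by fact
  let ?A = "arc_angle (to_pair \<circ> c) (to_pair \<circ> c')" and ?B = "arc_angle (to_pair \<circ> seg) (\<lambda>a. (c 0 $ 1 - c 1 $ 1, 0))"
  have AE: "AE z in lborel. ?A z + ?B z = 2 * pi * (s * indicator D (of_pair z))"
  proof -
    have "AE x in lborel. x \<notin> bnd" using null_bnd by (rule AE_not_in)
    then have "AE z in lborel. of_pair z \<notin> bnd" by (rule AE_of_pair)
    then show ?thesis
    proof eventually_elim
      case (elim z)
      from s[OF elim] show ?case by (simp add: angle_def)
    qed
  qed
  have Dm: "D \<in> sets borel" using open_D by simp
  have iD: "(\<lambda>z. indicator D (of_pair z) :: real) \<in> borel_measurable lborel"
    by (rule measurable_compose[OF of_pair_measurable]) (use Dm in simp)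
  have m: "(\<lambda>z. h z * (2 * pi * (s * indicator D (of_pair z)))) \<in> borel_measurable lborel"
    if "h \<in> borel_measurable borel" for h :: "real \<times> real \<Rightarrow> real"
    using that by (intro borel_measurable_times borel_measurable_const iD) simp
  have sum: "(LINT z|lborel. h z * ?A z) + (LINT z|lborel. h z * ?B z) = 2 * pi * (s * (LINT z|lborel. indicator D (of_pair z) * h z))"
    if A: "integrable lborel (\<lambda>z. h z * ?A z)" and B: "integrable lborel (\<lambda>z. h z * ?B z)" and h: "h \<in> borel_measurable borel" for h
  proof -
    have "(LINT z|lborel. h z * ?A z) + (LINT z|lborel. h z * ?B z) = (LINT z|lborel. h z * ?A z + h z * ?B z)"
      using A B by simp
    also have "\<dots> = (LINT z|lborel. h z * (2 * pi * (s * indicator D (of_pair z))))"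
    proof (rule integral_cong_AE)
      show "(\<lambda>z. h z * ?A z + h z * ?B z) \<in> borel_measurable lborel" using A B by auto
      show "AE z in lborel. h z * ?A z + h z * ?B z = h z * (2 * pi * (s * indicator D (of_pair z)))"
        using AE by eventually_elim (simp only: distrib_left[symmetric])
    qed (rule m[OF h])
    also have "\<dots> = (LINT z|lborel. 2 * pi * s * (indicator D (of_pair z) * h z))"
      by (simp add: mult_ac)
    finally show ?thesis by simp
  qed
  have "2 * pi * (s * ?X) = 2 * pi * ?x"
    using sum[OF integrable_arc_angle[OF pair_deriv cont_pair'] integrable_arc_angle[OF seg_pair_deriv continuous_on_const] meas(2)]
    unfolding integral_arc_angle[OF pair_deriv cont_pair'] integral_arc_angle[OF seg_pair_deriv continuous_on_const]
    by (simp add: seg_ends o_def)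
  then show "s * ?X = ?x" by simp
  have w: "(LINT a|lborel. indicator {0..1} a * (g (to_pair (seg a)) * (c 0 $ 1 - c 1 $ 1))) = - ?w"
    using integral_seg[of "\<lambda>x. g (to_pair x)"] by simp
  have "2 * pi * (s * ?Y) = 2 * pi * (?w - ?y)"
    using sum[OF integral_arc_angle_swap(1)[OF pair_deriv cont_pair'] integral_arc_angle_swap(1)[OF seg_pair_deriv continuous_on_const] meas(3)]
    unfolding integral_arc_angle_swap(2)[OF pair_deriv cont_pair'] integral_arc_angle_swap(2)[OF seg_pair_deriv continuous_on_const]
    using w by (simp add: seg_ends o_def right_diff_distrib)
  then show "s * ?Y = ?w - ?y" by simp
qed

end

lemma Ck_has_derivative_grad:
  assumes "Ck (Suc 0) f" shows "(f has_derivative (\<lambda>h. grad f x \<bullet> h)) (at x)"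
proof -
  have d: "(f has_derivative frechet_derivative f (at x)) (at x)" using assms by (rule Ck_Suc_has_derivative)
  have "frechet_derivative f (at x) h = grad f x \<bullet> h" for h
  proof -
    have "h = h $ 1 *\<^sub>R axis 1 1 + h $ 2 *\<^sub>R axis 2 1" by (simp add: vec2_eq_iff axis_def)
    then have "frechet_derivative f (at x) h = frechet_derivative f (at x) (h $ 1 *\<^sub>R axis 1 1 + h $ 2 *\<^sub>R axis 2 1)"
      by simp
    also have "\<dots> = grad f x \<bullet> h"
      using has_derivative_linear[OF d] by (simp add: linear_add linear_scale grad_def inner_vec2)
    finally show ?thesis .
  qed
  then show ?thesis using d by (simp add: fun_eq_iff has_derivative_eq_rhs)
qed

lemma grad_eqI:
  assumes "(f has_derivative (\<lambda>h. w \<bullet> h)) (at x)" shows "grad f x = w"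
proof -
  have "frechet_derivative f (at x) = (\<lambda>h. w \<bullet> h)" using assms frechet_derivative_at by metis
  then show ?thesis by (simp add: grad_def vec2_eq_iff inner_axis)
qed

lemma grad_cong_open:
  assumes "Ck (Suc 0) f" "open U" "x \<in> U" "\<And>y. y \<in> U \<Longrightarrow> f y = g y"
  shows "grad g x = grad f x"
  using has_derivative_transform_within_open[OF Ck_has_derivative_grad[OF assms(1)] assms(2-4)]
  by (rule grad_eqI)

lemma Ck_grad_nth: "Ck (Suc k) f \<Longrightarrow> Ck k (\<lambda>x. grad f x $ i)"
  by (simp add: grad_def Ck_frechet)

lemma plane_test_of_Ck:
  assumes G: "Ck (Suc 0) G" and R: "\<And>x. \<bar>x $ 1\<bar> > R \<or> \<bar>x $ 2\<bar> > R \<Longrightarrow> G x = 0"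
  shows "plane_test (\<lambda>z. G (of_pair z)) (\<lambda>z. grad G (of_pair z) $ 1) (\<lambda>z. grad G (of_pair z) $ 2) R"
proof
  have c: "continuous_on UNIV (\<lambda>z. grad G (of_pair z) $ i)" for i
    using continuous_on_compose2[OF Ck_imp_continuous_on[OF Ck_grad_nth[OF G], of UNIV] continuous_on_of_pair, of UNIV] by simp
  show "continuous_on UNIV (\<lambda>z. grad G (of_pair z) $ 1)" "continuous_on UNIV (\<lambda>z. grad G (of_pair z) $ 2)"
    by (rule c)+
  fix z
  from has_derivative_compose[OF bounded_linear_imp_has_derivative[OF bounded_linear_of_pair] Ck_has_derivative_grad[OF G]]
  show "((\<lambda>z. G (of_pair z)) has_derivative (\<lambda>h. grad G (of_pair z) $ 1 * fst h + grad G (of_pair z) $ 2 * snd h)) (at z)"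
    by (rule has_derivative_eq_rhs) (auto simp: fun_eq_iff inner_vec2)
  assume z: "\<bar>fst z\<bar> > R \<or> \<bar>snd z\<bar> > R"
  \<comment> \<open>\<open>G\<close> vanishes on an open set around the point, so its gradient does
    too.\<close>
  have "grad G (of_pair z) = grad (\<lambda>x. 0) (of_pair z)"
  proof (rule grad_cong_open[OF Ck_const])
    show "open {x :: real^2. \<bar>x $ 1\<bar> > R \<or> \<bar>x $ 2\<bar> > R}"
      by (intro open_Collect_disj open_Collect_less continuous_intros)
  qed (use z R in auto)
  also have "\<dots> = 0" by (rule grad_eqI) simp
  finally show "G (of_pair z) = 0 \<and> grad G (of_pair z) $ 1 = 0 \<and> grad G (of_pair z) $ 2 = 0"
    using R z by simp
qed

context droplet
begin

lemma set_integral_D: 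
  fixes f :: "real^2 \<Rightarrow> real"
  assumes "f \<in> borel_measurable borel"
  shows "(LINT x:D|lborel. f x) = (LINT z|lborel. indicator D (of_pair z) * f (of_pair z))"
proof -
  have "D \<in> sets borel" using open_D by simp
  then show ?thesis unfolding set_lebesgue_integral_def real_scaleR_def
    by (intro integral_of_pair borel_measurable_times assms) simp
qed

text \<open>The interior lies above the wall, so the loop, which runs along the wall from right to left,
  is traversed clockwise; a bump function centred on the wall detects this.\<close>

lemma orientation:
  assumes s: "s \<in> {-1, 1}" "\<And>x. x \<notin> bnd \<Longrightarrow> angle x = 2 * pi * s * indicator D x"
  shows "s = -1"
proof (rule ccontr)
  assume "s \<noteq> -1"
  then have s1: "s = 1" using s(1) by simp
  \<comment> \<open>The midpoint of the wetted wall has a positive distance from the interface; a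
    bump of that radius sees only the wall.\<close>
  define m where "m = (c 0 $ 1 + c 1 $ 1) / 2"
  define p where "p = pt m 0"
  have "p \<notin> c ` {0..1}"
  proof
    assume "p \<in> c ` {0..1}"
    then obtain a where a: "a \<in> {0..1}" "c a = p" by auto
    then have "\<not> a \<in> {0<..<1}" using above[of a] by (auto simp: p_def)
    then have "a = 0 \<or> a = 1" using a(1) by auto
    moreover have "c a $ 1 = m" using a(2) by (simp add: p_def)
    ultimately show False using ends(3) by (auto simp: m_def)
  qed
  moreover have "closed (c ` {0..1})" by (intro compact_imp_closed compact_continuous_image cont_c) auto
  ultimately obtain r where r: "0 < r" "\<And>x. x \<in> c ` {0..1} \<Longrightarrow> r \<le> dist p x"
    using separate_point_closed by metis
  define G where "G x = sqplus (r\<^sup>2 - (x - p) \<bullet> (x - p))" for x :: "real^2"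
  have G: "Ck (Suc 0) G"
    unfolding G_def by (intro Ck_compose[OF Ck_sqplus] Ck_intros)
  have G0: "G x = 0" if "r \<le> dist p x" for x
  proof -
    have "r\<^sup>2 \<le> (dist p x)\<^sup>2" using that r(1) by (intro power_mono) auto
    moreover have "(dist p x)\<^sup>2 = (x - p) \<bullet> (x - p)"
      by (metis dist_commute dist_norm power2_norm_eq_inner)
    ultimately show ?thesis by (simp add: G_def sqplus_def)
  qed
  have gradG: "grad G x $ 2 = - 4 * max 0 (r\<^sup>2 - (x - p) \<bullet> (x - p)) * x $ 2" for x
  proof -
    have "((\<lambda>x. r\<^sup>2 - (x - p) \<bullet> (x - p)) has_derivative (\<lambda>h. - 2 * ((x - p) \<bullet> h))) (at x)"
      by (auto intro!: derivative_eq_intros simp: fun_eq_iff inner_commute)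
    from has_derivative_compose[OF this DERIV_sqplus[unfolded has_field_derivative_def]]
    have "(G has_derivative (\<lambda>h. (- 4 * max 0 (r\<^sup>2 - (x - p) \<bullet> (x - p))) *\<^sub>R (x - p) \<bullet> h)) (at x)"
      unfolding G_def[abs_def] by (rule has_derivative_eq_rhs) (auto simp: fun_eq_iff)
    from grad_eqI[OF this] show ?thesis by (simp add: p_def)
  qed
  have "\<bar>x $ 1\<bar> > \<bar>m\<bar> + r \<or> \<bar>x $ 2\<bar> > \<bar>m\<bar> + r \<Longrightarrow> G x = 0" for x
    using component_le_norm_cart[of "p - x" 1] component_le_norm_cart[of "p - x" 2]
    by (intro G0) (auto simp: p_def dist_norm)
  from green_test(2)[OF plane_test_of_Ck[OF G this] s(2)]
  have eq: "(LINT z|lborel. indicator D (of_pair z) * grad G (of_pair z) $ 2)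
     = (LINT x:{c 0 $ 1..c 1 $ 1}|lborel. G (pt x 0)) - (LINT a|lborel. indicator {0..1} a * (G (c a) * c' a $ 1))"
    by (simp add: s1)
  have "(LINT a|lborel. indicator {0..1} a * (G (c a) * c' a $ 1)) = (LINT (a::real)|lborel. 0)"
    by (intro Bochner_Integration.integral_cong refl) (use G0 r(2) in \<open>auto simp: indicator_def\<close>)
  \<comment> \<open>In the droplet y is nonnegative, so the bump does not increase upwards there;
    with s = 1 this nonpositive area integral would equal the positive wall integral.\<close>
  moreover have "(LINT z|lborel. indicator D (of_pair z) * grad G (of_pair z) $ 2) \<le> 0"
  proof -
    have "0 \<le> (LINT z|lborel. - (indicator D (of_pair z) * grad G (of_pair z) $ 2))"
      using halfplane by (intro integral_nonneg_AE AE_I2) (auto simp: gradG indicator_def)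
    then show ?thesis by simp
  qed
  moreover have "(LINT x:{c 0 $ 1..c 1 $ 1}|lborel. G (pt x 0)) > 0"
  proof -
    have cG: "continuous_on {c 0 $ 1..c 1 $ 1} (\<lambda>x. G (pt x 0))"
      by (intro continuous_on_compose2[OF Ck_imp_continuous_on[OF G, of UNIV]] continuous_intros) auto
    have nn: "0 \<le> G x" for x by (simp add: G_def sqplus_def)
    have "(LINT x:{c 0 $ 1..c 1 $ 1}|lborel. G (pt x 0)) = integral {c 0 $ 1..c 1 $ 1} (\<lambda>x. G (pt x 0))"
      by (intro set_borel_integral_eq_integral(2) borel_integrable_atLeastAtMost' cG)
    moreover have "integral {c 0 $ 1..c 1 $ 1} (\<lambda>x. G (pt x 0)) \<noteq> 0"
    proof
      assume "integral {c 0 $ 1..c 1 $ 1} (\<lambda>x. G (pt x 0)) = 0"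
      then have "G (pt m 0) = 0"
        using integral_eq_0_iff[OF cG ends(3) nn] ends(3) by (auto simp: m_def)
      then show False using r(1) by (simp add: G_def sqplus_def p_def)
    qed
    moreover have "integral {c 0 $ 1..c 1 $ 1} (\<lambda>x. G (pt x 0)) \<ge> 0"
      by (intro integral_nonneg integrable_continuous_interval cG nn)
    ultimately show ?thesis by simp
  qed
  ultimately show False using eq by simp
qed

text \<open>Both sides depend only on \<open>V\<close> near the closed droplet, so \<open>V\<close>
  may be multiplied by a cutoff and the formula for test functions applies, with the sign found in
  \<open>orientation\<close>.\<close>

lemma green:
  assumes V: "Ck (Suc 0) V"
  shows "(LINT x:D|lborel. grad V x $ 1) = - (LINT a:{0..1}|lborel. V (c a) * c' a $ 2)"
    and "(LINT x:D|lborel. grad V x $ 2)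
      = (LINT a:{0..1}|lborel. V (c a) * c' a $ 1) - (LINT x:{c 0 $ 1..c 1 $ 1}|lborel. V (pt x 0))"
proof -
  obtain s where s: "s \<in> {-1, 1}" "\<And>x. x \<notin> bnd \<Longrightarrow> angle x = 2 * pi * s * indicator D x"
    using angle_const by blast
  have s1: "s = -1" using s by (rule orientation)
  obtain R where R: "R > 0" "\<And>x. x \<in> closure D \<Longrightarrow> norm x < R"
    using compact_imp_bounded[OF compact_closure_D] unfolding bounded_pos_less by auto
  \<comment> \<open>The inner \<open>sqplus\<close> is 0 for |x| <= R and at least 1 once |x|^2 >=
    R^2 + 1. Hence the cutoff is 1 on a ball that contains the closed droplet and 0 outside the
    square of half-width R + 1.\<close>
  define G where "G x = V x * sqplus (1 - sqplus (x \<bullet> x - R\<^sup>2))" for x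
  have G: "Ck (Suc 0) G"
    unfolding G_def by (intro Ck_intros V Ck_compose[OF Ck_sqplus])
  have GV: "V x = G x" if "x \<in> ball 0 R" for x
  proof -
    have "x \<bullet> x \<le> R\<^sup>2" using that power_mono[of "norm x" R 2] by (simp add: power2_norm_eq_inner)
    then show ?thesis by (simp add: G_def sqplus_def)
  qed
  have gradGV: "grad G x = grad V x" if "x \<in> ball 0 R" for x
    by (rule grad_cong_open[OF V open_ball that GV])
  have G0: "G x = 0" if "\<bar>x $ 1\<bar> > R + 1 \<or> \<bar>x $ 2\<bar> > R + 1" for x
  proof -
    have "norm x > R + 1"
      using that component_le_norm_cart[of x 1] component_le_norm_cart[of x 2] by auto
    then have "(R + 1)\<^sup>2 \<le> (norm x)\<^sup>2" using R(1) by (intro power_mono) auto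
    then have "(R + 1)\<^sup>2 \<le> x \<bullet> x" unfolding power2_norm_eq_inner .
    moreover have "(R + 1)\<^sup>2 = R\<^sup>2 + 2 * R + 1" by (simp add: power2_sum)
    ultimately have "x \<bullet> x - R\<^sup>2 \<ge> 1" using R(1) by linarith
    then have "sqplus (x \<bullet> x - R\<^sup>2) \<ge> 1" unfolding sqplus_def by (intro one_le_power) auto
    then show ?thesis by (simp add: G_def sqplus_def)
  qed
  have Dball: "x \<in> ball 0 R" if "x \<in> D \<or> x \<in> bnd" for x
    using R(2)[of x] that by (auto simp: closure_D)
  note gt = green_test[OF plane_test_of_Ck[of G "R + 1", OF G G0] s(2), unfolded s1]
  have mG: "(\<lambda>x. grad G x $ i) \<in> borel_measurable borel" for i
    using Ck_imp_continuous_on[OF Ck_grad_nth[OF G]] by (rule borel_measurable_continuous_onI)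
  have mV: "(\<lambda>x. grad V x $ i) \<in> borel_measurable borel" for i
    using Ck_imp_continuous_on[OF Ck_grad_nth[OF V]] by (rule borel_measurable_continuous_onI)
  have L: "(LINT x:D|lborel. grad V x $ i) = (LINT z|lborel. indicator D (of_pair z) * grad G (of_pair z) $ i)" for i
    unfolding set_integral_D[OF mV]
    by (intro Bochner_Integration.integral_cong refl) (use gradGV Dball in \<open>auto simp: indicator_def\<close>)
  have C: "(LINT a|lborel. indicator {0..1} a * (G (to_pair_inv (c a)) * f a)) = (LINT a:{0..1}|lborel. V (c a) * f a)"
    if "\<And>x. to_pair_inv x = x" for to_pair_inv f
    unfolding set_lebesgue_integral_def
    by (intro Bochner_Integration.integral_cong refl) (use that GV[OF Dball] in \<open>auto simp: indicator_def bnd_def\<close>)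
  have W: "(LINT x:{c 0 $ 1..c 1 $ 1}|lborel. G (pt x 0)) = (LINT x:{c 0 $ 1..c 1 $ 1}|lborel. V (pt x 0))"
    by (intro set_lebesgue_integral_cong) (use GV[OF Dball] in \<open>auto simp: bnd_def\<close>)
  show "(LINT x:D|lborel. grad V x $ 1) = - (LINT a:{0..1}|lborel. V (c a) * c' a $ 2)"
    using gt(1) C[of "\<lambda>x. of_pair (to_pair x)"] unfolding L by simp
  show "(LINT x:D|lborel. grad V x $ 2)
      = (LINT a:{0..1}|lborel. V (c a) * c' a $ 1) - (LINT x:{c 0 $ 1..c 1 $ 1}|lborel. V (pt x 0))"
    using gt(2) C[of "\<lambda>x. of_pair (to_pair x)"] W unfolding L by simp
qed

end

section \<open>Divergence theorem in the droplet and in the outer fluid\<close>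

lemma integrable_continuous_box:
  fixes f :: "'a::euclidean_space \<Rightarrow> real"
  assumes "continuous_on UNIV f" "A \<in> sets borel" "bounded A"
  shows "integrable lborel (\<lambda>x. indicator A x * f x)"
proof -
  have K: "compact (closure A)" using assms(3) by simp
  have "integrable lborel (\<lambda>x. indicator (closure A) x *\<^sub>R f x)"
    by (rule borel_integrable_compact[OF K continuous_on_subset[OF assms(1)]]) simp
  then show ?thesis
    by (rule Bochner_Integration.integrable_bound)
      (use assms(2) borel_measurable_continuous_onI[OF assms(1)] closure_subset[of A] in \<open>auto simp: indicator_def\<close>)
qed

lemma set_integrable_continuous_box:
  fixes f :: "'a::euclidean_space \<Rightarrow> real"
  assumes "continuous_on UNIV f" "A \<in> sets borel" "bounded A"
  shows "set_integrable lborel A f"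
  using integrable_continuous_box[OF assms] by (simp add: set_integrable_def)

lemma set_integral_Icc_eq_integral:
  fixes f :: "real \<Rightarrow> real"
  assumes "continuous_on {a..b} f" shows "(LINT x:{a..b}|lborel. f x) = integral {a..b} f"
  by (intro set_borel_integral_eq_integral(2) borel_integrable_atLeastAtMost' assms)

lemma FTC_set_integral:
  fixes F f :: "real \<Rightarrow> real"
  assumes "a \<le> b" "\<And>x. (F has_real_derivative f x) (at x)" "continuous_on UNIV f"
  shows "(LINT x:{a..b}|lborel. f x) = F b - F a"
  using integral_FTC_Icc_real[OF assms(1), of F f] assms(2,3)
  by (simp add: set_lebesgue_integral_def continuous_on_eq_continuous_at mult.commute)

lemma grad_line_deriv:
  assumes V: "Ck (Suc 0) V"
  shows "((\<lambda>x. V (pt x y)) has_real_derivative grad V (pt x y) $ 1) (at x)"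
    and "((\<lambda>y. V (pt x y)) has_real_derivative grad V (pt x y) $ 2) (at y)"
proof -
  have "((\<lambda>x. pt x y) has_derivative (\<lambda>h. pt h 0)) (at x)" "((\<lambda>y. pt x y) has_derivative (\<lambda>h. pt 0 h)) (at y)"
    unfolding pt_eq_axis by (auto intro!: derivative_eq_intros)
  from this[THEN has_derivative_compose, OF Ck_has_derivative_grad[OF V]]
  show "((\<lambda>x. V (pt x y)) has_real_derivative grad V (pt x y) $ 1) (at x)"
    and "((\<lambda>y. V (pt x y)) has_real_derivative grad V (pt x y) $ 2) (at y)"
    by (simp_all add: has_field_derivative_def inner_vec2)
qed

lemma set_integral_null_diff:
  fixes f :: "'a::euclidean_space \<Rightarrow> real"
  assumes "N \<in> null_sets lborel" "f \<in> borel_measurable borel" "A \<in> sets borel" "B \<in> sets borel"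
    "A - B \<subseteq> N" "B - A \<subseteq> N"
  shows "(LINT x:A|lborel. f x) = (LINT x:B|lborel. f x)"
  unfolding set_lebesgue_integral_def
proof (rule integral_cong_AE)
  have "AE x in lborel. x \<notin> N" using assms(1) by (rule AE_not_in)
  then show "AE x in lborel. indicator A x *\<^sub>R f x = indicator B x *\<^sub>R f x"
    by eventually_elim (use assms(5,6) in \<open>auto simp: indicator_def\<close>)
qed (use assms in auto)

lemma box_null: "cbox a b - box a b \<in> null_sets lborel" for a b :: "'a::euclidean_space"
proof -
  have "negligible (cbox a b - box a b)" by (rule negligible_frontier_interval)
  then have "emeasure lebesgue (cbox a b - box a b) = 0" by (simp add: negligible_iff_null_sets null_setsD1)
  moreover have "cbox a b - box a b \<in> sets borel" by simp
  ultimately show ?thesis by (auto simp: null_sets_def)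
qed

lemma set_integral_box_cbox:
  fixes f :: "real^2 \<Rightarrow> real"
  assumes "continuous_on UNIV f"
  shows "(LINT x:box a b|lborel. f x) = (LINT x:cbox a b|lborel. f x)"
  by (rule set_integral_null_diff[OF box_null])
    (use box_subset_cbox borel_measurable_continuous_onI[OF assms] in auto)

lemma set_integral_cbox_iterated:
  fixes f :: "real^2 \<Rightarrow> real"
  assumes f: "continuous_on UNIV f"
  shows "(LINT z:cbox (pt a b) (pt c d)|lborel. f z) = (LINT x:{a..c}|lborel. LINT y:{b..d}|lborel. f (pt x y))"
    and "(LINT z:cbox (pt a b) (pt c d)|lborel. f z) = (LINT y:{b..d}|lborel. LINT x:{a..c}|lborel. f (pt x y))"
proof -
  let ?F = "\<lambda>z. indicator {a..c} (fst z) * (indicator {b..d} (snd z) * f (of_pair z))"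
  have cf: "continuous_on UNIV (\<lambda>z. f (of_pair z))"
    using continuous_on_compose2[OF f continuous_on_of_pair, of UNIV] by simp
  have ind: "indicator (cbox (pt a b) (pt c d)) (of_pair z) = (indicator {a..c} (fst z) * indicator {b..d} (snd z) :: real)" for z
    by (auto simp: indicator_def cbox_def Basis_vec2 inner_axis)
  have "integrable lborel (\<lambda>z. indicator (cbox (a, b) (c, d)) z * f (of_pair z))"
    by (rule integrable_continuous_box[OF cf]) auto
  then have int: "integrable (lborel \<Otimes>\<^sub>M lborel) ?F"
    by (simp add: lborel_prod cbox_Pair_eq indicator_times split_def mult.assoc)
  have eta: "(\<lambda>(x, y). ?F (x, y)) = ?F" by auto
  have "(LINT z:cbox (pt a b) (pt c d)|lborel. f z) = (LINT z|lborel. ?F z)"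
    unfolding set_lebesgue_integral_def real_scaleR_def
    by (subst integral_of_pair)
      (use borel_measurable_continuous_onI[OF f] in \<open>simp_all add: ind mult.assoc\<close>)
  also have "\<dots> = (LINT x|lborel. LINT y|lborel. ?F (x, y))"
    using lborel_pair.integral_fst'[OF int] unfolding lborel_prod by (rule sym)
  finally have 1: "(LINT z:cbox (pt a b) (pt c d)|lborel. f z) = (LINT x|lborel. LINT y|lborel. ?F (x, y))" .
  then show "(LINT z:cbox (pt a b) (pt c d)|lborel. f z) = (LINT x:{a..c}|lborel. LINT y:{b..d}|lborel. f (pt x y))"
    by (simp add: set_lebesgue_integral_def)
  have sw: "(LINT x|lborel. LINT y|lborel. ?F (x, y)) = (LINT y|lborel. LINT x|lborel. ?F (x, y))"
    using lborel_pair.Fubini_integral[of "\<lambda>x y. ?F (x, y)"] int unfolding eta by simp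
  show "(LINT z:cbox (pt a b) (pt c d)|lborel. f z) = (LINT y:{b..d}|lborel. LINT x:{a..c}|lborel. f (pt x y))"
  proof -
    have "(LINT x|lborel. ?F (x, y)) = indicator {b..d} y *\<^sub>R (LINT x:{a..c}|lborel. f (pt x y))" for y
    proof -
      have "(LINT x|lborel. ?F (x, y)) = (LINT x|lborel. indicator {b..d} y * (indicator {a..c} x * f (pt x y)))"
        by (intro Bochner_Integration.integral_cong refl) (simp add: mult.left_commute)
      then show ?thesis by (simp add: set_lebesgue_integral_def)
    qed
    then show ?thesis unfolding 1 sw
      by (simp only: set_lebesgue_integral_def)
  qed
qed

lemma green_box:
  assumes V: "Ck (Suc 0) V" and le: "a \<le> c" "b \<le> d"
  shows "(LINT z:box (pt a b) (pt c d)|lborel. grad V z $ 1) = (LINT y:{b..d}|lborel. V (pt c y) - V (pt a y))"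
    and "(LINT z:box (pt a b) (pt c d)|lborel. grad V z $ 2) = (LINT x:{a..c}|lborel. V (pt x d) - V (pt x b))"
proof -
  have cg: "continuous_on A (\<lambda>z. grad V z $ i)" for i A using Ck_imp_continuous_on[OF Ck_grad_nth[OF V]] .
  have "(LINT x:{a..c}|lborel. grad V (pt x y) $ 1) = V (pt c y) - V (pt a y)" for y
    by (rule FTC_set_integral[OF le(1) grad_line_deriv(1)[OF V]])
      (rule continuous_on_compose2[OF cg[of UNIV], of UNIV "\<lambda>x. pt x y"], auto intro!: continuous_intros)
  then show "(LINT z:box (pt a b) (pt c d)|lborel. grad V z $ 1) = (LINT y:{b..d}|lborel. V (pt c y) - V (pt a y))"
    unfolding set_integral_box_cbox[OF cg] set_integral_cbox_iterated(2)[OF cg] by simp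
  have "(LINT y:{b..d}|lborel. grad V (pt x y) $ 2) = V (pt x d) - V (pt x b)" for x
    by (rule FTC_set_integral[OF le(2) grad_line_deriv(2)[OF V]])
      (rule continuous_on_compose2[OF cg[of UNIV], of UNIV "\<lambda>y. pt x y"], auto intro!: continuous_intros)
  then show "(LINT z:box (pt a b) (pt c d)|lborel. grad V z $ 2) = (LINT x:{a..c}|lborel. V (pt x d) - V (pt x b))"
    unfolding set_integral_box_cbox[OF cg] set_integral_cbox_iterated(1)[OF cg] by simp
qed

lemma jacobian_nth:
  assumes V: "Ck (Suc 0) V" shows "jacobian V (at x) $ i $ j = grad (\<lambda>y. V y $ i) x $ j"
proof -
  have d: "(V has_derivative frechet_derivative V (at x)) (at x)" using V by (rule Ck_Suc_has_derivative)
  have "((\<lambda>y. V y $ i) has_derivative (\<lambda>h. frechet_derivative V (at x) h $ i)) (at x)"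
    by (rule bounded_linear.has_derivative[OF bounded_linear_vec_nth d])
  then have "frechet_derivative (\<lambda>y. V y $ i) (at x) = (\<lambda>h. frechet_derivative V (at x) h $ i)"
    using frechet_derivative_at by metis
  then show ?thesis by (simp add: grad_def jacobian_def matrix_def)
qed

lemma dvg_eq: "Ck (Suc 0) V \<Longrightarrow> dvg V x = grad (\<lambda>y. V y $ 1) x $ 1 + grad (\<lambda>y. V y $ 2) x $ 2"
  by (simp add: dvg_def trace_def sum_2 jacobian_nth)

lemma Ck_dvg: "Ck (Suc k) V \<Longrightarrow> Ck k (dvg V)"
proof -
  assume V: "Ck (Suc k) V"
  then have V1: "Ck (Suc 0) V" using Ck_mono[of "Suc k" V "Suc 0"] by simp
  have "Ck k (\<lambda>x. grad (\<lambda>y. V y $ 1) x $ 1 + grad (\<lambda>y. V y $ 2) x $ 2)"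
    by (intro Ck_add Ck_grad_nth Ck_vec_nth V)
  then show ?thesis by (simp add: dvg_eq[OF V1, abs_def])
qed

locale drop_in_box = droplet +
  fixes L H :: real
  assumes in_box: "- L < c 0 $ 1" "c 1 $ 1 < L" "0 < H"
    and int_box: "\<And>a. a \<in> {0<..<1} \<Longrightarrow> c a \<in> box (pt (- L) 0) (pt L H)"
begin

text \<open>The left normal scaled by the speed: integrating against it in the parameter is
  integrating against the unit normal in arclength. As the interface runs from left to right, it
  points out of the droplet.\<close>

definition nrm :: "real \<Rightarrow> real^2" where "nrm a = pt (- (c' a $ 2)) (c' a $ 1)"
definition Out :: "(real^2) set" where "Out = box (pt (- L) 0) (pt L H) - closure D"

lemma D_subset_box: "D \<subseteq> box (pt (- L) 0) (pt L H)"
proof -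
  have "bnd \<subseteq> cbox (pt (- L) 0) (pt L H)"
  proof
    fix x assume "x \<in> bnd"
    then consider a where "a \<in> {0..1}" "x = c a" | b where "b \<in> {c 0 $ 1..c 1 $ 1}" "x = pt b 0" by (auto simp: bnd_def)
    then show "x \<in> cbox (pt (- L) 0) (pt L H)"
    proof cases
      case (1 a)
      then consider "a = 0" | "a = 1" | "a \<in> {0<..<1}" by force
      then show ?thesis
      proof cases
        case 3 then show ?thesis using int_box box_subset_cbox 1 by blast
      qed (use 1 ends in_box in \<open>auto simp: cbox_def Basis_vec2 inner_axis\<close>)
    qed (use in_box in \<open>auto simp: cbox_def Basis_vec2 inner_axis\<close>)
  qed
  then have "- cbox (pt (- L) 0) (pt L H) \<subseteq> outside bnd" by (intro outside_subset_convex convex_box)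
  then have "D \<subseteq> cbox (pt (- L) 0) (pt L H)" unfolding D_def using inside_Int_outside by blast
  then have "D \<subseteq> interior (cbox (pt (- L) 0) (pt L H))" by (intro interior_maximal open_D)
  then show ?thesis by (simp add: interior_cbox)
qed

lemma Out_meas: "Out \<in> sets borel" and Out_bounded: "bounded Out" and D_meas: "D \<in> sets borel"
  using open_D by (auto simp: Out_def intro: bounded_subset[OF bounded_box])

lemma set_integral_Out:
  fixes f :: "real^2 \<Rightarrow> real"
  assumes f: "continuous_on UNIV f"
  shows "(LINT x:Out|lborel. f x) = (LINT x:box (pt (- L) 0) (pt L H)|lborel. f x) - (LINT x:D|lborel. f x)"
proof -
  have "(LINT x:box (pt (- L) 0) (pt L H)|lborel. f x) = (LINT x:D \<union> Out|lborel. f x)"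
    by (rule set_integral_null_diff[OF null_bnd])
      (use D_subset_box D_meas Out_meas borel_measurable_continuous_onI[OF f] in \<open>auto simp: Out_def closure_D\<close>)
  also have "\<dots> = (LINT x:D|lborel. f x) + (LINT x:Out|lborel. f x)"
    by (intro set_integral_Un set_integrable_continuous_box f Out_meas D_meas Out_bounded bounded_D)
      (auto simp: Out_def closure_D)
  finally show ?thesis by simp
qed

lemma set_integral_add':
  fixes f g :: "real^2 \<Rightarrow> real"
  assumes "continuous_on UNIV f" "continuous_on UNIV g" "A \<in> sets borel" "bounded A"
  shows "(LINT x:A|lborel. f x + g x) = (LINT x:A|lborel. f x) + (LINT x:A|lborel. g x)"
  by (intro set_integral_add set_integrable_continuous_box assms)

lemma divergence_D:
  assumes V: "Ck (Suc 0) V"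
  shows "(LINT x:D|lborel. dvg V x) = (LINT a:{0..1}|lborel. V (c a) \<bullet> nrm a)
     - (LINT x:{c 0 $ 1..c 1 $ 1}|lborel. V (pt x 0) $ 2)"
proof -
  have Vi: "Ck (Suc 0) (\<lambda>y. V y $ i)" for i using Ck_vec_nth[OF V] .
  have ca: "continuous_on UNIV (\<lambda>a. V (c a) $ i * c' a $ j)" for i j
    by (intro continuous_intros continuous_on_compose2[OF Ck_imp_continuous_on[OF V, of UNIV]] cont_c cont_c') auto
  have "(LINT x:D|lborel. dvg V x) = (LINT x:D|lborel. grad (\<lambda>y. V y $ 1) x $ 1) + (LINT x:D|lborel. grad (\<lambda>y. V y $ 2) x $ 2)"
    unfolding dvg_eq[OF V] by (intro set_integral_add' Ck_imp_continuous_on[OF Ck_grad_nth[OF Vi]] D_meas bounded_D)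
  also have "\<dots> = (LINT a:{0..1}|lborel. V (c a) $ 2 * c' a $ 1) - (LINT a:{0..1}|lborel. V (c a) $ 1 * c' a $ 2)
     - (LINT x:{c 0 $ 1..c 1 $ 1}|lborel. V (pt x 0) $ 2)"
    unfolding green(1)[OF Vi] green(2)[OF Vi] by simp
  also have "(LINT a:{0..1}|lborel. V (c a) $ 2 * c' a $ 1) - (LINT a:{0..1}|lborel. V (c a) $ 1 * c' a $ 2)
     = (LINT a:{0..1}|lborel. V (c a) $ 2 * c' a $ 1 - V (c a) $ 1 * c' a $ 2)"
    by (intro set_integral_diff(2)[symmetric] set_integrable_continuous_box ca) auto
  finally show ?thesis by (simp add: nrm_def inner_vec2)
qed

lemma wall_split:
  fixes h :: "real \<Rightarrow> real"
  assumes "continuous_on UNIV h"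
  shows "(LINT x:{- L..L}|lborel. h x) = (LINT x:{c 0 $ 1..c 1 $ 1}|lborel. h x)
     + (LINT x:{- L..<c 0 $ 1} \<union> {c 1 $ 1<..L}|lborel. h x)"
proof -
  have "{- L..L} = {c 0 $ 1..c 1 $ 1} \<union> ({- L..<c 0 $ 1} \<union> {c 1 $ 1<..L})"
    using in_box ends by auto
  then show ?thesis
    by (simp only:) (intro set_integral_Un set_integrable_continuous_box assms; auto)
qed

text \<open>The formula for the box minus that for the droplet, the curve itself being a null set.
  The interface thus enters with the opposite sign, and the wetted part of the bottom side drops
  out.\<close>

lemma divergence_Out:
  assumes V: "Ck (Suc 0) V"
  shows "(LINT x:Out|lborel. dvg V x) = - (LINT a:{0..1}|lborel. V (c a) \<bullet> nrm a)
     - (LINT x:{- L..<c 0 $ 1} \<union> {c 1 $ 1<..L}|lborel. V (pt x 0) $ 2)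
     + (LINT x:{- L..L}|lborel. V (pt x H) $ 2)
     + (LINT y:{0..H}|lborel. V (pt L y) $ 1 - V (pt (- L) y) $ 1)"
proof -
  have Vi: "Ck (Suc 0) (\<lambda>y. V y $ i)" for i using Ck_vec_nth[OF V] .
  have cx: "continuous_on UNIV (\<lambda>x. V (pt x y) $ i)" for y i
    by (intro continuous_intros continuous_on_compose2[OF Ck_imp_continuous_on[OF V, of UNIV]]) auto
  have LH: "- L \<le> L" "0 \<le> H" using in_box ends by auto
  have "(LINT x:box (pt (- L) 0) (pt L H)|lborel. dvg V x)
      = (LINT x:box (pt (- L) 0) (pt L H)|lborel. grad (\<lambda>y. V y $ 1) x $ 1)
       + (LINT x:box (pt (- L) 0) (pt L H)|lborel. grad (\<lambda>y. V y $ 2) x $ 2)"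
    unfolding dvg_eq[OF V] by (intro set_integral_add' Ck_imp_continuous_on[OF Ck_grad_nth[OF Vi]]) auto
  also have "\<dots> = (LINT y:{0..H}|lborel. V (pt L y) $ 1 - V (pt (- L) y) $ 1)
     + ((LINT x:{- L..L}|lborel. V (pt x H) $ 2) - (LINT x:{- L..L}|lborel. V (pt x 0) $ 2))"
    unfolding green_box[OF Vi LH]
    by (subst set_integral_diff(2)) (auto intro!: set_integrable_continuous_box cx)
  finally show ?thesis
    unfolding set_integral_Out[OF Ck_imp_continuous_on[OF Ck_dvg[OF V]]] divergence_D[OF V] wall_split[OF cx]
    by simp
qed

end

section \<open>Reynolds transport\<close>

lemma Ck_slice: "Ck k (\<lambda>(t, x). f t x) \<Longrightarrow> Ck k (f t)"
  using Ck_compose[OF _ Ck_Pair[OF Ck_const Ck_id], of k "\<lambda>(t, x). f t x" t] by simp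

lemma Ck_joint_compose:
  assumes "Ck k (\<lambda>(t, x). f t x)" "Ck k g" "Ck k h"
  shows "Ck k (\<lambda>z. f (g z) (h z))"
  using Ck_compose[OF assms(1) Ck_Pair[OF assms(2,3)]] by simp

lemma Ck_joint_derivs:
  fixes f :: "real \<Rightarrow> 'a::euclidean_space \<Rightarrow> 'b::euclidean_space"
  assumes f: "Ck (Suc k) (\<lambda>(t, x). f t x)"
  shows "((\<lambda>s. f s x) has_vector_derivative vector_derivative (\<lambda>s. f s x) (at t)) (at t)"
    and "Ck k (\<lambda>(t, x). vector_derivative (\<lambda>s. f s x) (at t))"
    and "frechet_derivative (f t) (at x) v = frechet_derivative (\<lambda>(t, x). f t x) (at (t, x)) (0, v)"
    and "Ck k (\<lambda>(t, x). frechet_derivative (f t) (at x) v)"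
    and "frechet_derivative (\<lambda>(t, x). f t x) (at (t, x)) (r, v)
      = r *\<^sub>R vector_derivative (\<lambda>s. f s x) (at t) + frechet_derivative (f t) (at x) v"
proof -
  let ?f = "\<lambda>(t, x). f t x"
  have lin: "linear (frechet_derivative ?f (at z))" for z
    using Ck_Suc_has_derivative[OF f] has_derivative_linear by blast
  have t: "((\<lambda>s. f s x) has_vector_derivative frechet_derivative ?f (at (t, x)) (1, 0)) (at t)" for t x
    using Ck_has_vector_derivative_comp[OF f, of "\<lambda>s. (s, x)" "(1, 0)" t UNIV]
    by (simp add: has_vector_derivative_def has_derivative_Pair has_derivative_ident has_derivative_const)
  then have vt: "vector_derivative (\<lambda>s. f s x) (at t) = frechet_derivative ?f (at (t, x)) (1, 0)" for t x
    by (rule vector_derivative_at)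
  show "((\<lambda>s. f s x) has_vector_derivative vector_derivative (\<lambda>s. f s x) (at t)) (at t)"
    using t by (simp add: vt)
  show "Ck k (\<lambda>(t, x). vector_derivative (\<lambda>s. f s x) (at t))"
    using Ck_frechet[OF f, of "(1, 0)"] by (simp add: vt split_def)
  have "(f t has_derivative (\<lambda>v. frechet_derivative ?f (at (t, x)) (0, v))) (at x)" for t x
    using has_derivative_compose[OF has_derivative_Pair[OF has_derivative_const has_derivative_ident]
        Ck_Suc_has_derivative[OF f], of t x UNIV] by simp
  then have "(\<lambda>v. frechet_derivative ?f (at (t, x)) (0, v)) = frechet_derivative (f t) (at x)" for t x
    by (rule frechet_derivative_at)
  then show fx: "frechet_derivative (f t) (at x) v = frechet_derivative ?f (at (t, x)) (0, v)" for t x v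
    by metis
  show "Ck k (\<lambda>(t, x). frechet_derivative (f t) (at x) v)"
    using Ck_frechet[OF f, of "(0, v)"] by (simp add: fx split_def)
  have "frechet_derivative ?f (at (t, x)) (r, v) = frechet_derivative ?f (at (t, x)) (r *\<^sub>R (1, 0) + (0, v))"
    by simp
  also have "\<dots> = r *\<^sub>R frechet_derivative ?f (at (t, x)) (1, 0) + frechet_derivative ?f (at (t, x)) (0, v)"
    by (simp only: linear_add[OF lin] linear_scale[OF lin])
  finally show "frechet_derivative ?f (at (t, x)) (r, v)
      = r *\<^sub>R vector_derivative (\<lambda>s. f s x) (at t) + frechet_derivative (f t) (at x) v"
    by (simp add: vt fx)
qed

lemma Ck_joint_chain:
  fixes f :: "real \<Rightarrow> 'a::euclidean_space \<Rightarrow> 'b::euclidean_space"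
  assumes f: "Ck (Suc k) (\<lambda>(t, x). f t x)" and g: "(g has_vector_derivative g') (at t)"
  shows "((\<lambda>s. f s (g s)) has_vector_derivative
     vector_derivative (\<lambda>s. f s (g t)) (at t) + frechet_derivative (f t) (at (g t)) g') (at t)"
proof -
  have "((\<lambda>s. (s, g s)) has_vector_derivative (1, g')) (at t)"
    using g unfolding has_vector_derivative_def by (auto intro!: derivative_eq_intros)
  from Ck_has_vector_derivative_comp[OF f this]
  show ?thesis unfolding Ck_joint_derivs(5)[OF f] by simp
qed

lemma frechet_grad: "Ck (Suc k) f \<Longrightarrow> frechet_derivative f (at x) v = grad f x \<bullet> v" for f :: "real^2 \<Rightarrow> real"
  using Ck_has_derivative_grad[of f x] Ck_mono[of "Suc k" f "Suc 0"] frechet_derivative_at by (metis Suc_le_mono zero_le)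

lemma vector_derivative_frechet: "Ck (Suc k) f \<Longrightarrow> vector_derivative f (at a) = frechet_derivative f (at a) 1"
  for f :: "real \<Rightarrow> 'b::euclidean_space"
  by (simp add: Ck.simps(2) frechet_derivative_eq_vector_derivative)

lemma Ck_has_vector_derivative: "Ck (Suc k) f \<Longrightarrow> (f has_vector_derivative vector_derivative f (at a)) (at a)"
  for f :: "real \<Rightarrow> 'b::euclidean_space"
  by (simp add: Ck.simps(2) vector_derivative_works[symmetric])

lemma Ck_vector_derivative: "Ck (Suc k) f \<Longrightarrow> Ck k (\<lambda>a. vector_derivative f (at a))"
  for f :: "real \<Rightarrow> 'b::euclidean_space"
  by (simp add: vector_derivative_frechet Ck_frechet)

lemma Ck_joint_param_deriv:
  fixes f :: "real \<Rightarrow> real \<Rightarrow> 'b::euclidean_space"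
  assumes f: "Ck (Suc k) (\<lambda>(t, a). f t a)"
  shows "(f t has_vector_derivative vector_derivative (f t) (at a)) (at a)"
    and "Ck k (\<lambda>(t, a). vector_derivative (f t) (at a))"
proof -
  have ft: "Ck (Suc k) (f t)" for t by (rule Ck_slice[OF f])
  show "(f t has_vector_derivative vector_derivative (f t) (at a)) (at a)"
    by (rule Ck_has_vector_derivative[OF ft])
  show "Ck k (\<lambda>(t, a). vector_derivative (f t) (at a))"
    unfolding vector_derivative_frechet[OF ft] by (rule Ck_joint_derivs(4)[OF f])
qed

lemma Ck_joint_grad:
  fixes f :: "real \<Rightarrow> real^2 \<Rightarrow> real"
  assumes f: "Ck (Suc k) (\<lambda>(t, x). f t x)" shows "Ck k (\<lambda>(t, x). grad (f t) x $ i)"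
  using Ck_joint_derivs(4)[OF f, of "axis i 1"] by (simp add: grad_def)

lemma leibniz_cbox:
  fixes f :: "real \<Rightarrow> 'a::euclidean_space \<Rightarrow> real"
  assumes f: "Ck (Suc 0) (\<lambda>(t, x). f t x)"
  shows "((\<lambda>t. LINT x:cbox a b|lborel. f t x) has_real_derivative
     (LINT x:cbox a b|lborel. vector_derivative (\<lambda>s. f s x) (at t))) (at t)"
proof -
  have I: "(LINT x:cbox a b|lborel. h x) = integral (cbox a b) h" if "continuous_on UNIV h" for h :: "'a \<Rightarrow> real"
  proof -
    have "integrable lborel (\<lambda>x. indicator (cbox a b) x * h x)"
      by (rule integrable_continuous_box[OF that]) auto
    then have "((\<lambda>x. if x \<in> cbox a b then h x else 0) has_integral (LINT x:cbox a b|lborel. h x)) UNIV"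
    proof -
      have "(\<lambda>x. indicator (cbox a b) x * h x) = (\<lambda>x. if x \<in> cbox a b then h x else 0)"
        by (auto simp: indicator_def)
      with has_integral_integral_lborel[OF \<open>integrable lborel _\<close>] show ?thesis
        unfolding set_lebesgue_integral_def real_scaleR_def by (simp only:)
    qed
    then show ?thesis by (simp add: has_integral_restrict_UNIV integral_unique)
  qed
  have c1: "continuous_on UNIV (\<lambda>x. f t x)" for t using Ck_imp_continuous_on[OF Ck_slice[OF f]] .
  have cd: "continuous_on A (\<lambda>(t, x). vector_derivative (\<lambda>s. f s x) (at t))" for A
    using Ck_imp_continuous_on[OF Ck_joint_derivs(2)[OF f]] .
  have c2: "continuous_on UNIV (\<lambda>x. vector_derivative (\<lambda>s. f s x) (at t))" for t
    using Ck_imp_continuous_on[OF Ck_slice[OF Ck_joint_derivs(2)[OF f]]] .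
  have "((\<lambda>t. integral (cbox a b) (f t)) has_vector_derivative
      integral (cbox a b) (\<lambda>x. vector_derivative (\<lambda>s. f s x) (at t))) (at t within UNIV)"
  proof (rule leibniz_rule_vector_derivative[OF _ _ cd])
    show "((\<lambda>x. f x y) has_vector_derivative vector_derivative (\<lambda>s. f s y) (at x)) (at x within UNIV)" for x y
      using Ck_joint_derivs(1)[OF f] by simp
    show "f x integrable_on cbox a b" for x
      by (rule integrable_continuous[OF continuous_on_subset[OF c1]]) simp
  qed auto
  then show ?thesis unfolding I[OF c1] I[OF c2] has_real_derivative_iff_has_vector_derivative by simp
qed

text \<open>This is the integral of \<open>h\<close> from 0 to \<open>y\<close>, rescaled to a fixed
  interval so that smooth dependence on parameters can be read off from
  \<open>Ck_integral\<close>.\<close>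

lemma primitive_formula:
  fixes h :: "real \<Rightarrow> real"
  assumes h: "Ck (Suc 0) h"
  shows "((\<lambda>y. y * integral {0..1} (\<lambda>s. h (s * y))) has_real_derivative h y) (at y)"
proof -
  define h' where "h' = (\<lambda>x. vector_derivative h (at x))"
  have dh: "(h has_real_derivative h' x) (at x)" for x
    using Ck_has_vector_derivative[OF h] by (simp add: h'_def has_real_derivative_iff_has_vector_derivative)
  have ch: "continuous_on A h" and ch': "continuous_on A h'" for A
    using Ck_imp_continuous_on[OF h] Ck_imp_continuous_on[OF Ck_vector_derivative[OF h]] by (auto simp: h'_def)
  have int1: "(\<lambda>s. h (s * y)) integrable_on {0..1}" for y
    by (intro integrable_continuous_interval continuous_on_compose2[OF ch[of UNIV]] continuous_intros) auto
  have int2: "(\<lambda>s. h' (s * y) * s) integrable_on {0..1}" for y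
    by (intro integrable_continuous_interval continuous_on_mult continuous_on_compose2[OF ch'[of UNIV]] continuous_intros) auto
  have "((\<lambda>y. integral (cbox 0 1) (\<lambda>s. h (s * y))) has_vector_derivative integral (cbox 0 1) (\<lambda>s. h' (s * y) * s)) (at y within UNIV)"
  proof (rule leibniz_rule_vector_derivative)
    show "((\<lambda>y. h (s * y)) has_vector_derivative h' (s * y) * s) (at y within UNIV)" for y s
      unfolding has_real_derivative_iff_has_vector_derivative[symmetric]
      using DERIV_chain2[OF dh, of "\<lambda>y. s * y" s y UNIV] by (auto intro!: derivative_eq_intros)
    show "continuous_on (UNIV \<times> cbox 0 1) (\<lambda>(y, s). h' (s * y) * s)"
      unfolding split_def by (intro continuous_on_mult continuous_on_compose2[OF ch'[of UNIV]] continuous_intros) auto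
  qed (use int1 in auto)
  then have "((\<lambda>y. integral {0..1} (\<lambda>s. h (s * y))) has_real_derivative integral {0..1} (\<lambda>s. h' (s * y) * s)) (at y)"
    by (simp add: has_real_derivative_iff_has_vector_derivative)
  from DERIV_mult[OF DERIV_ident this]
  have 1: "((\<lambda>y. y * integral {0..1} (\<lambda>s. h (s * y))) has_real_derivative
     integral {0..1} (\<lambda>s. h (s * y)) + integral {0..1} (\<lambda>s. h' (s * y) * s) * y) (at y)"
    by simp
  \<comment> \<open>The derivative found by the product rule is the integral over s of an exact
    derivative, and its end values give \<open>h y\<close>.\<close>
  have "((\<lambda>s. s * h (s * y)) has_real_derivative h (s * y) + h' (s * y) * s * y) (at s)" for s
  proof -
    have "((\<lambda>s. s * y) has_real_derivative y) (at s)" by (auto intro!: derivative_eq_intros)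
    from DERIV_mult[OF DERIV_ident DERIV_chain2[OF dh this]] show ?thesis by (simp add: mult_ac)
  qed
  note d = this
  have A: "((\<lambda>s. h (s * y) + h' (s * y) * s * y) has_integral (1 * h (1 * y) - 0 * h (0 * y))) {0..1}"
  proof (rule fundamental_theorem_of_calculus)
    show "((\<lambda>s. s * h (s * y)) has_vector_derivative h (s * y) + h' (s * y) * s * y) (at s within {0..1})" for s
      using d[of s] unfolding has_real_derivative_iff_has_vector_derivative by (rule has_vector_derivative_at_within)
  qed simp
  have B: "((\<lambda>s. h (s * y) + h' (s * y) * s * y) has_integral
     (integral {0..1} (\<lambda>s. h (s * y)) + integral {0..1} (\<lambda>s. h' (s * y) * s) * y)) {0..1}"
    by (intro has_integral_add has_integral_mult_left integrable_integral int1 int2)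
  have "integral {0..1} (\<lambda>s. h (s * y)) + integral {0..1} (\<lambda>s. h' (s * y) * s) * y = h y"
    using has_integral_unique[OF B A] by simp
  then show ?thesis using 1 by simp
qed

text \<open>Integrating a density in the first coordinate turns the area integral over the droplet into a
  line integral over the interface alone, because the wall is horizontal.\<close>

lemma exists_primitive:
  fixes \<phi> :: "real \<Rightarrow> real^2 \<Rightarrow> real"
  assumes \<phi>: "Ck 2 (\<lambda>(t, x). \<phi> t x)"
  obtains V where "Ck 2 (\<lambda>(t, x). V t x)" "\<And>t x. grad (V t) x $ 1 = \<phi> t x"
    "\<And>t x. grad (dt V t) x $ 1 = dt \<phi> t x"
proof -
  \<comment> \<open>Integration of the density along the horizontal line from x = 0, the same
    starting abscissa for all times and heights.\<close>
  define V where "V t x = x $ 1 * integral {0..1} (\<lambda>s. \<phi> t (pt (s * x $ 1) (x $ 2)))" for t and x :: "real^2"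
  have lin: "Ck 2 (\<lambda>z :: (real \<times> (real^2)) \<times> real. pt (snd z * snd (fst z) $ 1) (snd (fst z) $ 2))"
    unfolding pt_eq_axis by (intro Ck_intros)
  have "Ck 2 (\<lambda>(z :: real \<times> (real^2), s). \<phi> (fst z) (pt (s * snd z $ 1) (snd z $ 2)))"
    using Ck_joint_compose[OF \<phi> Ck_fst[OF Ck_fst[OF Ck_id]] lin] by (simp add: split_def)
  from Ck_integral[OF this]
  have V: "Ck 2 (\<lambda>(t, x). V t x)" unfolding V_def split_def by (intro Ck_intros)
  have V': "Ck (Suc (Suc 0)) (\<lambda>(t, x). V t x)" using V by (simp add: numeral_2_eq_2)
  have \<phi>1: "Ck (Suc 0) (\<lambda>(t, x). \<phi> t x)" using Ck_mono[OF \<phi>, of "Suc 0"] by simp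
  have Vt: "Ck (Suc 0) (V t)" for t using Ck_mono[OF Ck_slice[OF V], of "Suc 0"] by simp
  have dV: "Ck (Suc 0) (\<lambda>(t, x). dt V t x)" unfolding dt_def by (rule Ck_joint_derivs(2)[OF V'])
  have prim: "((\<lambda>x. V t (pt x y)) has_real_derivative \<phi> t (pt x y)) (at x)" for t x y
  proof -
    have "Ck (Suc 0) (\<lambda>x. \<phi> t (pt x y))"
      unfolding pt_eq_axis by (intro Ck_compose[OF Ck_slice[OF \<phi>1]] Ck_intros)
    from primitive_formula[OF this, of x] show ?thesis by (simp add: V_def)
  qed
  have 1: "grad (V t) x $ 1 = \<phi> t x" for t x
    using DERIV_unique[OF grad_line_deriv(1)[OF Vt] prim, of t "x $ 1" "x $ 2"] by simp
  have 2: "grad (dt V t) x $ 1 = dt \<phi> t x" for t x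
  proof -
    have "Ck 2 (\<lambda>(s, r). V s (pt r (x $ 2)))"
      unfolding split_def pt_eq_axis by (intro Ck_joint_compose[OF V] Ck_intros)
    from Ck_mixed_partials[OF this, of t "x $ 1"]
    have "((\<lambda>r. dt V t (pt r (x $ 2))) has_vector_derivative
      vector_derivative (\<lambda>s. vector_derivative (\<lambda>r. V s (pt r (x $ 2))) (at (x $ 1))) (at t)) (at (x $ 1))"
      by (simp add: dt_def)
    moreover have "vector_derivative (\<lambda>r. V s (pt r (x $ 2))) (at (x $ 1)) = \<phi> s x" for s
      using prim[of s "x $ 2" "x $ 1"]
      by (simp add: has_real_derivative_iff_has_vector_derivative vector_derivative_at)
    ultimately have "((\<lambda>r. dt V t (pt r (x $ 2))) has_real_derivative dt \<phi> t x) (at (x $ 1))"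
      by (simp add: has_real_derivative_iff_has_vector_derivative dt_def)
    from DERIV_unique[OF grad_line_deriv(1)[OF Ck_slice[OF dV], of t "x $ 2" "x $ 1"] this]
    show ?thesis by simp
  qed
  show ?thesis by (rule that[OF V 1 2])
qed

section \<open>Moving droplets and the transport theorem\<close>

locale moving_drop =
  fixes X :: "real \<Rightarrow> real \<Rightarrow> real^2" and T L H :: real
  assumes CX: "Ck 2 (\<lambda>(t, a). X t a)" and T: "0 < T"
    and drop: "\<And>t. t \<in> {0..T} \<Longrightarrow> drop_in_box (X t) (\<lambda>a. vector_derivative (X t) (at a)) L H"
begin

definition Xa :: "real \<Rightarrow> real \<Rightarrow> real^2" where "Xa t a = vector_derivative (X t) (at a)"
definition Xt :: "real \<Rightarrow> real \<Rightarrow> real^2" where "Xt t a = vector_derivative (\<lambda>s. X s a) (at t)"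
definition N :: "real \<Rightarrow> real \<Rightarrow> real^2" where "N t a = pt (- (Xa t a $ 2)) (Xa t a $ 1)"
abbreviation "D1 t \<equiv> droplet.D (X t)"
abbreviation "D2 t \<equiv> drop_in_box.Out (X t) L H"

lemma drop': "t \<in> {0..T} \<Longrightarrow> drop_in_box (X t) (Xa t) L H"
  using drop by (simp add: Xa_def[abs_def])

lemma CX': "Ck (Suc (Suc 0)) (\<lambda>(t, a). X t a)"
  using CX by (simp add: numeral_2_eq_2)

lemma CXa: "Ck (Suc 0) (\<lambda>(t, a). Xa t a)" and CXt: "Ck (Suc 0) (\<lambda>(t, a). Xt t a)"
  unfolding Xa_def Xt_def by (rule Ck_joint_param_deriv(2)[OF CX'], rule Ck_joint_derivs(2)[OF CX'])

lemma X_derivs: "(X t has_vector_derivative Xa t a) (at a)" "((\<lambda>s. X s a) has_vector_derivative Xt t a) (at t)"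
  unfolding Xa_def Xt_def by (rule Ck_joint_param_deriv(1)[OF CX'], rule Ck_joint_derivs(1)[OF CX'])

lemma Xta: "((\<lambda>a. Xt t a) has_vector_derivative vector_derivative (\<lambda>s. Xa s a) (at t)) (at a)"
  using Ck_mixed_partials[OF CX] by (simp add: Xt_def Xa_def)

lemma vec_nth_deriv: "(f has_vector_derivative f') F \<Longrightarrow> ((\<lambda>a. f a $ i) has_real_derivative f' $ i) F"
  for f :: "real \<Rightarrow> real^2"
  unfolding has_real_derivative_iff_has_vector_derivative
  by (rule bounded_linear.has_vector_derivative[OF bounded_linear_vec_nth])

text \<open>The contact points are known to stay on the wall only for times in [0, T], so
  derivatives are compared within that interval, where they are unique because T > 0.\<close>

lemma Xt_wall:
  assumes t: "t \<in> {0..T}" and a: "a = 0 \<or> a = 1"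
  shows "Xt t a $ 2 = 0"
proof -
  have z: "X s a $ 2 = 0" if "s \<in> {0..T}" for s
    using drop'[OF that] a unfolding drop_in_box_def droplet_def by auto
  have "((\<lambda>s. X s a $ 2) has_vector_derivative Xt t a $ 2) (at t within {0..T})"
    using vec_nth_deriv[OF X_derivs(2)] by (auto simp: has_real_derivative_iff_has_vector_derivative intro: has_vector_derivative_at_within)
  moreover have "((\<lambda>s. X s a $ 2) has_vector_derivative 0) (at t within {0..T})"
    by (rule has_vector_derivative_transform[OF t _ has_vector_derivative_const]) (use z in auto)
  moreover have "at t within {0..T} \<noteq> bot"
    using t T islimpt_Icc[of 0 T t] by (simp add: trivial_limit_within)
  ultimately show ?thesis using vector_derivative_unique_within by blast
qed

text \<open>With the primitive V, the area integral is minus the integral of V dy over a fixed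
  parameter interval and can be differentiated in time. The term with \<open>dt V\<close> goes back
  to the droplet by Green's theorem. The others are the boundary term and \<open>?d\<close>, the
  exact derivative of V times the vertical velocity of the parameterization, which vanishes at the
  contact points.\<close>

lemma reynolds_D:
  assumes \<phi>: "Ck 2 (\<lambda>(t, x). \<phi> t x)" and t: "t \<in> {0..T}"
  shows "((\<lambda>t. LINT x:D1 t|lborel. \<phi> t x) has_real_derivative
     (LINT x:D1 t|lborel. dt \<phi> t x) + (LINT a:{0..1}|lborel. \<phi> t (X t a) * (Xt t a \<bullet> N t a))) (at t within {0..T})"
proof -
  obtain V where V: "Ck 2 (\<lambda>(t, x). V t x)" and V1: "\<And>t x. grad (V t) x $ 1 = \<phi> t x"
    and V2: "\<And>t x. grad (dt V t) x $ 1 = dt \<phi> t x"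
    using exists_primitive[OF \<phi>] by blast
  have VS: "Ck (Suc (Suc 0)) (\<lambda>(t, x). V t x)" using V by (simp add: numeral_2_eq_2)
  have Vt: "Ck (Suc 0) (V t)" for t using Ck_mono[OF Ck_slice[OF V], of "Suc 0"] by simp
  have dV: "Ck (Suc 0) (dt V t)" for t unfolding dt_def by (rule Ck_slice[OF Ck_joint_derivs(2)[OF VS]])
  have \<phi>1: "Ck (Suc 0) (\<phi> t)" using Ck_mono[OF Ck_slice[OF \<phi>], of "Suc 0"] by simp
  have CX1: "Ck (Suc 0) (\<lambda>z. X (fst z) (snd z))" using Ck_Suc_imp[OF CX'] by (simp add: split_def)
  define W where "W t a = V t (X t a) * Xa t a $ 2" for t a
  have "Ck (Suc 0) (\<lambda>z. V (fst z) (X (fst z) (snd z)))"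
    by (rule Ck_joint_compose[OF Ck_Suc_imp[OF VS] Ck_fst[OF Ck_id] CX1])
  then have CW: "Ck (Suc 0) (\<lambda>(t, a). W t a)"
    using CXa unfolding W_def split_def by (intro Ck_mult Ck_vec_nth)
  have rep: "(LINT x:D1 s|lborel. \<phi> s x) = - (LINT a:{0..1}|lborel. W s a)" if "s \<in> {0..T}" for s
  proof -
    interpret drop_in_box "X s" "Xa s" L H by (rule drop'[OF that])
    show ?thesis using green(1)[OF Vt, of s] by (simp add: V1 W_def)
  qed
  let ?Wt = "\<lambda>a. vector_derivative (\<lambda>s. W s a) (at t)"
  let ?d = "\<lambda>a. (grad (V t) (X t a) \<bullet> Xa t a) * Xt t a $ 2 + V t (X t a) * vector_derivative (\<lambda>s. Xa s a) (at t) $ 2"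
  have Wt: "?Wt a = dt V t (X t a) * Xa t a $ 2 - \<phi> t (X t a) * (Xt t a \<bullet> N t a) + ?d a" for a
  proof -
    have 1: "((\<lambda>s. V s (X s a)) has_vector_derivative dt V t (X t a) + grad (V t) (X t a) \<bullet> Xt t a) (at t)"
      using Ck_joint_chain[OF VS X_derivs(2)[of a t]] unfolding frechet_grad[OF Vt] dt_def .
    have "((\<lambda>s. Xa s a) has_vector_derivative vector_derivative (\<lambda>s. Xa s a) (at t)) (at t)"
      by (rule Ck_joint_derivs(1)[OF CXa])
    from vec_nth_deriv[OF this] have 2: "((\<lambda>s. Xa s a $ 2) has_real_derivative vector_derivative (\<lambda>s. Xa s a) (at t) $ 2) (at t)" .
    have "((\<lambda>s. W s a) has_real_derivative (dt V t (X t a) + grad (V t) (X t a) \<bullet> Xt t a) * Xa t a $ 2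
       + vector_derivative (\<lambda>s. Xa s a) (at t) $ 2 * V t (X t a)) (at t)"
      unfolding W_def using DERIV_mult[OF 1[unfolded has_real_derivative_iff_has_vector_derivative[symmetric]] 2] by simp
    then have "?Wt a = (dt V t (X t a) + grad (V t) (X t a) \<bullet> Xt t a) * Xa t a $ 2
       + vector_derivative (\<lambda>s. Xa s a) (at t) $ 2 * V t (X t a)"
      unfolding has_real_derivative_iff_has_vector_derivative by (rule vector_derivative_at)
    then show ?thesis by (simp add: V1[symmetric] N_def inner_vec2 algebra_simps)
  qed
  have dd: "((\<lambda>a. V t (X t a) * Xt t a $ 2) has_real_derivative ?d a) (at a)" for a
  proof -
    have 1: "((\<lambda>a. V t (X t a)) has_vector_derivative grad (V t) (X t a) \<bullet> Xa t a) (at a)"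
      using Ck_has_vector_derivative_comp[OF Vt X_derivs(1)[of t a]] unfolding frechet_grad[OF Vt] .
    show ?thesis
      using DERIV_mult[OF 1[unfolded has_real_derivative_iff_has_vector_derivative[symmetric]] vec_nth_deriv[where i = 2, OF Xta]]
      by (simp add: mult.commute)
  qed
  have cX: "continuous_on UNIV (X t)" "continuous_on UNIV (Xa t)" "continuous_on UNIV (Xt t)"
    using Ck_imp_continuous_on Ck_slice CX CXa CXt by blast+
  have c1: "continuous_on UNIV (\<lambda>a. dt V t (X t a) * Xa t a $ 2)"
    by (intro continuous_intros continuous_on_compose2[OF Ck_imp_continuous_on[OF dV, of UNIV]] cX) auto
  have c2: "continuous_on UNIV (\<lambda>a. \<phi> t (X t a) * (Xt t a \<bullet> N t a))"
    unfolding N_def by (intro continuous_intros continuous_on_compose2[OF Ck_imp_continuous_on[OF \<phi>1, of UNIV]] cX) auto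
  have cW: "continuous_on UNIV ?Wt"
    using Ck_imp_continuous_on[OF Ck_slice[OF Ck_joint_derivs(2)[OF CW]]] .
  have cd: "continuous_on UNIV ?d"
  proof -
    have "continuous_on UNIV (\<lambda>a. ?Wt a - dt V t (X t a) * Xa t a $ 2 + \<phi> t (X t a) * (Xt t a \<bullet> N t a))"
      by (intro continuous_on_add continuous_on_diff c1 c2 cW)
    then show ?thesis by (simp add: Wt)
  qed
  note si = set_integrable_continuous_box[of _ "{0..1::real}"]
  have "(LINT a:{0..1}|lborel. ?Wt a) = (LINT a:{0..1}|lborel. dt V t (X t a) * Xa t a $ 2)
     - (LINT a:{0..1}|lborel. \<phi> t (X t a) * (Xt t a \<bullet> N t a)) + (LINT a:{0..1}|lborel. ?d a)"
    unfolding Wt using c1 c2 cd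
    by (subst set_integral_add(2), simp_all add: si set_integral_diff)
  also have "(LINT a:{0..1}|lborel. ?d a) = 0"
    using FTC_set_integral[OF _ dd cd, of 0 1] Xt_wall[OF t] by simp
  also have "(LINT a:{0..1}|lborel. dt V t (X t a) * Xa t a $ 2) = - (LINT x:D1 t|lborel. dt \<phi> t x)"
  proof -
    interpret drop_in_box "X t" "Xa t" L H by (rule drop'[OF t])
    show ?thesis using green(1)[OF dV, of t] by (simp add: V2)
  qed
  finally have eq: "- (LINT a:{0..1}|lborel. ?Wt a) = (LINT x:D1 t|lborel. dt \<phi> t x) + (LINT a:{0..1}|lborel. \<phi> t (X t a) * (Xt t a \<bullet> N t a))"
    by simp
  \<comment> \<open>\<open>W\<close> is smooth for all times but represents the area integral only
    for times in [0, T]; hence the derivative within that interval.\<close>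
  have "((\<lambda>t. - (LINT a:{0..1}|lborel. W t a)) has_real_derivative - (LINT a:{0..1}|lborel. ?Wt a)) (at t within {0..T})"
    using DERIV_minus[OF leibniz_cbox[OF CW, of 0 1 t]] has_field_derivative_at_within by (simp add: box_real)
  then show ?thesis
    unfolding eq by (rule has_field_derivative_transform_within[of _ _ _ _ 1]) (use t rep in auto)
qed

text \<open>Up to a null set the outer fluid is a fixed box without the droplet.\<close>

lemma reynolds_Out:
  assumes \<phi>: "Ck 2 (\<lambda>(t, x). \<phi> t x)" and t: "t \<in> {0..T}"
  shows "((\<lambda>t. LINT x:D2 t|lborel. \<phi> t x) has_real_derivative
     (LINT x:D2 t|lborel. dt \<phi> t x) - (LINT a:{0..1}|lborel. \<phi> t (X t a) * (Xt t a \<bullet> N t a))) (at t within {0..T})"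
proof -
  let ?B = "box (pt (- L) 0) (pt L H)"
  have \<phi>1: "Ck (Suc 0) (\<lambda>(t, x). \<phi> t x)" using Ck_mono[OF \<phi>, of "Suc 0"] by simp
  have c1: "continuous_on UNIV (\<phi> t)" for t using Ck_imp_continuous_on[OF Ck_slice[OF \<phi>1]] .
  have c2: "continuous_on UNIV (dt \<phi> t)" for t
    using Ck_imp_continuous_on[OF Ck_slice[OF Ck_joint_derivs(2)[OF \<phi>1]]] by (simp add: dt_def[abs_def])
  have rep: "(LINT x:D2 s|lborel. f x) = (LINT x:?B|lborel. f x) - (LINT x:D1 s|lborel. f x)"
    if "s \<in> {0..T}" "continuous_on UNIV f" for s and f :: "real^2 \<Rightarrow> real"
    using drop_in_box.set_integral_Out[OF drop'[OF that(1)] that(2)] .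
  have "((\<lambda>t. LINT x:?B|lborel. \<phi> t x) has_real_derivative (LINT x:?B|lborel. dt \<phi> t x)) (at t)"
    unfolding set_integral_box_cbox[OF c1] set_integral_box_cbox[OF c2] unfolding dt_def by (rule leibniz_cbox[OF \<phi>1])
  from DERIV_diff[OF has_field_derivative_at_within[OF this] reynolds_D[OF \<phi> t]]
  have "((\<lambda>t. (LINT x:?B|lborel. \<phi> t x) - (LINT x:D1 t|lborel. \<phi> t x)) has_real_derivative
     (LINT x:D2 t|lborel. dt \<phi> t x) - (LINT a:{0..1}|lborel. \<phi> t (X t a) * (Xt t a \<bullet> N t a))) (at t within {0..T})"
    unfolding rep[OF t c2] by (simp add: algebra_simps)
  then show ?thesis
    by (rule has_field_derivative_transform_within[of _ _ _ _ 1]) (use t rep c1 in auto)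
qed

end

section \<open>Positivity of the bulk concentration\<close>

context moving_drop
begin

text \<open>A point off the closed droplet has winding number 0. So has every nearby point for the
  loops of nearby times, as the winding number does not change while the loop moves by less than its
  distance from the point. Inside it is 1 or -1, so such points remain off the closed
  droplet.\<close>

lemma closure_D1_stable:
  assumes t0: "t0 \<in> {0..T}" and x0: "x0 \<notin> closure (D1 t0)"
  obtains e where "0 < e"
    "\<And>t x. t \<in> {0..T} \<Longrightarrow> \<bar>t - t0\<bar> < e \<Longrightarrow> dist x x0 < e \<Longrightarrow> x \<notin> closure (D1 t)"
proof -
  interpret A: drop_in_box "X t0" "Xa t0" L H by (rule drop'[OF t0])
  obtain d where d: "0 < d" "\<And>y. dist y x0 < d \<Longrightarrow> y \<notin> closure A.D"
    using x0 open_Compl[OF closed_closure[of A.D]] unfolding open_dist by (metis ComplD ComplI)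
  \<comment> \<open>Uniform continuity bounds the displacement of the interface for all parameters
    at once.\<close>
  have "uniformly_continuous_on ({0..T} \<times> {0..1}) (\<lambda>(t, a). X t a)"
    using Ck_imp_continuous_on[OF CX] by (intro compact_uniformly_continuous compact_Times) auto
  then obtain e where e: "0 < e" "\<And>z z'. z \<in> {0..T} \<times> {0..1} \<Longrightarrow> z' \<in> {0..T} \<times> {0..1} \<Longrightarrow> dist z' z < e
      \<Longrightarrow> dist (X (fst z') (snd z')) (X (fst z) (snd z)) < d / 2"
    unfolding uniformly_continuous_on_def split_def using d(1) by (metis half_gt_zero)
  show ?thesis
  proof (rule that[of "min e (d / 2)"])
    show "0 < min e (d / 2)" using d(1) e(1) by simp
    fix t x assume t: "t \<in> {0..T}" and te: "\<bar>t - t0\<bar> < min e (d / 2)" and x: "dist x x0 < min e (d / 2)"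
    interpret B: drop_in_box "X t" "Xa t" L H by (rule drop'[OF t])
    have near: "norm (X t a - X t0 a) < d / 2" if "a \<in> {0..1}" for a
      using e(2)[of "(t0, a)" "(t, a)"] that t t0 te by (simp add: dist_Pair_Pair dist_real_def dist_norm)
    have iso: "norm (to_complex y) = norm y" for y
      by (simp add: norm_complex_def norm_vec_def L2_set_def sum_2)
    have diff: "to_complex y - to_complex z = to_complex (y - z)" for y z
      by (simp add: complex_eq_iff)
    have close: "norm (B.loop s - A.loop s) < d / 2" if s: "s \<in> {0..1}" for s
    proof (cases "s \<le> 1 / 2")
      case True
      then have "norm (B.loop s - A.loop s) = norm (X t (2 * s) - X t0 (2 * s))"
        by (simp only: A.loop_def B.loop_def joinpaths_def if_True o_def diff iso)
      then show ?thesis using near[of "2 * s"] s True by simp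
    next
      case False
      \<comment> \<open>On the wall part the displacement is a convex combination of the
        displacements of the two contact points.\<close>
      let ?r = "2 * s - 1"
      have r: "0 \<le> ?r" "?r \<le> 1" using False s by auto
      have "B.loop s - A.loop s = to_complex ((1 - ?r) *\<^sub>R (X t 1 - X t0 1) + ?r *\<^sub>R (X t 0 - X t0 0))"
        using False by (simp add: A.loop_def B.loop_def joinpaths_def linepath_def complex_eq_iff algebra_simps)
      then have "norm (B.loop s - A.loop s) = norm ((1 - ?r) *\<^sub>R (X t 1 - X t0 1) + ?r *\<^sub>R (X t 0 - X t0 0))"
        by (simp only: iso)
      then have "norm (B.loop s - A.loop s) \<le> (1 - ?r) * norm (X t 1 - X t0 1) + ?r * norm (X t 0 - X t0 0)"
        using norm_triangle_ineq[of "(1 - ?r) *\<^sub>R (X t 1 - X t0 1)" "?r *\<^sub>R (X t 0 - X t0 0)"] r by simp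
      also have "\<dots> < d / 2"
        using convex_bound_lt[OF near[of 1] near[of 0], of "1 - ?r" ?r] r by simp
      finally show ?thesis .
    qed
    \<comment> \<open>The loop at time \<open>t0\<close> keeps at least the distance d from
      \<open>x0\<close>, and \<open>x\<close> is closer than d/2 to \<open>x0\<close>.\<close>
    have far: "d / 2 < norm (A.loop s - to_complex x)" if s: "s \<in> {0..1}" for s
    proof -
      have "A.loop s \<in> to_complex ` A.bnd" using A.loop_image s by (auto simp: path_image_def)
      then obtain y where y: "y \<in> A.bnd" "A.loop s = to_complex y" by auto
      then have "d \<le> dist y x0" using d(2)[of y] A.closure_D by force
      then have "d / 2 < dist y x" using x dist_triangle[of y x0 x] by simp
      then show ?thesis by (simp only: y(2) diff iso dist_norm)
    qed
    have lt: "norm (B.loop s - A.loop s) < norm (A.loop s - to_complex x)" if "s \<in> {0..1}" for s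
      using close[OF that] far[OF that] by linarith
    have "winding_number B.loop (to_complex x) = winding_number A.loop (to_complex x)"
      using A.simple_loop B.simple_loop A.closed_loop B.closed_loop lt
      by (intro winding_number_nearby_loops_eq) (auto simp: simple_path_def)
    also have "\<dots> = 0"
    proof (rule winding_number_zero_in_outside)
      show "path A.loop" "pathfinish A.loop = pathstart A.loop"
        using A.simple_loop A.closed_loop by (auto simp: simple_path_def)
      have "dist x x0 < d" using x d(1) by simp
      then have "x \<notin> A.D" "x \<notin> A.bnd" using d(2) A.closure_D by auto
      then have "to_complex x \<notin> inside (path_image A.loop)" "to_complex x \<notin> path_image A.loop"
        using A.D_eq A.inj_to_complex by (auto simp: A.loop_image inj_def)
      then show "to_complex x \<in> outside (path_image A.loop)" using inside_Un_outside by blast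
    qed
    finally have w: "winding_number B.loop (to_complex x) = 0" .
    have "to_complex x \<notin> path_image B.loop"
    proof
      assume "to_complex x \<in> path_image B.loop"
      then obtain s where "s \<in> {0..1}" "to_complex x = B.loop s" by (auto simp: path_image_def)
      then show False using lt[of s] by (simp add: norm_minus_commute)
    qed
    moreover have "to_complex x \<notin> inside (path_image B.loop)"
      using w simple_closed_path_norm_winding_number_inside[OF B.simple_loop] by force
    ultimately have "x \<notin> B.bnd" "x \<notin> B.D" using B.loop_image B.D_eq by auto
    then show "x \<notin> closure B.D" using B.closure_D by blast
  qed
qed

text \<open>All droplets lie in one box, and closedness is what \<open>closure_D1_stable\<close>
  expresses.\<close>

lemma compact_spacetime: "compact {(t, x). t \<in> {0..T} \<and> x \<in> closure (D1 t)}"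
proof -
  let ?S = "{(t, x). t \<in> {0..T} \<and> x \<in> closure (D1 t)}"
  have "?S \<subseteq> {0..T} \<times> cbox (pt (- L) 0) (pt L H)"
  proof safe
    fix t x assume t: "t \<in> {0..T}" and x: "x \<in> closure (D1 t)"
    interpret drop_in_box "X t" "Xa t" L H by (rule drop'[OF t])
    have "closure D \<subseteq> cbox (pt (- L) 0) (pt L H)"
      using D_subset_box box_subset_cbox closed_cbox by (intro closure_minimal) blast+
    then show "x \<in> cbox (pt (- L) 0) (pt L H)" using x by blast
  qed
  then have "bounded ?S" by (rule bounded_subset[rotated]) (intro bounded_Times; simp)
  moreover have "closed ?S"
    unfolding closed_def open_dist
  proof (intro ballI)
    fix z assume z: "z \<in> - ?S"
    obtain t0 x0 where z0: "z = (t0, x0)" by (cases z)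
    show "\<exists>e>0. \<forall>y. dist y z < e \<longrightarrow> y \<in> - ?S"
    proof (cases "t0 \<in> {0..T}")
      case True
      then have "x0 \<notin> closure (D1 t0)" using z z0 by auto
      then obtain e where e: "0 < e" "\<And>t x. t \<in> {0..T} \<Longrightarrow> \<bar>t - t0\<bar> < e \<Longrightarrow> dist x x0 < e \<Longrightarrow> x \<notin> closure (D1 t)"
        using closure_D1_stable[OF True] by blast
      have "y \<in> - ?S" if "dist y z < e" for y
      proof -
        have "\<bar>fst y - t0\<bar> < e" "dist (snd y) x0 < e"
          using that dist_fst_le[of y z] dist_snd_le[of y z] by (auto simp: z0 dist_real_def)
        then show ?thesis using e(2)[of "fst y" "snd y"] by (auto simp: split_def)
      qed
      then show ?thesis using e(1) by blast
    next
      case False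
      then have "open (- {0..T})" "t0 \<in> - {0..T}" by auto
      then obtain e where e: "0 < e" "\<And>t. dist t t0 < e \<Longrightarrow> t \<in> - {0..T}" unfolding open_dist by blast
      have "y \<in> - ?S" if "dist y z < e" for y
        using e(2)[of "fst y"] that dist_fst_le[of y z] by (auto simp: z0)
      then show ?thesis using e(1) by blast
    qed
  qed
  ultimately show ?thesis by (simp add: compact_eq_bounded_closed)
qed

text \<open>A minimum over the closed droplets of all times; being uniform in time, it lets one
  fixed extension of \<open>f_bulk\<close> serve throughout.\<close>

lemma uniformly_positive:
  fixes \<phi> :: "real \<Rightarrow> real^2 \<Rightarrow> real"
  assumes c: "continuous_on UNIV (\<lambda>(t, x). \<phi> t x)"
    and pos: "\<And>t x. t \<in> {0..T} \<Longrightarrow> x \<in> closure (D1 t) \<Longrightarrow> 0 < \<phi> t x"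
  obtains m where "0 < m" "\<And>t x. t \<in> {0..T} \<Longrightarrow> x \<in> closure (D1 t) \<Longrightarrow> m \<le> \<phi> t x"
proof -
  let ?S = "{(t, x). t \<in> {0..T} \<and> x \<in> closure (D1 t)}"
  show ?thesis
  proof (cases "?S = {}")
    case True
    then show ?thesis by (intro that[of 1]) auto
  next
    case False
    from continuous_attains_inf[OF compact_spacetime False continuous_on_subset[OF c subset_UNIV]]
    obtain z where z: "z \<in> ?S" "\<And>y. y \<in> ?S \<Longrightarrow> \<phi> (fst z) (snd z) \<le> \<phi> (fst y) (snd y)"
      by (auto simp: split_def)
    show ?thesis
      by (rule that[of "\<phi> (fst z) (snd z)"]) (use z(1) z(2)[of "(t, x)" for t x] pos in auto)
  qed
qed

end

text \<open>\<open>f_bulk\<close> is smooth for positive arguments only. Below \<open>m\<close> its argument is replaced in the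
  logarithm by \<open>c + (m - c)\<^sup>2 / (2 m)\<close>, which is still positive.\<close>

lemma exists_f_bulk_extension:
  assumes m: "0 < m" and lam: "0 < lam P"
  obtains fe h h' where "Ck 2 fe" "Ck (Suc 0) h" "\<And>c. (fe has_real_derivative h c) (at c)"
    "\<And>c. (h has_real_derivative h' c) (at c)"
    "\<And>c. m \<le> c \<Longrightarrow> fe c = f_bulk P c" "\<And>c. m \<le> c \<Longrightarrow> h c = El P * ln (lam P * c)"
    "\<And>c. m \<le> c \<Longrightarrow> h' c = El P / c"
proof -
  define k where "k c = c + sqplus (m - c) / (2 * m)" for c
  define k' where "k' c = 1 - max 0 (m - c) / m" for c
  define h where "h c = El P * ln (lam P * k c)" for c
  define h' where "h' c = El P * (k' c / k c)" for c
  have kpos: "0 < k c" for c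
  proof (cases "m \<le> c")
    case True then show ?thesis using m by (simp add: k_def sqplus_def)
  next
    case False
    \<comment> \<open>The correction in \<open>k\<close> is chosen so that 2 m k(c) = m^2 + c^2
      below \<open>m\<close>, which is positive even for negative \<open>c\<close>.\<close>
    have "2 * m * k c = 2 * m * c + (m - c)\<^sup>2" using m False by (simp add: k_def sqplus_def field_simps)
    also have "\<dots> = m\<^sup>2 + c\<^sup>2" by (simp add: power2_eq_square algebra_simps)
    also have "\<dots> > 0" using m by (simp add: add_pos_nonneg)
    finally show ?thesis using m by (simp add: zero_less_mult_iff)
  qed
  have dk: "(k has_real_derivative k' c) (at c)" for c
  proof -
    have "((\<lambda>c. m - c) has_real_derivative -1) (at c)" by (auto intro!: derivative_eq_intros)
    from DERIV_chain2[OF DERIV_sqplus this]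
    have "((\<lambda>c. sqplus (m - c)) has_real_derivative - 2 * max 0 (m - c)) (at c)" by simp
    from DERIV_add[OF DERIV_ident DERIV_cdivide[OF this, of "2 * m"]]
    show ?thesis unfolding k_def k'_def using m by simp
  qed
  have dh: "(h has_real_derivative h' c) (at c)" for c
    unfolding h_def h'_def using kpos[of c] lam
    by (auto intro!: derivative_eq_intros dk simp: field_simps)
  have ck: "continuous_on UNIV k" "continuous_on UNIV k'"
    using m unfolding k_def k'_def by (auto intro!: continuous_intros)
  have "continuous_on UNIV h'"
    unfolding h'_def using kpos by (intro continuous_intros ck) (auto simp: less_imp_neq[symmetric])
  then have Ch: "Ck (Suc 0) h" using Ck_real_SucI[OF dh] by simp
  \<comment> \<open>A primitive of \<open>h\<close>, with the constant that makes it agree with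
    \<open>f_bulk\<close> at \<open>m\<close>.\<close>
  define fe where "fe y = f_bulk P m - m * integral {0..1} (\<lambda>s. h (s * m)) + y * integral {0..1} (\<lambda>s. h (s * y))" for y
  have dfe: "(fe has_real_derivative h c) (at c)" for c
    unfolding fe_def using DERIV_add[OF DERIV_const primitive_formula[OF Ch]] by simp
  have Cfe: "Ck 2 fe" using Ck_real_SucI[OF dfe Ch] by (simp add: numeral_2_eq_2)
  have hm: "h c = El P * ln (lam P * c)" "h' c = El P / c" if "m \<le> c" for c
    using that m by (auto simp: h_def h'_def k_def k'_def sqplus_def)
  have fm: "fe c = f_bulk P c" if c: "m \<le> c" for c
  proof (cases "m = c")
    case True then show ?thesis by (simp add: fe_def)
  next
    case False
    then have mc: "m < c" using c by simp
    have df: "(f_bulk P has_real_derivative El P * ln (lam P * y)) (at y)" if "m \<le> y" for y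
      unfolding f_bulk_def
      using that m lam by (auto intro!: derivative_eq_intros simp: field_simps)
    have "((\<lambda>y. fe y - f_bulk P y) has_real_derivative 0) (at y)" if "m \<le> y" "y \<le> c" for y
      using DERIV_diff[OF dfe[of y] df[OF that(1)]] hm(1)[OF that(1)] by simp
    then have "fe c - f_bulk P c = fe m - f_bulk P m"
      using DERIV_isconst2[OF mc, of "\<lambda>y. fe y - f_bulk P y" c] mc
      by (metis (no_types, lifting) DERIV_continuous continuous_at_imp_continuous_on atLeastAtMost_iff less_eq_real_def order_refl)
    then show ?thesis by (simp add: fe_def)
  qed
  show ?thesis by (rule that[OF Cfe Ch dfe dh fm hm])
qed

lemma deriv_f_bulk:
  assumes "0 < c" "0 < lam P"
  shows "deriv (f_bulk P) c = El P * ln (lam P * c)" "deriv (deriv (f_bulk P)) c = El P / c"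
proof -
  have d: "(f_bulk P has_real_derivative El P * ln (lam P * y)) (at y)" if "0 < y" for y
    unfolding f_bulk_def
    using that assms by (auto intro!: derivative_eq_intros simp: field_simps)
  then show "deriv (f_bulk P) c = El P * ln (lam P * c)" using assms DERIV_imp_deriv by blast
  have "((\<lambda>y. El P * ln (lam P * y)) has_real_derivative El P / c) (at c)"
    using assms by (auto intro!: derivative_eq_intros simp: field_simps)
  then have "(deriv (f_bulk P) has_real_derivative El P / c) (at c)"
    by (rule has_field_derivative_transform_within_open[of _ _ _ "{0<..}"])
      (use assms d DERIV_imp_deriv in \<open>auto intro!: DERIV_imp_deriv[symmetric]\<close>)
  then show "deriv (deriv (f_bulk P)) c = El P / c" by (rule DERIV_imp_deriv)
qed

lemma g_surf_derivs:
  assumes "0 < y" "y < 1"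
  shows "(g_surf P has_real_derivative El P * (ln y - ln (1 - y))) (at y)"
    and "((\<lambda>y. El P * (ln y - ln (1 - y))) has_real_derivative El P / (y * (1 - y))) (at y)"
proof -
  show "(g_surf P has_real_derivative El P * (ln y - ln (1 - y))) (at y)"
  proof -
    have 1: "((\<lambda>y. y * ln y) has_real_derivative ln y + 1) (at y)"
      using assms by (auto intro!: derivative_eq_intros)
    have 2: "((\<lambda>y. (1 - y) * ln (1 - y)) has_real_derivative - ln (1 - y) - 1) (at y)"
      using assms by (auto intro!: derivative_eq_intros)
    show ?thesis
      unfolding g_surf_def[abs_def]
      using DERIV_add[OF DERIV_const DERIV_cmult[OF DERIV_add[OF 1 2], of "El P"], of 1] by (simp add: algebra_simps)
  qed
  show "((\<lambda>y. El P * (ln y - ln (1 - y))) has_real_derivative El P / (y * (1 - y))) (at y)"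
    using assms by (auto intro!: derivative_eq_intros simp: field_simps)
qed

lemma deriv_g_surf:
  assumes "0 < y" "y < 1"
  shows "deriv (g_surf P) y = El P * (ln y - ln (1 - y))" "deriv (deriv (g_surf P)) y = El P / (y * (1 - y))"
proof -
  show "deriv (g_surf P) y = El P * (ln y - ln (1 - y))"
    using g_surf_derivs(1)[OF assms] by (rule DERIV_imp_deriv)
  have "(deriv (g_surf P) has_real_derivative El P / (y * (1 - y))) (at y)"
    by (rule has_field_derivative_transform_within_open[OF g_surf_derivs(2)[OF assms], of "{0<..<1}"])
      (use assms g_surf_derivs(1) in \<open>auto intro!: DERIV_imp_deriv[symmetric]\<close>)
  then show "deriv (deriv (g_surf P)) y = El P / (y * (1 - y))" by (rule DERIV_imp_deriv)
qed

section \<open>Calculus on the interface\<close>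

lemma FTC_set_integral_Icc:
  fixes F f :: "real \<Rightarrow> real"
  assumes "a \<le> b" "\<And>x. x \<in> {a..b} \<Longrightarrow> (F has_real_derivative f x) (at x)" "continuous_on {a..b} f"
  shows "(LINT x:{a..b}|lborel. f x) = F b - F a"
  unfolding set_lebesgue_integral_def
  by (rule integral_FTC_Icc[OF assms(1) _ assms(3)])
    (use assms(2) in \<open>auto simp: has_real_derivative_iff_has_vector_derivative intro: has_vector_derivative_at_within\<close>)

lemma has_real_derivative_inner:
  assumes "(f has_vector_derivative f') (at a within S)" "(g has_vector_derivative g') (at a within S)"
  shows "((\<lambda>a. f a \<bullet> g a) has_real_derivative f a \<bullet> g' + f' \<bullet> g a) (at a within S)"
  unfolding has_real_derivative_iff_has_vector_derivative
  by (rule bounded_bilinear.has_vector_derivative[OF bounded_bilinear_inner assms])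

locale regular_curve =
  fixes c :: "real \<Rightarrow> real^2"
  assumes C: "Ck 2 c" and reg: "\<And>a. a \<in> {0..1} \<Longrightarrow> vector_derivative c (at a) \<noteq> 0"
begin

definition c' where "c' a = vector_derivative c (at a)"
definition c'' where "c'' a = vector_derivative c' (at a)"
definition nu where "nu a = norm (c' a)"
abbreviation tau where "tau \<equiv> tangent c"
abbreviation nor where "nor \<equiv> normal c"
text \<open>Derivative of the unit tangent in the curve parameter, not in arclength: the part of
  c''/nu normal to the curve.\<close>

definition tau' where "tau' a = (1 / nu a) *\<^sub>R c'' a - ((c' a \<bullet> c'' a) / nu a ^ 3) *\<^sub>R c' a"

lemma C2: "Ck (Suc (Suc 0)) c" using C by (simp add: numeral_2_eq_2)
lemma C1': "Ck (Suc 0) c'" unfolding c'_def[abs_def] by (rule Ck_vector_derivative[OF C2])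

lemma c_deriv: "(c has_vector_derivative c' a) (at a)" "(c' has_vector_derivative c'' a) (at a)"
  using Ck_has_vector_derivative[OF C2] Ck_has_vector_derivative[OF C1'] by (auto simp: c'_def c''_def)

lemma cont: "continuous_on A c" "continuous_on A c'" "continuous_on A c''" "continuous_on A nu"
  using Ck_imp_continuous_on[OF C2] Ck_imp_continuous_on[OF C1']
    Ck_imp_continuous_on[OF Ck_vector_derivative[OF C1']]
  by (auto simp: c''_def[abs_def] nu_def[abs_def] intro!: continuous_intros)

lemma nu_pos: "a \<in> {0..1} \<Longrightarrow> 0 < nu a"
  using reg by (simp add: nu_def c'_def)

lemma tau_eq: "tau a = (1 / nu a) *\<^sub>R c' a"
  by (simp add: tangent_def d_arc_def nu_def c'_def)

lemma c'_eq: "a \<in> {0..1} \<Longrightarrow> c' a = nu a *\<^sub>R tau a"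
  using nu_pos[of a] by (simp add: tau_eq)

lemma tau_unit: "a \<in> {0..1} \<Longrightarrow> tau a \<bullet> tau a = 1"
  using nu_pos[of a] by (simp add: tau_eq nu_def power2_norm_eq_inner[symmetric] power2_eq_square)

lemma nor_nth: "nor a $ 1 = - (tau a $ 2)" "nor a $ 2 = tau a $ 1"
  by (simp_all add: normal_def)

lemma frame:
  assumes "a \<in> {0..1}"
  shows "v = (v \<bullet> tau a) *\<^sub>R tau a + (v \<bullet> nor a) *\<^sub>R nor a"
    and "v \<bullet> w = (v \<bullet> tau a) * (w \<bullet> tau a) + (v \<bullet> nor a) * (w \<bullet> nor a)"
proof -
  have u: "(tau a $ 1)\<^sup>2 + (tau a $ 2)\<^sup>2 = 1"
    using tau_unit[OF assms] by (simp add: inner_vec2 power2_eq_square)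
  have "(v \<bullet> tau a) * tau a $ 1 + (v \<bullet> nor a) * nor a $ 1 = v $ 1 * ((tau a $ 1)\<^sup>2 + (tau a $ 2)\<^sup>2)"
    "(v \<bullet> tau a) * tau a $ 2 + (v \<bullet> nor a) * nor a $ 2 = v $ 2 * ((tau a $ 1)\<^sup>2 + (tau a $ 2)\<^sup>2)"
    by (simp_all add: inner_vec2 nor_nth power2_eq_square algebra_simps)
  then show v: "v = (v \<bullet> tau a) *\<^sub>R tau a + (v \<bullet> nor a) *\<^sub>R nor a"
    unfolding vec2_eq_iff by (simp add: u)
  have "v \<bullet> w = ((v \<bullet> tau a) *\<^sub>R tau a + (v \<bullet> nor a) *\<^sub>R nor a) \<bullet> w" by (rule arg_cong[OF v])
  then show "v \<bullet> w = (v \<bullet> tau a) * (w \<bullet> tau a) + (v \<bullet> nor a) * (w \<bullet> nor a)"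
    by (simp only: inner_add_left inner_scaleR_left inner_commute[of "tau a" w] inner_commute[of "nor a" w])
qed

lemma nu_deriv: "a \<in> {0..1} \<Longrightarrow> (nu has_real_derivative (c' a \<bullet> c'' a) / nu a) (at a)"
proof -
  assume a: "a \<in> {0..1}"
  then have "c' a \<noteq> 0" using reg by (simp add: c'_def)
  from has_derivative_compose[OF c_deriv(2)[unfolded has_vector_derivative_def] has_derivative_norm[OF this]]
  show ?thesis
    unfolding has_field_derivative_def nu_def[abs_def]
    by (rule has_derivative_eq_rhs) (auto simp: fun_eq_iff sgn_div_norm divide_inverse inner_commute algebra_simps)
qed

lemma tau_deriv:
  assumes a: "a \<in> {0..1}" shows "(tau has_vector_derivative tau' a) (at a)"
proof -
  have "((\<lambda>a. 1 / nu a) has_real_derivative - ((c' a \<bullet> c'' a) / nu a ^ 3)) (at a)"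
    using nu_pos[OF a] by (auto intro!: derivative_eq_intros nu_deriv[OF a] simp: power2_eq_square power3_eq_cube)
  from has_vector_derivative_scaleR[OF this c_deriv(2)]
  show ?thesis unfolding tau_eq[abs_def] tau'_def by simp
qed

lemma tau'_orth: "a \<in> {0..1} \<Longrightarrow> tau' a \<bullet> tau a = 0"
proof -
  assume a: "a \<in> {0..1}"
  have e: "c' a \<bullet> c' a = (nu a)\<^sup>2" by (simp add: nu_def power2_norm_eq_inner)
  have "tau' a \<bullet> tau a = (1 / nu a) * ((1 / nu a) * (c'' a \<bullet> c' a) - (c' a \<bullet> c'' a) / nu a ^ 3 * (c' a \<bullet> c' a))"
    by (simp add: tau'_def tau_eq inner_diff_left)
  also have "\<dots> = 0"
    unfolding e using nu_pos[OF a] by (simp add: inner_commute field_simps power2_eq_square power3_eq_cube)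
  finally show ?thesis .
qed

lemma cont_tau: "continuous_on {0..1} tau" "continuous_on {0..1} tau'" "continuous_on {0..1} nor"
proof -
  have ne: "nu a \<noteq> 0" if "a \<in> {0..1}" for a using nu_pos[OF that] by simp
  show t: "continuous_on {0..1} tau" unfolding tau_eq[abs_def] by (intro continuous_intros cont) (use ne in auto)
  show "continuous_on {0..1} tau'" unfolding tau'_def[abs_def] by (intro continuous_intros cont) (use ne in auto)
  show "continuous_on {0..1} nor" unfolding normal_def[abs_def] by (intro continuous_intros t)
qed

lemma sgrad_eq: "a \<in> {0..1} \<Longrightarrow> sgrad (nor a) f x = (grad f x \<bullet> tau a) *\<^sub>R tau a"
proof -
  assume a: "a \<in> {0..1}"
  have "sgrad (nor a) f x = grad f x - (grad f x \<bullet> nor a) *\<^sub>R nor a"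
    by (simp add: sgrad_def tan_proj_def vec2_eq_iff matrix_vector_mult_def sum_2 mat_def inner_vec2 algebra_simps)
  then show ?thesis using frame(1)[OF a, of "grad f x"] by (metis add_diff_cancel_right')
qed

text \<open>Since \<open>tau'\<close> is normal to the curve, it equals minus speed times curvature
  times the normal. The capillary force per unit of parameter is therefore a derivative of the
  tangent, which makes the work of surface tension exact.\<close>

lemma curvature_eq:
  assumes a: "a \<in> {0..1}"
  shows "nu a * (v \<bullet> (- (k * curvature c a)) *\<^sub>R nor a) = k * (v \<bullet> tau' a)"
proof -
  have "curvature c a = - (1 / nu a) * (tau' a \<bullet> nor a)"
    using vector_derivative_at[OF tau_deriv[OF a]]
    by (simp add: curvature_def d_arc_def nu_def c'_def)
  moreover have "v \<bullet> tau' a = (v \<bullet> nor a) * (tau' a \<bullet> nor a)"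
    using frame(2)[OF a, of v "tau' a"] tau'_orth[OF a] by simp
  ultimately show ?thesis using nu_pos[OF a] by simp
qed

lemma sdvg_eq:
  assumes a: "a \<in> {0..1}" and V: "Ck (Suc 0) V" and d: "((\<lambda>a. V (c a)) has_vector_derivative V') (at a)"
  shows "sdvg (nor a) V (c a) * nu a = V' \<bullet> tau a"
proof -
  have "sdvg (nor a) V (c a) = d_arc c (\<lambda>b. V (c b)) a \<bullet> tau a"
    by (rule sdvg_eq_d_arc) (use differentiableI_vector[OF c_deriv(1)] reg[OF a] V in \<open>auto simp: Ck.simps(2)\<close>)
  then show ?thesis
    using vector_derivative_at[OF d] nu_pos[OF a] by (simp add: d_arc_def nu_def c'_def)
qed

text \<open>The arclength derivative of \<open>f\<close> along the curve, a scalar that stands for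
  the surface gradient.\<close>

definition q :: "(real^2 \<Rightarrow> real) \<Rightarrow> real \<Rightarrow> real" where "q f a = grad f (c a) \<bullet> tau a"

lemma grad_c_deriv:
  assumes f: "Ck 2 f"
  obtains G' where "\<And>a. ((\<lambda>a. grad f (c a)) has_vector_derivative G' a) (at a)" "continuous_on UNIV G'"
proof -
  have f2: "Ck (Suc (Suc 0)) f" using f by (simp add: numeral_2_eq_2)
  have "Ck (Suc 0) (grad f)"
  proof (rule Ck_componentwise)
    fix b :: "real^2" assume "b \<in> Basis"
    then show "Ck (Suc 0) (\<lambda>x. grad f x \<bullet> b)" using Ck_grad_nth[OF f2] by (auto simp: Basis_vec2 inner_axis)
  qed
  from Ck_compose[OF this Ck_mono[OF C2, of "Suc 0"]] have k: "Ck (Suc 0) (\<lambda>a. grad f (c a))" by simp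
  show ?thesis
    by (rule that[OF Ck_has_vector_derivative[OF k] Ck_imp_continuous_on[OF Ck_vector_derivative[OF k]]])
qed

lemma scalar_c_deriv:
  assumes f: "(f has_derivative (\<lambda>h. grad f (c a) \<bullet> h)) (at (c a))" and a: "a \<in> {0..1}"
  shows "((\<lambda>a. f (c a)) has_real_derivative nu a * q f a) (at a)"
proof -
  from has_derivative_compose[OF c_deriv(1)[unfolded has_vector_derivative_def] f]
  show ?thesis unfolding has_field_derivative_def
    by (rule has_derivative_eq_rhs) (auto simp: fun_eq_iff q_def c'_eq[OF a])
qed

lemma q_deriv:
  assumes f: "Ck 2 f"
  obtains q' where "\<And>a. a \<in> {0..1} \<Longrightarrow> (q f has_real_derivative q' a) (at a)" "continuous_on {0..1} q'"
    "\<And>a. a \<in> {0..1} \<Longrightarrow> slaplacian c f a * nu a = q' a"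
proof -
  obtain G' where G': "\<And>a. ((\<lambda>a. grad f (c a)) has_vector_derivative G' a) (at a)" "continuous_on UNIV G'"
    using grad_c_deriv[OF f] by blast
  have cg: "continuous_on A (\<lambda>a. grad f (c a))" for A
    using G'(1) by (meson continuous_at_imp_continuous_on has_vector_derivative_continuous)
  define q' where "q' a = grad f (c a) \<bullet> tau' a + G' a \<bullet> tau a" for a
  have qd: "(q f has_real_derivative q' a) (at a)" if "a \<in> {0..1}" for a
    unfolding q_def[abs_def] q'_def by (rule has_real_derivative_inner[OF G'(1) tau_deriv[OF that]])
  have "continuous_on {0..1} q'"
    unfolding q'_def[abs_def] by (intro continuous_intros cg cont_tau continuous_on_subset[OF G'(2)]) auto
  moreover have "slaplacian c f a * nu a = q' a" if a: "a \<in> {0..1}" for a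
  proof -
    \<comment> \<open>\<open>slaplacian\<close> takes a two-sided derivative, also at the ends 0 and
      1, so the formula for the surface gradient is needed in a neighbourhood; regularity persists
      there because it is an open condition.\<close>
    have op: "open {b. c' b \<noteq> 0}"
      by (rule open_Collect_neq[OF cont(2) continuous_on_const])
    have d: "((\<lambda>b. q f b *\<^sub>R tau b) has_vector_derivative q f a *\<^sub>R tau' a + q' a *\<^sub>R tau a) (at a)"
      by (rule has_vector_derivative_scaleR[OF qd[OF a] tau_deriv[OF a]])
    have eq: "sgrad (nor b) f (c b) = q f b *\<^sub>R tau b" if "c' b \<noteq> 0" for b
    proof -
      have u: "(tau b $ 1)\<^sup>2 + (tau b $ 2)\<^sup>2 = 1"
        using that by (simp add: tau_eq nu_def power_divide norm_vec_def L2_set_def sum_2 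
            add_divide_distrib[symmetric] sum_power2_eq_zero_iff vec2_eq_iff)
      have u': "1 - (tau b $ 2)\<^sup>2 = (tau b $ 1)\<^sup>2" "1 - (tau b $ 1)\<^sup>2 = (tau b $ 2)\<^sup>2" using u by auto
      have "sgrad (nor b) f (c b) $ 1 = grad f (c b) $ 1 * (1 - (tau b $ 2)\<^sup>2) + grad f (c b) $ 2 * (tau b $ 1 * tau b $ 2)"
        "sgrad (nor b) f (c b) $ 2 = grad f (c b) $ 2 * (1 - (tau b $ 1)\<^sup>2) + grad f (c b) $ 1 * (tau b $ 1 * tau b $ 2)"
        by (simp_all add: sgrad_def tan_proj_def matrix_vector_mult_def sum_2 mat_def nor_nth power2_eq_square algebra_simps)
      then show ?thesis unfolding u' vec2_eq_iff by (simp add: q_def inner_vec2 power2_eq_square algebra_simps)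
    qed
    have "((\<lambda>b. sgrad (nor b) f (c b)) has_vector_derivative q f a *\<^sub>R tau' a + q' a *\<^sub>R tau a) (at a)"
      by (rule has_vector_derivative_transform_within_open[OF d op])
        (use eq reg[OF a] in \<open>auto simp: c'_def\<close>)
    from vector_derivative_at[OF this]
    have "slaplacian c f a * nu a = (q f a *\<^sub>R tau' a + q' a *\<^sub>R tau a) \<bullet> tau a"
      using nu_pos[OF a] by (simp add: slaplacian_def d_arc_def nu_def c'_def)
    then show ?thesis using tau'_orth[OF a] tau_unit[OF a] by (simp add: inner_add_left)
  qed
  ultimately show ?thesis using qd that by blast
qed

lemma set_int: "continuous_on {0..1} f \<Longrightarrow> set_integrable lborel {0..1} f" for f :: "real \<Rightarrow> real"
  by (rule borel_integrable_atLeastAtMost')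

text \<open>Here \<open>w\<close> is the velocity of the parameterization and \<open>U\<close> that of the fluid. They differ by a
  tangential field that vanishes at both ends, so the integrand is the exact derivative of
  \<open>h (w - U) \<bullet> tau\<close>.\<close>

lemma tangential_slip:
  assumes w: "\<And>a. (w has_vector_derivative w' a) (at a)" "continuous_on UNIV w'"
    and U: "\<And>a. (U has_vector_derivative U' a) (at a)" "continuous_on UNIV U'"
    and kin: "\<And>a. a \<in> {0..1} \<Longrightarrow> w a \<bullet> nor a = U a \<bullet> nor a" and ends: "w 0 = U 0" "w 1 = U 1"
    and h: "\<And>a. a \<in> {0..1} \<Longrightarrow> (h has_real_derivative h' a) (at a)" "continuous_on {0..1} h'"
  shows "(LINT a:{0..1}|lborel. h' a * ((w a - U a) \<bullet> tau a) + h a * ((w' a - U' a) \<bullet> tau a)) = 0"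
proof -
  let ?F = "\<lambda>a. h a * ((w a - U a) \<bullet> tau a)"
  let ?f = "\<lambda>a. h' a * ((w a - U a) \<bullet> tau a) + h a * ((w' a - U' a) \<bullet> tau a)"
  have cw: "continuous_on A w" "continuous_on A U" for A
    using w(1) U(1) by (meson continuous_at_imp_continuous_on has_vector_derivative_continuous)+
  have ch: "continuous_on {0..1} h" using h(1) by (meson DERIV_isCont continuous_at_imp_continuous_on)
  have "(?F has_real_derivative ?f a) (at a)" if a: "a \<in> {0..1}" for a
  proof -
    \<comment> \<open>The slip is tangential and \<open>tau'\<close> is normal, so differentiating
      the tangent contributes nothing.\<close>
    have "(w a - U a) \<bullet> tau' a = 0"
      using frame(2)[OF a, of "w a - U a" "tau' a"] kin[OF a] tau'_orth[OF a] by (simp add: inner_diff_left)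
    moreover have "((\<lambda>a. (w a - U a) \<bullet> tau a) has_real_derivative (w a - U a) \<bullet> tau' a + (w' a - U' a) \<bullet> tau a) (at a)"
      by (rule has_real_derivative_inner[OF has_vector_derivative_diff[OF w(1) U(1)] tau_deriv[OF a]])
    ultimately have "((\<lambda>a. (w a - U a) \<bullet> tau a) has_real_derivative (w' a - U' a) \<bullet> tau a) (at a)" by simp
    from DERIV_mult[OF h(1)[OF a] this] show ?thesis by (simp add: mult.commute add.commute)
  qed
  moreover have "continuous_on {0..1} ?f"
    by (intro continuous_intros h(2) ch cw cont_tau continuous_on_subset[OF w(2)] continuous_on_subset[OF U(2)]) auto
  ultimately show ?thesis using FTC_set_integral_Icc[of 0 1 ?F ?f] ends by simp
qed

text \<open>Integration by parts along the curve; the absence of surface flux at the contact points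
  removes the boundary terms.\<close>

lemma surface_diffusion:
  assumes f: "Ck 2 f" and I: "\<And>a. a \<in> {0..1} \<Longrightarrow> f (c a) \<in> I"
    and g: "\<And>y. y \<in> I \<Longrightarrow> (g has_real_derivative g' y) (at y)" "continuous_on I g'"
    and ends: "q f 0 = 0" "q f 1 = 0"
  shows "(LINT a:{0..1}|lborel. g (f (c a)) * (slaplacian c f a * nu a)) = - (LINT a:{0..1}|lborel. g' (f (c a)) * (q f a)\<^sup>2 * nu a)"
proof -
  obtain q' where q': "\<And>a. a \<in> {0..1} \<Longrightarrow> (q f has_real_derivative q' a) (at a)" "continuous_on {0..1} q'"
    "\<And>a. a \<in> {0..1} \<Longrightarrow> slaplacian c f a * nu a = q' a"
    using q_deriv[OF f] by blast
  have f1: "Ck (Suc 0) f" using Ck_mono[OF f, of "Suc 0"] by simp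
  have cq: "continuous_on {0..1} (q f)" using q'(1) by (meson DERIV_isCont continuous_at_imp_continuous_on)
  have cf: "continuous_on {0..1} (\<lambda>a. f (c a))"
    by (intro continuous_on_compose2[OF Ck_imp_continuous_on[OF f1, of UNIV]] cont) auto
  have cg: "continuous_on {0..1} (\<lambda>a. g (f (c a)))"
  proof -
    have "continuous_on I g" using g(1) by (meson DERIV_isCont continuous_at_imp_continuous_on)
    then show ?thesis by (rule continuous_on_compose2[OF _ cf]) (use I in auto)
  qed
  have cg': "continuous_on {0..1} (\<lambda>a. g' (f (c a)))"
    by (rule continuous_on_compose2[OF g(2) cf]) (use I in auto)
  have "((\<lambda>a. g (f (c a)) * q f a) has_real_derivative g (f (c a)) * q' a + g' (f (c a)) * (q f a)\<^sup>2 * nu a) (at a)" if a: "a \<in> {0..1}" for a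
    using DERIV_mult[OF DERIV_chain2[OF g(1)[OF I[OF a]] scalar_c_deriv[OF Ck_has_derivative_grad[OF f1] a]] q'(1)[OF a]]
    by (simp add: power2_eq_square algebra_simps)
  then have "(LINT a:{0..1}|lborel. g (f (c a)) * q' a + g' (f (c a)) * (q f a)\<^sup>2 * nu a) = 0"
    using FTC_set_integral_Icc[of 0 1 "\<lambda>a. g (f (c a)) * q f a" "\<lambda>a. g (f (c a)) * q' a + g' (f (c a)) * (q f a)\<^sup>2 * nu a"] ends
    by (simp add: continuous_on_add continuous_on_mult continuous_on_power cg cg' cq q'(2) cont)
  moreover have "(LINT a:{0..1}|lborel. g (f (c a)) * q' a + g' (f (c a)) * (q f a)\<^sup>2 * nu a)
     = (LINT a:{0..1}|lborel. g (f (c a)) * q' a) + (LINT a:{0..1}|lborel. g' (f (c a)) * (q f a)\<^sup>2 * nu a)"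
    by (intro set_integral_add(2) set_int continuous_on_mult continuous_on_power cg cg' cq q'(2) cont)
  moreover have "(LINT a:{0..1}|lborel. g (f (c a)) * (slaplacian c f a * nu a)) = (LINT a:{0..1}|lborel. g (f (c a)) * q' a)"
    by (rule set_lebesgue_integral_cong) (auto simp: q'(3))
  ultimately show ?thesis by simp
qed

text \<open>The product rule for g(f) (V . tau) along the curve: differentiating V gives the surface
  divergence, differentiating tau the curvature force, and differentiating g(f) the Marangoni force.
  The two integrands thus add up to an exact derivative.\<close>

lemma surface_tension_work:
  assumes f: "Ck 2 f" and V: "Ck 2 V" and I: "\<And>a. a \<in> {0..1} \<Longrightarrow> f (c a) \<in> I"
    and g: "\<And>y. y \<in> I \<Longrightarrow> (g has_real_derivative g' y) (at y)" "continuous_on I g'"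
  shows "(LINT a:{0..1}|lborel. g (f (c a)) * (sdvg (nor a) V (c a) * nu a))
     + (LINT a:{0..1}|lborel. nu a * (V (c a) \<bullet> (- (g (f (c a)) * curvature c a) *\<^sub>R nor a + sgrad (nor a) (\<lambda>y. g (f y)) (c a))))
     = g (f (c 1)) * (V (c 1) \<bullet> tau 1) - g (f (c 0)) * (V (c 0) \<bullet> tau 0)"
proof -
  have f1: "Ck (Suc 0) f" and V1: "Ck (Suc 0) V" using Ck_mono[OF f, of "Suc 0"] Ck_mono[OF V, of "Suc 0"] by auto
  define V' where "V' a = vector_derivative (\<lambda>a. V (c a)) (at a)" for a
  have kV: "Ck (Suc 0) (\<lambda>a. V (c a))" using Ck_compose[OF V1 Ck_mono[OF C2, of "Suc 0"]] by simp
  have dV: "((\<lambda>a. V (c a)) has_vector_derivative V' a) (at a)" for a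
    unfolding V'_def by (rule Ck_has_vector_derivative[OF kV])
  have cV: "continuous_on A (\<lambda>a. V (c a))" "continuous_on A V'" for A
    using Ck_imp_continuous_on[OF kV] Ck_imp_continuous_on[OF Ck_vector_derivative[OF kV]] by (auto simp: V'_def[abs_def])
  have cf: "continuous_on {0..1} (\<lambda>a. f (c a))"
    by (intro continuous_on_compose2[OF Ck_imp_continuous_on[OF f1, of UNIV]] cont) auto
  have cg: "continuous_on {0..1} (\<lambda>a. g (f (c a)))"
  proof -
    have "continuous_on I g" using g(1) by (meson DERIV_isCont continuous_at_imp_continuous_on)
    then show ?thesis by (rule continuous_on_compose2[OF _ cf]) (use I in auto)
  qed
  have cg': "continuous_on {0..1} (\<lambda>a. g' (f (c a)))"
    by (rule continuous_on_compose2[OF g(2) cf]) (use I in auto)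
  have cq: "continuous_on {0..1} (q f)"
    unfolding q_def[abs_def] inner_vec2
    by (intro continuous_intros continuous_on_compose2[OF Ck_imp_continuous_on[OF Ck_grad_nth[OF f1], of UNIV]] cont cont_tau) auto
  let ?A = "\<lambda>a. g (f (c a)) * (V' a \<bullet> tau a)"
  let ?B = "\<lambda>a. g (f (c a)) * (V (c a) \<bullet> tau' a) + g' (f (c a)) * (nu a * q f a) * (V (c a) \<bullet> tau a)"
  have A: "g (f (c a)) * (sdvg (nor a) V (c a) * nu a) = ?A a" if "a \<in> {0..1}" for a
    by (simp only: sdvg_eq[OF that V1 dV])
  have B: "nu a * (V (c a) \<bullet> (- (g (f (c a)) * curvature c a) *\<^sub>R nor a + sgrad (nor a) (\<lambda>y. g (f y)) (c a))) = ?B a"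
    if a: "a \<in> {0..1}" for a
  proof -
    have "((\<lambda>y. g (f y)) has_derivative (\<lambda>h. (g' (f (c a)) *\<^sub>R grad f (c a)) \<bullet> h)) (at (c a))"
      using has_derivative_compose[OF Ck_has_derivative_grad[OF f1] g(1)[OF I[OF a], unfolded has_field_derivative_def]]
      by (rule has_derivative_eq_rhs) simp
    then have "grad (\<lambda>y. g (f y)) (c a) = g' (f (c a)) *\<^sub>R grad f (c a)" by (rule grad_eqI)
    then have "nu a * (V (c a) \<bullet> sgrad (nor a) (\<lambda>y. g (f y)) (c a)) = g' (f (c a)) * (nu a * q f a) * (V (c a) \<bullet> tau a)"
      by (simp add: sgrad_eq[OF a] q_def)
    then show ?thesis
      using curvature_eq[OF a, of "V (c a)" "g (f (c a))"] by (simp only: inner_add_right distrib_left)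
  qed
  have cA: "continuous_on {0..1} ?A" and cB: "continuous_on {0..1} ?B"
    by (intro continuous_intros cg cg' cV cont_tau cq cont)+
  have d: "((\<lambda>a. g (f (c a)) * (V (c a) \<bullet> tau a)) has_real_derivative ?A a + ?B a) (at a)" if a: "a \<in> {0..1}" for a
    using DERIV_mult[OF DERIV_chain2[OF g(1)[OF I[OF a]] scalar_c_deriv[OF Ck_has_derivative_grad[OF f1] a]]
        has_real_derivative_inner[OF dV tau_deriv[OF a]]]
    by (simp add: algebra_simps)
  have "(LINT a:{0..1}|lborel. ?A a) + (LINT a:{0..1}|lborel. ?B a) = (LINT a:{0..1}|lborel. ?A a + ?B a)"
    by (intro set_integral_add(2)[symmetric] set_int cA cB)
  also have "\<dots> = g (f (c 1)) * (V (c 1) \<bullet> tau 1) - g (f (c 0)) * (V (c 0) \<bullet> tau 0)"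
    by (rule FTC_set_integral_Icc[OF _ d]) (auto intro: continuous_on_add[OF cA cB])
  also have "(LINT a:{0..1}|lborel. ?A a) = (LINT a:{0..1}|lborel. g (f (c a)) * (sdvg (nor a) V (c a) * nu a))"
    by (rule set_lebesgue_integral_cong) (auto simp: A)
  also have "(LINT a:{0..1}|lborel. ?B a) = (LINT a:{0..1}|lborel. nu a * (V (c a) \<bullet> (- (g (f (c a)) * curvature c a) *\<^sub>R nor a + sgrad (nor a) (\<lambda>y. g (f y)) (c a))))"
    by (rule set_lebesgue_integral_cong) (simp, intro allI impI, erule B[symmetric])
  finally show ?thesis .
qed

end

section \<open>Transport theorem on the moving interface\<close>

locale moving_surface = moving_drop +
  assumes regular: "\<And>t a. t \<in> {0..T} \<Longrightarrow> a \<in> {0..1} \<Longrightarrow> vector_derivative (X t) (at a) \<noteq> 0"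
begin

lemma curve: "t \<in> {0..T} \<Longrightarrow> regular_curve (X t)"
  using Ck_slice[OF CX] regular by unfold_locales

lemma arc_integral_eq: "arc_integral (X t) h = (LINT a:{0..1}|lborel. h a * norm (Xa t a))"
  by (simp add: arc_integral_def Xa_def)

text \<open>Differentiation under the integral happens at a fixed parameter, that is along
  \<open>Xt\<close>. Replacing \<open>Xt\<close> by the fluid velocity changes the integrand by that
  of \<open>tangential_slip\<close>, whose integral is zero.\<close>

lemma surface_rate:
  assumes G: "Ck 2 (\<lambda>(t, x). \<Gamma> t x)" and u: "Ck 2 (\<lambda>(t, x). u t x)"
    and I: "\<And>t a. t \<in> {0..T} \<Longrightarrow> a \<in> {0..1} \<Longrightarrow> \<Gamma> t (X t a) \<in> I"
    and g: "\<And>y. y \<in> I \<Longrightarrow> (g has_real_derivative g' y) (at y)" "continuous_on I g'"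
    and t: "t \<in> {0..T}"
    and kin: "\<And>a. a \<in> {0..1} \<Longrightarrow> Xt t a \<bullet> normal (X t) a = u t (X t a) \<bullet> normal (X t) a"
    and ends: "Xt t 0 = u t (X t 0)" "Xt t 1 = u t (X t 1)"
  shows "((\<lambda>t. arc_integral (X t) (\<lambda>a. g (\<Gamma> t (X t a)))) has_real_derivative
     arc_integral (X t) (\<lambda>a. g' (\<Gamma> t (X t a)) * material_derivative u \<Gamma> t (X t a)
        + g (\<Gamma> t (X t a)) * sdvg (normal (X t) a) (u t) (X t a))) (at t within {0..T})"
proof -
  have G2: "Ck (Suc (Suc 0)) (\<lambda>(t, x). \<Gamma> t x)" and u2: "Ck (Suc (Suc 0)) (\<lambda>(t, x). u t x)"
    using G u by (simp_all add: numeral_2_eq_2)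
  have G1: "Ck (Suc 0) (\<Gamma> t)" for t using Ck_slice[OF Ck_Suc_imp[OF G2]] .
  have u1: "Ck (Suc 0) (u t)" for t using Ck_slice[OF Ck_Suc_imp[OF u2]] .
  define Xat where "Xat t a = vector_derivative (\<lambda>s. Xa s a) (at t)" for t a
  have Xat: "((\<lambda>s. Xa s a) has_vector_derivative Xat t a) (at t)" for t a
    unfolding Xat_def by (rule Ck_joint_derivs(1)[OF CXa])
  have jc: "continuous_on A (\<lambda>z. f (fst z) (snd z))" if "Ck k (\<lambda>(t, a). f t a)" for f :: "real \<Rightarrow> 'q::euclidean_space \<Rightarrow> 'r::euclidean_space" and k A
    using Ck_imp_continuous_on[OF that] by (simp add: split_def)
  have comp: "continuous_on A (\<lambda>z. f (fst z) (X (fst z) (snd z)))" if "Ck k (\<lambda>(t, x). f t x)" for f :: "real \<Rightarrow> real^2 \<Rightarrow> real" and k A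
    using continuous_on_compose2[OF jc[OF that, of UNIV], of A "\<lambda>z. (fst z, X (fst z) (snd z))"]
    by (simp add: continuous_on_Pair continuous_on_fst[OF continuous_on_id] jc[OF CX])
  have cXat: "Ck 0 (\<lambda>(t, a). Xat t a)" unfolding Xat_def by (rule Ck_joint_derivs(2)[OF CXa])
  let ?S = "{0..T} \<times> {0..1}"
  let ?G = "\<lambda>s a. \<Gamma> s (X s a)"
  have cG: "continuous_on ?S (\<lambda>z. ?G (fst z) (snd z))" by (rule comp[OF G])
  have cont_g: "continuous_on I g" using g(1) by (meson DERIV_isCont continuous_at_imp_continuous_on)
  have cg: "continuous_on ?S (\<lambda>z. g (?G (fst z) (snd z)))" "continuous_on ?S (\<lambda>z. g' (?G (fst z) (snd z)))"
    using continuous_on_compose2[OF cont_g cG] continuous_on_compose2[OF g(2) cG] I by force+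
  \<comment> \<open>Time derivative of the integrand at a fixed parameter; the last factor is the
    rate of change of the speed, which measures the stretching of the interface.\<close>
  define ft where "ft s a = g' (?G s a) * (dt \<Gamma> s (X s a) + grad (\<Gamma> s) (X s a) \<bullet> Xt s a) * norm (Xa s a)
     + g (?G s a) * ((Xa s a \<bullet> Xat s a) / norm (Xa s a))" for s a
  have ne: "norm (Xa s a) \<noteq> 0" if "s \<in> {0..T}" "a \<in> {0..1}" for s a
    using regular[OF that] by (simp add: Xa_def)
  have cft: "continuous_on ?S (\<lambda>(s, a). ft s a)"
    unfolding ft_def split_def inner_vec2 dt_def
    by (intro continuous_intros cg comp[OF Ck_joint_derivs(2)[OF G2]] comp[OF Ck_joint_grad[OF G2]]
        jc[OF CXa] jc[OF CXt] jc[OF cXat]) (use ne in auto)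
  have dft: "((\<lambda>s. g (?G s a) * norm (Xa s a)) has_vector_derivative ft s a) (at s within {0..T})"
    if s: "s \<in> {0..T}" and a: "a \<in> {0..1}" for s a
  proof -
    have dG: "((\<lambda>s. ?G s a) has_real_derivative dt \<Gamma> s (X s a) + grad (\<Gamma> s) (X s a) \<bullet> Xt s a) (at s)"
      using Ck_joint_chain[OF G2 X_derivs(2)[of a s]] unfolding frechet_grad[OF G1] dt_def
      by (simp add: has_real_derivative_iff_has_vector_derivative)
    have "Xa s a \<noteq> 0" using ne[OF s a] by simp
    from has_derivative_compose[OF Xat[unfolded has_vector_derivative_def] has_derivative_norm[OF this]]
    have dn: "((\<lambda>s. norm (Xa s a)) has_real_derivative (Xa s a \<bullet> Xat s a) / norm (Xa s a)) (at s)"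
      unfolding has_field_derivative_def
      by (rule has_derivative_eq_rhs) (auto simp: fun_eq_iff sgn_div_norm divide_inverse inner_commute algebra_simps)
    have "((\<lambda>s. g (?G s a) * norm (Xa s a)) has_real_derivative ft s a) (at s)"
      using DERIV_mult[OF DERIV_chain2[OF g(1)[OF I[OF s a]] dG] dn] unfolding ft_def by (simp add: mult.commute mult.left_commute)
    then show ?thesis
      unfolding has_real_derivative_iff_has_vector_derivative by (rule has_vector_derivative_at_within)
  qed
  have sec: "continuous_on {0..1} (\<lambda>a. f s a)" if "continuous_on ?S (\<lambda>z. f (fst z) (snd z))" "s \<in> {0..T}" for f :: "real \<Rightarrow> real \<Rightarrow> real" and s
    using continuous_on_compose2[OF that(1) continuous_on_Pair_const[of "{0..1}" s]] that(2) by force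
  have cf: "continuous_on ?S (\<lambda>z. g (?G (fst z) (snd z)) * norm (Xa (fst z) (snd z)))"
    by (intro continuous_intros cg jc[OF CXa])
  have "((\<lambda>s. integral (cbox 0 1) (\<lambda>a. g (?G s a) * norm (Xa s a))) has_vector_derivative integral (cbox 0 1) (ft t)) (at t within {0..T})"
    by (rule leibniz_rule_vector_derivative)
      (use dft cft t sec[OF cf] in \<open>auto intro: integrable_continuous_interval\<close>)
  then have 1: "((\<lambda>s. integral {0..1} (\<lambda>a. g (?G s a) * norm (Xa s a))) has_real_derivative integral {0..1} (ft t)) (at t within {0..T})"
    by (simp add: has_real_derivative_iff_has_vector_derivative)
  have ai: "arc_integral (X s) (\<lambda>a. g (?G s a)) = integral {0..1} (\<lambda>a. g (?G s a) * norm (Xa s a))" if "s \<in> {0..T}" for s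
    unfolding arc_integral_eq using sec[OF cf that] by (rule set_integral_Icc_eq_integral)
  interpret R: regular_curve "X t" by (rule curve[OF t])
  define U' where "U' a = vector_derivative (\<lambda>a. u t (X t a)) (at a)" for a
  have kU: "Ck (Suc 0) (\<lambda>a. u t (X t a))" using Ck_compose[OF u1 Ck_mono[OF R.C2, of "Suc 0"]] by simp
  have dU: "((\<lambda>a. u t (X t a)) has_vector_derivative U' a) (at a)" for a
    unfolding U'_def by (rule Ck_has_vector_derivative[OF kU])
  have cU': "continuous_on A U'" for A
    using Ck_imp_continuous_on[OF Ck_vector_derivative[OF kU]] by (simp add: U'_def[abs_def])
  have c'_Xa: "R.c' a = Xa t a" "R.nu a = norm (Xa t a)" for a by (simp_all add: R.c'_def R.nu_def Xa_def)
  have dh: "((\<lambda>a. g (?G t a)) has_real_derivative g' (?G t a) * (R.nu a * R.q (\<Gamma> t) a)) (at a)" if "a \<in> {0..1}" for a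
    by (rule DERIV_chain2[OF g(1)[OF I[OF t that]] R.scalar_c_deriv[OF Ck_has_derivative_grad[OF G1] that]])
  have cq: "continuous_on {0..1} (R.q (\<Gamma> t))"
    unfolding R.q_def[abs_def] inner_vec2
    by (intro continuous_intros continuous_on_compose2[OF Ck_imp_continuous_on[OF Ck_grad_nth[OF G1], of UNIV]] R.cont R.cont_tau) auto
  have cw: "continuous_on UNIV (\<lambda>a. Xat t a)" using Ck_imp_continuous_on[OF Ck_slice[OF cXat]] .
  let ?slip = "\<lambda>a. g' (?G t a) * (R.nu a * R.q (\<Gamma> t) a) * ((Xt t a - u t (X t a)) \<bullet> R.tau a) + g (?G t a) * ((Xat t a - U' a) \<bullet> R.tau a)"
  let ?main = "\<lambda>a. (g' (?G t a) * material_derivative u \<Gamma> t (X t a) + g (?G t a) * sdvg (normal (X t) a) (u t) (X t a)) * norm (Xa t a)"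
  let ?main' = "\<lambda>a. g' (?G t a) * material_derivative u \<Gamma> t (X t a) * R.nu a + g (?G t a) * (U' a \<bullet> R.tau a)"
  have slip0: "(LINT a:{0..1}|lborel. ?slip a) = 0"
    by (rule R.tangential_slip[OF _ cw dU cU' kin _ _ dh])
      (use Xta[of t] ends in \<open>auto simp: Xat_def intro!: continuous_intros sec[OF cg(2) t] cq R.cont\<close>)
  have main': "?main a = ?main' a" if "a \<in> {0..1}" for a
    using R.sdvg_eq[OF that u1 dU] unfolding c'_Xa(2) by (simp only: distrib_right mult.assoc)
  have split: "ft t a = ?main' a + ?slip a" if a: "a \<in> {0..1}" for a
  proof -
    have e1: "(Xa t a \<bullet> Xat t a) / norm (Xa t a) = Xat t a \<bullet> R.tau a"
      by (simp add: R.tau_eq c'_Xa inner_commute)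
    \<comment> \<open>The two velocities have the same normal component, so only the tangential
      derivative of the concentration meets their difference.\<close>
    have e2: "grad (\<Gamma> t) (X t a) \<bullet> Xt t a = grad (\<Gamma> t) (X t a) \<bullet> u t (X t a) + R.q (\<Gamma> t) a * ((Xt t a - u t (X t a)) \<bullet> R.tau a)"
    proof -
      have "grad (\<Gamma> t) (X t a) \<bullet> (Xt t a - u t (X t a)) = R.q (\<Gamma> t) a * ((Xt t a - u t (X t a)) \<bullet> R.tau a)"
        using R.frame(2)[OF a, of "grad (\<Gamma> t) (X t a)" "Xt t a - u t (X t a)"] kin[OF a]
        by (simp add: R.q_def inner_diff_left)
      then show ?thesis by (simp add: inner_diff_right)
    qed
    show ?thesis
      unfolding ft_def material_derivative_def c'_Xa(2) e1 e2
      by (simp add: inner_diff_left inner_commute[of "u t (X t a)"] algebra_simps)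
  qed
  have cmain: "continuous_on {0..1} ?main'"
  proof -
    have "continuous_on {0..1} (\<lambda>a. material_derivative u \<Gamma> t (X t a))"
      unfolding material_derivative_def inner_vec2 dt_def
      by (intro continuous_intros R.cont
          continuous_on_compose2[OF Ck_imp_continuous_on[OF Ck_slice[OF Ck_joint_derivs(2)[OF G2]], of UNIV]]
          continuous_on_compose2[OF Ck_imp_continuous_on[OF Ck_grad_nth[OF G1], of UNIV]]
          continuous_on_compose2[OF Ck_imp_continuous_on[OF u1, of UNIV]]) auto
    then show ?thesis
      by (intro continuous_intros sec[OF cg(1) t] sec[OF cg(2) t] R.cont R.cont_tau cU')
  qed
  have cslip: "continuous_on {0..1} ?slip"
    by (intro continuous_intros sec[OF cg(1) t] sec[OF cg(2) t] cq R.cont R.cont_tau cU' continuous_on_subset[OF cw]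
        Ck_imp_continuous_on[OF kU] Ck_imp_continuous_on[OF Ck_slice[OF CXt]]) auto
  have "integral {0..1} (ft t) = (LINT a:{0..1}|lborel. ft t a)"
    using cft sec[of ft, OF _ t] by (intro set_integral_Icc_eq_integral[symmetric]) (simp add: split_def)
  also have "\<dots> = (LINT a:{0..1}|lborel. ?main' a + ?slip a)"
    by (rule set_lebesgue_integral_cong) (simp, intro allI impI, erule split)
  also have "\<dots> = (LINT a:{0..1}|lborel. ?main' a)"
    using slip0 by (subst set_integral_add(2)[OF R.set_int[OF cmain] R.set_int[OF cslip]]) simp
  also have "\<dots> = (LINT a:{0..1}|lborel. ?main a)"
    by (rule set_lebesgue_integral_cong) (simp, intro allI impI, erule main'[symmetric])
  finally have 2: "integral {0..1} (ft t) = arc_integral (X t) (\<lambda>a. g' (\<Gamma> t (X t a)) * material_derivative u \<Gamma> t (X t a)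
        + g (\<Gamma> t (X t a)) * sdvg (normal (X t) a) (u t) (X t a))"
    unfolding arc_integral_eq .
  show ?thesis
    using 1 unfolding 2 by (rule has_field_derivative_transform_within[of _ _ _ _ 1]) (use t ai in auto)
qed

end

lemma grad_add: "Ck (Suc 0) f \<Longrightarrow> Ck (Suc 0) g \<Longrightarrow> grad (\<lambda>x. f x + g x) x = grad f x + grad g x"
  by (rule grad_eqI, rule has_derivative_eq_rhs[OF has_derivative_add[OF Ck_has_derivative_grad Ck_has_derivative_grad]])
    (auto simp: inner_add_left)

lemma grad_mult: "Ck (Suc 0) f \<Longrightarrow> Ck (Suc 0) g \<Longrightarrow> grad (\<lambda>x. f x * g x) x = f x *\<^sub>R grad g x + g x *\<^sub>R grad f x"
  by (rule grad_eqI, rule has_derivative_eq_rhs[OF has_derivative_mult[OF Ck_has_derivative_grad Ck_has_derivative_grad]])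
    (auto simp: inner_add_left fun_eq_iff)

lemma grad_cmult: "Ck (Suc 0) f \<Longrightarrow> grad (\<lambda>x. k * f x) x = k *\<^sub>R grad f x"
  by (rule grad_eqI, rule has_derivative_eq_rhs[OF has_derivative_mult_right[OF Ck_has_derivative_grad]])
    (auto simp: fun_eq_iff)

lemma grad_chain:
  assumes "Ck (Suc 0) f" "(g has_real_derivative g') (at (f x))"
  shows "grad (\<lambda>x. g (f x)) x = g' *\<^sub>R grad f x"
  using has_derivative_compose[OF Ck_has_derivative_grad[OF assms(1)] assms(2)[unfolded has_field_derivative_def]]
  by (intro grad_eqI) simp

lemma Ck_vec2I: "(\<And>i. Ck k (\<lambda>x. f x $ i)) \<Longrightarrow> Ck k f" for f :: "'a::euclidean_space \<Rightarrow> real^2"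
  by (rule Ck_componentwise) (auto simp: Basis_vec2 inner_axis)

lemma set_integral_minus: "(LINT x:A|M. - f x) = - (LINT x:A|M. f x)" for f :: "'a \<Rightarrow> real"
  by (simp add: set_lebesgue_integral_def)

section \<open>Solutions of the droplet system\<close>

locale flow_solution =
  fixes P :: params and F :: flow and T :: real
  assumes adm: "admissible P" and Tpos: "T > 0" and sol: "smooth_solution P F T"
    and Phi_pos: "\<And>t x. t \<in> {0..T} \<Longrightarrow> x \<in> closure (Omega P F 1 t) \<Longrightarrow> Phi F t x > 0"
    and Gam_range: "\<And>t x. t \<in> {0..T} \<Longrightarrow> x \<in> Sigma_int F t \<Longrightarrow> 0 < Gam F t x \<and> Gam F t x < 1"
begin

lemma smooth:
  "i \<in> {1, 2} \<Longrightarrow> Ck 2 (\<lambda>(t, x). vel F i t x)" "i \<in> {1, 2} \<Longrightarrow> Ck (Suc 0) (\<lambda>(t, x). pres F i t x)"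
  "Ck 2 (\<lambda>(t, a). X F t a)" "Ck 2 (\<lambda>(t, x). Phi F t x)" "Ck 2 (\<lambda>(t, x). Gam F t x)"
  using sol unfolding smooth_solution_def smooth_fields_def One_nat_def by auto

lemma at_time:
  assumes "t \<in> {0..T}"
  shows "geometry P F t" "fluid_eqs P F t" "interface_conditions P F t" "boundary_conditions P F t"
    "contact_conditions P F t" "surfactant_eqs P F t"
  using sol assms unfolding smooth_solution_def by auto

lemma positive: "0 < Lx P" "0 < Ly P" "0 < Rey P" "0 < Ca P" "0 < ls P" "0 < Da P" "0 < El P" "0 < Pe_Phi P"
  "0 < Pe_Gamma P" "0 < lam P" "0 < We P"
  using adm by (auto simp: admissible_def We_def)

sublocale moving_surface "X F" T "Lx P" "Ly P"
proof (intro moving_surface.intro moving_drop.intro moving_surface_axioms.intro)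
  show "Ck 2 (\<lambda>(t, a). X F t a)" "0 < T" using smooth(3) Tpos by auto
  fix t assume t: "t \<in> {0..T}"
  have X: "Ck (Suc (Suc 0)) (X F t)" using Ck_slice[OF smooth(3)] by (simp add: numeral_2_eq_2)
  note g = at_time(1)[OF t, unfolded geometry_def x_l_def x_r_def]
  have box: "X F t a \<in> box (pt (- Lx P) 0) (pt (Lx P) (Ly P))" if "a \<in> {0<..<1}" for a using g that by blast
  show "drop_in_box (X F t) (\<lambda>a. vector_derivative (X F t) (at a)) (Lx P) (Ly P)"
  proof
    show "(X F t has_vector_derivative vector_derivative (X F t) (at a)) (at a)" for a
      by (rule Ck_has_vector_derivative[OF X])
    show "continuous_on UNIV (\<lambda>a. vector_derivative (X F t) (at a))"
      using Ck_imp_continuous_on[OF Ck_vector_derivative[OF X]] .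
    show "0 < X F t a $ 2" if "a \<in> {0<..<1}" for a
      using box[OF that] by (auto simp: box_def Basis_vec2 inner_axis)
  qed (use g box positive in auto)
  show "vector_derivative (X F t) (at a) \<noteq> 0" if "a \<in> {0..1}" for a using g that by blast
qed

lemma Omega1: "t \<in> {0..T} \<Longrightarrow> Omega P F 1 t = D1 t"
proof -
  assume t: "t \<in> {0..T}"
  interpret drop_in_box "X F t" "Xa t" "Lx P" "Ly P" by (rule drop'[OF t])
  show ?thesis by (simp add: Omega_def Let_def Sigma_int_def x_l_def x_r_def D_def bnd_def)
qed

lemma Omega2: "t \<in> {0..T} \<Longrightarrow> Omega P F 2 t = D2 t"
proof -
  assume t: "t \<in> {0..T}"
  interpret drop_in_box "X F t" "Xa t" "Lx P" "Ly P" by (rule drop'[OF t])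
  show ?thesis by (simp add: Omega_def Let_def Sigma_int_def x_l_def x_r_def D_def bnd_def Out_def)
qed

lemma vel_Suc: "i \<in> {1, 2} \<Longrightarrow> Ck (Suc (Suc 0)) (\<lambda>(t, x). vel F i t x)"
  using smooth(1) by (simp add: numeral_2_eq_2)

lemma vel_slice: "i \<in> {1, 2} \<Longrightarrow> Ck (Suc (Suc 0)) (vel F i t)" "i \<in> {1, 2} \<Longrightarrow> Ck (Suc 0) (vel F i t)"
  by (rule Ck_slice[OF vel_Suc], assumption, rule Ck_Suc_imp[OF Ck_slice[OF vel_Suc]], assumption)

lemma N_eq: "N t a = norm (Xa t a) *\<^sub>R normal (X F t) a"
proof -
  \<comment> \<open>Valid for v = 0 as well, where 1 / 0 is 0; so the formula holds for every
    parameter.\<close>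
  have "norm v *\<^sub>R ((1 / norm v) *\<^sub>R v) = v" for v :: "real^2" by simp
  from this[of "Xa t a"] have "norm (Xa t a) *\<^sub>R tangent (X F t) a = Xa t a"
    unfolding tangent_def d_arc_def Xa_def[symmetric] .
  from arg_cong[OF this, of "\<lambda>v. v $ i" for i]
  have "norm (Xa t a) * tangent (X F t) a $ i = Xa t a $ i" for i by (simp only: vector_scaleR_component real_scaleR_def)
  then show ?thesis by (simp add: N_def normal_def vec2_eq_iff)
qed

lemma kinematic:
  assumes "t \<in> {0..T}" "a \<in> {0..1}"
  shows "Xt t a \<bullet> normal (X F t) a = vel F 1 t (X F t a) \<bullet> normal (X F t) a"
    and "vel F 2 t (X F t a) = vel F 1 t (X F t a)"
  using at_time(3)[OF assms(1)] assms(2) unfolding interface_conditions_def Let_def Xt_def by auto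

lemma Xt_N: "t \<in> {0..T} \<Longrightarrow> a \<in> {0..1} \<Longrightarrow> Xt t a \<bullet> N t a = vel F 1 t (X F t a) \<bullet> N t a"
  using kinematic(1) by (simp add: N_eq)

lemma x_lr: "x_l F t = X F t 0 $ 1" "x_r F t = X F t 1 $ 1"
  by (simp_all add: x_l_def x_r_def)

lemma wall_vel:
  assumes t: "t \<in> {0..T}" and i: "i \<in> {1, 2}" and x: "x \<in> wall P F i t"
  shows "vel F i t (pt x 0) $ 2 = 0"
    and "sigma_visc P F i t (pt x 0) $ 1 $ 2 * ls P = beta P i * vel F i t (pt x 0) $ 1"
  using at_time(4)[OF t] i x unfolding boundary_conditions_def
  by (auto simp: n_w_def t_w_def inner_vec2 matrix_vector_mult_def sum_2 mult.commute)

text \<open>The contact conditions give the horizontal component. The vertical one vanishes for the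
  fluid because the wall condition, imposed on the open wetted segment, extends to its ends by
  continuity, and for \<open>Xt\<close> by \<open>Xt_wall\<close>.\<close>

lemma contact_velocity:
  assumes t: "t \<in> {0..T}" and a: "a = 0 \<or> a = 1"
  shows "Xt t a = vel F 1 t (X F t a)"
proof -
  interpret drop_in_box "X F t" "Xa t" "Lx P" "Ly P" by (rule drop'[OF t])
  have c: "continuous_on (closure {x_l F t<..<x_r F t}) (\<lambda>x. vel F 1 t (pt x 0) $ 2)"
    by (intro continuous_intros continuous_on_compose2[OF Ck_imp_continuous_on[OF vel_slice(2), of 1 UNIV]]) auto
  have lt: "x_l F t < x_r F t" using ends(3) by (simp add: x_lr)
  have "vel F 1 t (pt x 0) $ 2 = 0" if "x \<in> closure {x_l F t<..<x_r F t}" for x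
    using continuous_constant_on_closure[OF c _ that, of 0] wall_vel(1)[OF t, of 1] by (simp add: wall_def)
  then have z: "vel F 1 t (pt (x_l F t) 0) $ 2 = 0" "vel F 1 t (pt (x_r F t) 0) $ 2 = 0"
    using lt by auto
  have p: "pt (x_l F t) 0 = X F t 0" "pt (x_r F t) 0 = X F t 1"
    using ends by (auto simp: x_lr vec2_eq_iff)
  have d: "deriv (\<lambda>t. X F t b $ 1) t = Xt t b $ 1" for b
    by (rule DERIV_imp_deriv[OF vec_nth_deriv[OF X_derivs(2)]])
  have "deriv (x_l F) t = Xt t 0 $ 1" "deriv (x_r F) t = Xt t 1 $ 1"
    using d[of 0] d[of 1] by (simp_all add: x_l_def[abs_def] x_r_def[abs_def])
  then have "Xt t 0 $ 1 = vel F 1 t (X F t 0) $ 1" "Xt t 1 $ 1 = vel F 1 t (X F t 1) $ 1"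
    using at_time(5)[OF t] by (simp_all add: contact_conditions_def t_w_def inner_vec2)
  then show ?thesis
    using a z Xt_wall[OF t a] unfolding p by (auto simp: vec2_eq_iff)
qed

section \<open>Balance of kinetic energy\<close>

definition ke :: "nat \<Rightarrow> real \<Rightarrow> real^2 \<Rightarrow> real" where
  "ke i t x = (1/2) * rho P i * (norm (vel F i t x))\<^sup>2"

lemma Ck_ke: "i \<in> {1, 2} \<Longrightarrow> Ck 2 (\<lambda>(t, x). ke i t x)"
proof -
  assume i: "i \<in> {1, 2}"
  have v: "Ck 2 (\<lambda>z. vel F i (fst z) (snd z))" using smooth(1)[OF i] by (simp add: split_def)
  show ?thesis unfolding ke_def power2_norm_eq_inner split_def by (intro Ck_intros v)
qed

lemma stress_nth: "i \<in> {1, 2} \<Longrightarrow> stress P F i t x $ k $ l = pres F i t x * mat 1 $ k $ l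
    - eta P i / Rey P * (grad (\<lambda>y. vel F i t y $ k) x $ l + grad (\<lambda>y. vel F i t y $ l) x $ k)"
  by (simp add: stress_def sigma_visc_def transpose_def jacobian_nth[OF vel_slice(2)])

lemma stress_sym: "i \<in> {1, 2} \<Longrightarrow> stress P F i t x $ k $ l = stress P F i t x $ l $ k"
  by (simp add: stress_nth mat_def add.commute)

lemma Ck_stress: "i \<in> {1, 2} \<Longrightarrow> Ck (Suc 0) (\<lambda>x. stress P F i t x $ k $ l)"
proof -
  assume i: "i \<in> {1, 2}"
  have p: "Ck (Suc 0) (pres F i t)" by (rule Ck_slice[OF smooth(2)[OF i]])
  show ?thesis unfolding stress_nth[OF i] by (intro Ck_intros p Ck_grad_nth vel_slice i)
qed

text \<open>The momentum equation carries + div T, so T is a momentum flux, the negative of the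
  usual Cauchy stress; hence the plus sign in front of T u.\<close>

definition flux :: "nat \<Rightarrow> real \<Rightarrow> real^2 \<Rightarrow> real^2" where
  "flux i t x = ke i t x *\<^sub>R vel F i t x + stress P F i t x *v vel F i t x"

lemma flux_nth: "flux i t x $ k = ke i t x * vel F i t x $ k
    + (stress P F i t x $ k $ 1 * vel F i t x $ 1 + stress P F i t x $ k $ 2 * vel F i t x $ 2)"
  by (simp add: flux_def matrix_vector_mult_def sum_2)

lemma Ck_ke_slice: "i \<in> {1, 2} \<Longrightarrow> Ck (Suc 0) (ke i t)"
  using Ck_mono[OF Ck_slice[OF Ck_ke], of i "Suc 0" t] by simp

lemma Ck_flux: "i \<in> {1, 2} \<Longrightarrow> Ck (Suc 0) (flux i t)"
  by (rule Ck_vec2I, unfold flux_nth) (intro Ck_intros Ck_ke_slice Ck_stress vel_slice; assumption)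

text \<open>The momentum equation times u, plus div u = 0 times ke + p. What is left of T : grad u
  is the viscous part, a sum of squares by the symmetry of the stress.\<close>

lemma kinetic_pointwise:
  assumes i: "i \<in> {1, 2}" and t: "t \<in> {0..T}" and x: "x \<in> Omega P F i t"
  shows "dt (ke i) t x + dvg (flux i t) x = - (1 / Rey P * (2 * eta P i * (norm (strain (vel F i t) x))\<^sup>2))"
proof -
  let ?u = "vel F i t" and ?T = "stress P F i t"
  have Cu: "Ck (Suc 0) ?u" by (rule vel_slice(2)[OF i])
  have Cuk: "Ck (Suc 0) (\<lambda>y. ?u y $ k)" for k by (rule Ck_vec_nth[OF Cu])
  \<comment> \<open>Naming the first derivatives of velocity and stress turns the claim into a
    polynomial identity.\<close>
  define J where "J k l = grad (\<lambda>y. ?u y $ k) x $ l" for k l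
  define S where "S k l m = grad (\<lambda>y. ?T y $ k $ l) x $ m" for k l m
  define r where "r = eta P i / Rey P"
  define p where "p = pres F i t x"
  define d where "d = dt (vel F i) t x"
  have jac: "jacobian ?u (at x) $ k $ l = J k l" for k l unfolding J_def by (rule jacobian_nth[OF Cu])
  have eqs: "rho P i *\<^sub>R (d + jacobian ?u (at x) *v ?u x) + tensor_dvg ?T x = 0" "dvg ?u x = 0"
    using at_time(2)[OF t] i x unfolding fluid_eqs_def d_def by blast+
  have Ssym: "S 2 1 m = S 1 2 m" for m unfolding S_def stress_sym[OF i, of t _ 2 1] ..
  have "tensor_dvg ?T x $ k = S k 1 1 + S k 2 2" for k
  proof -
    have "Ck (Suc 0) (\<lambda>y. ?T y $ k)" by (rule Ck_vec2I) (rule Ck_stress[OF i])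
    from dvg_eq[OF this, of x] show ?thesis by (simp add: tensor_dvg_def S_def)
  qed
  then have m: "rho P i * (d $ k + (J k 1 * ?u x $ 1 + J k 2 * ?u x $ 2)) + (S k 1 1 + S k 2 2) = 0" for k
    using arg_cong[OF eqs(1), of "\<lambda>v. v $ k"] by (simp add: matrix_vector_mult_def sum_2 jac)
  have dv: "J 1 1 + J 2 2 = 0" using eqs(2) by (simp add: dvg_eq[OF Cu] J_def)
  have T: "?T x $ 1 $ 1 = p - r * (2 * J 1 1)" "?T x $ 2 $ 2 = p - r * (2 * J 2 2)"
    "?T x $ 1 $ 2 = - (r * (J 1 2 + J 2 1))" "?T x $ 2 $ 1 = - (r * (J 1 2 + J 2 1))"
    by (simp_all add: stress_nth[OF i] mat_def J_def r_def p_def add.commute)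
  have dke: "dt (ke i) t x = rho P i * (?u x $ 1 * d $ 1 + ?u x $ 2 * d $ 2)"
  proof -
    have dv: "((\<lambda>s. vel F i s x) has_vector_derivative d) (at t)"
      unfolding d_def dt_def by (rule Ck_joint_derivs(1)[OF vel_Suc[OF i]])
    have "((\<lambda>s. ke i s x) has_real_derivative (1/2 * rho P i) * (?u x \<bullet> d + d \<bullet> ?u x)) (at t)"
      unfolding ke_def power2_norm_eq_inner by (rule DERIV_cmult[OF has_real_derivative_inner[OF dv dv]])
    then show ?thesis
      unfolding dt_def has_real_derivative_iff_has_vector_derivative
      by (simp add: vector_derivative_at inner_vec2 algebra_simps)
  qed
  have gke: "grad (ke i t) x $ l = rho P i * (?u x $ 1 * J 1 l + ?u x $ 2 * J 2 l)" for l
  proof -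
    have "ke i t = (\<lambda>x. (1/2 * rho P i) * (?u x $ 1 * ?u x $ 1 + ?u x $ 2 * ?u x $ 2))"
      by (auto simp: ke_def power2_norm_eq_inner inner_vec2)
    note eq = this
    have "grad (ke i t) x = (1/2 * rho P i) *\<^sub>R ((?u x $ 1 *\<^sub>R grad (\<lambda>y. ?u y $ 1) x + ?u x $ 1 *\<^sub>R grad (\<lambda>y. ?u y $ 1) x)
       + (?u x $ 2 *\<^sub>R grad (\<lambda>y. ?u y $ 2) x + ?u x $ 2 *\<^sub>R grad (\<lambda>y. ?u y $ 2) x))"
      unfolding eq by (simp only: grad_cmult grad_add grad_mult Ck_add Ck_mult Cuk)
    then show ?thesis by (simp add: J_def algebra_simps)
  qed
  have gflux: "grad (\<lambda>y. flux i t y $ k) x $ k = ke i t x * J k k + ?u x $ k * grad (ke i t) x $ k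
     + ((?T x $ k $ 1 * J 1 k + ?u x $ 1 * S k 1 k) + (?T x $ k $ 2 * J 2 k + ?u x $ 2 * S k 2 k))" for k
    unfolding flux_nth
    by (simp add: grad_add grad_mult Ck_add Ck_mult Cuk Ck_ke_slice[OF i] Ck_stress[OF i] J_def S_def)
  have nrm: "(norm (strain ?u x))\<^sup>2 = (J 1 1)\<^sup>2 + (J 2 2)\<^sup>2 + (J 1 2 + J 2 1)\<^sup>2 / 2"
  proof -
    have "strain ?u x $ k $ l = (J k l + J l k) / 2" for k l
      by (simp add: strain_def transpose_def jac)
    note s = this
    have "strain ?u x \<bullet> strain ?u x = (strain ?u x $ 1 $ 1)\<^sup>2 + (strain ?u x $ 1 $ 2)\<^sup>2
        + ((strain ?u x $ 2 $ 1)\<^sup>2 + (strain ?u x $ 2 $ 2)\<^sup>2)"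
      by (simp add: inner_vec_def sum_2 power2_eq_square)
    also have "\<dots> = ((J 1 1 + J 1 1) / 2)\<^sup>2 + ((J 1 2 + J 2 1) / 2)\<^sup>2 + (((J 2 1 + J 1 2) / 2)\<^sup>2 + ((J 2 2 + J 2 2) / 2)\<^sup>2)"
      unfolding s ..
    also have "\<dots> = (J 1 1)\<^sup>2 + (J 2 2)\<^sup>2 + (J 1 2 + J 2 1)\<^sup>2 / 2"
      by (simp add: power2_eq_square field_simps)
    finally show ?thesis unfolding power2_norm_eq_inner .
  qed
  \<comment> \<open>The right side combines the two components of the momentum equation with
    incompressibility, so each of its three summands vanishes.\<close>
  have "dt (ke i) t x + dvg (flux i t) x - (- (2 * r * ((J 1 1)\<^sup>2 + (J 2 2)\<^sup>2 + (J 1 2 + J 2 1)\<^sup>2 / 2)))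
     = ?u x $ 1 * (rho P i * (d $ 1 + (J 1 1 * ?u x $ 1 + J 1 2 * ?u x $ 2)) + (S 1 1 1 + S 1 2 2))
      + ?u x $ 2 * (rho P i * (d $ 2 + (J 2 1 * ?u x $ 1 + J 2 2 * ?u x $ 2)) + (S 2 1 1 + S 2 2 2))
      + (ke i t x + p) * (J 1 1 + J 2 2)"
    unfolding dvg_eq[OF Ck_flux[OF i]] gflux gke dke T Ssym by (simp add: power2_eq_square algebra_simps)
  also have "\<dots> = 0" unfolding m dv by simp
  finally show ?thesis unfolding nrm r_def by (simp add: field_simps)
qed

lemma dissipation_integral:
  assumes i: "i \<in> {1, 2}" and t: "t \<in> {0..T}" and A: "Omega P F i t \<in> sets borel" "bounded (Omega P F i t)"
  shows "(LINT x:Omega P F i t|lborel. dt (ke i) t x) + (LINT x:Omega P F i t|lborel. dvg (flux i t) x)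
     = - (1 / Rey P * (LINT x:Omega P F i t|lborel. 2 * eta P i * (norm (strain (vel F i t) x))\<^sup>2))"
proof -
  have "Ck (Suc 0) (\<lambda>(t, x). dt (ke i) t x)"
    using Ck_joint_derivs(2)[of "Suc 0" "ke i"] Ck_ke[OF i] by (simp add: numeral_2_eq_2 dt_def)
  then have c: "continuous_on UNIV (dt (ke i) t)" using Ck_imp_continuous_on[OF Ck_slice] by blast
  have c': "continuous_on UNIV (dvg (flux i t))" using Ck_imp_continuous_on[OF Ck_dvg[OF Ck_flux[OF i]]] .
  have "(LINT x:Omega P F i t|lborel. dt (ke i) t x) + (LINT x:Omega P F i t|lborel. dvg (flux i t) x)
     = (LINT x:Omega P F i t|lborel. dt (ke i) t x + dvg (flux i t) x)"
    by (intro set_integral_add(2)[symmetric] set_integrable_continuous_box c c' A)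
  also have "\<dots> = (LINT x:Omega P F i t|lborel. - (1 / Rey P * (2 * eta P i * (norm (strain (vel F i t) x))\<^sup>2)))"
    by (rule set_lebesgue_integral_cong) (use A(1) kinetic_pointwise[OF i t] in auto)
  also have "\<dots> = - (1 / Rey P * (LINT x:Omega P F i t|lborel. 2 * eta P i * (norm (strain (vel F i t) x))\<^sup>2))"
    unfolding set_integral_minus by simp
  finally show ?thesis .
qed

text \<open>At the wall the normal velocity is zero, so only the shear stress times the tangential
  velocity remains, and the slip condition makes this a multiple of a square.\<close>

lemma wall_flux:
  assumes t: "t \<in> {0..T}" and i: "i \<in> {1, 2}" and x: "x \<in> wall P F i t"
  shows "flux i t (pt x 0) $ 2 = - (1 / (Rey P * ls P) * (beta P i * \<bar>vel F i t (pt x 0) \<bullet> t_w\<bar>\<^sup>2))"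
proof -
  have "stress P F i t (pt x 0) $ 2 $ 1 = - (1 / Rey P) * sigma_visc P F i t (pt x 0) $ 1 $ 2"
    unfolding stress_sym[OF i, of t _ 2 1] by (simp add: stress_def mat_def)
  also have "sigma_visc P F i t (pt x 0) $ 1 $ 2 = beta P i * vel F i t (pt x 0) $ 1 / ls P"
    using wall_vel(2)[OF assms] positive(5) by (simp add: field_simps)
  finally have s: "stress P F i t (pt x 0) $ 2 $ 1 = - (1 / Rey P) * (beta P i * vel F i t (pt x 0) $ 1 / ls P)" .
  show ?thesis
    unfolding flux_nth wall_vel(1)[OF assms] s by (simp add: t_w_def inner_vec2 power2_eq_square)
qed

text \<open>Power of the stress of fluid \<open>i\<close> at the interface; the velocity is that of
  fluid 1 for both, since the two agree there.\<close>

definition traction :: "nat \<Rightarrow> real \<Rightarrow> real" where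
  "traction i t = (LINT a:{0..1}|lborel. norm (Xa t a) * (vel F 1 t (X F t a) \<bullet> (stress P F i t (X F t a) *v normal (X F t) a)))"

lemma cont_X: "continuous_on A (X F t)" "continuous_on A (Xa t)" "continuous_on A (Xt t)" "continuous_on A (N t)"
proof -
  show x: "continuous_on A (X F t)" "continuous_on A (Xa t)" "continuous_on A (Xt t)"
    using Ck_imp_continuous_on[OF Ck_slice[OF smooth(3)]] Ck_imp_continuous_on[OF Ck_slice[OF CXa]]
      Ck_imp_continuous_on[OF Ck_slice[OF CXt]] by auto
  show "continuous_on A (N t)" unfolding N_def[abs_def] by (intro continuous_intros x)
qed

lemma cont_X_comp: "Ck k f \<Longrightarrow> continuous_on A (\<lambda>a. f (X F t a))" for f :: "real^2 \<Rightarrow> 'b::euclidean_space"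
  by (rule continuous_on_compose2[OF Ck_imp_continuous_on[of k f UNIV] cont_X(1)]) auto

text \<open>The normal velocity of the interface is that of the fluid, so the convective part of the
  flux equals the boundary term of the transport theorem and will cancel it.\<close>

lemma flux_interface:
  assumes t: "t \<in> {0..T}" and i: "i \<in> {1, 2}"
  shows "(LINT a:{0..1}|lborel. flux i t (X F t a) \<bullet> N t a)
    = (LINT a:{0..1}|lborel. ke i t (X F t a) * (Xt t a \<bullet> N t a)) + traction i t"
proof -
  have v: "vel F i t (X F t a) = vel F 1 t (X F t a)" if "a \<in> {0..1}" for a using kinematic(2)[OF t that] i by auto
  let ?w = "\<lambda>a. (stress P F i t (X F t a) *v vel F i t (X F t a)) \<bullet> N t a"
  have eq: "?w a = norm (Xa t a) * (vel F 1 t (X F t a) \<bullet> (stress P F i t (X F t a) *v normal (X F t) a))" if "a \<in> {0..1}" for a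
    unfolding N_eq v[OF that] using stress_sym[OF i, of t "X F t a" 2 1]
    by (simp add: matrix_vector_mult_def sum_2 inner_vec2 algebra_simps)
  have "(LINT a:{0..1}|lborel. flux i t (X F t a) \<bullet> N t a) = (LINT a:{0..1}|lborel. ke i t (X F t a) * (Xt t a \<bullet> N t a) + ?w a)"
    by (rule set_lebesgue_integral_cong) (use Xt_N[OF t] v in \<open>auto simp: flux_def inner_add_left\<close>)
  also have "\<dots> = (LINT a:{0..1}|lborel. ke i t (X F t a) * (Xt t a \<bullet> N t a)) + (LINT a:{0..1}|lborel. ?w a)"
  proof (intro set_integral_add(2) borel_integrable_atLeastAtMost')
    show "continuous_on {0..1} (\<lambda>a. ke i t (X F t a) * (Xt t a \<bullet> N t a))"
      by (intro continuous_intros cont_X cont_X_comp[OF Ck_ke_slice[OF i]])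
    show "continuous_on {0..1} ?w"
      by (simp add: inner_vec2 matrix_vector_mult_def sum_2)
        (intro continuous_intros cont_X cont_X_comp[OF Ck_stress[OF i]] cont_X_comp[OF vel_slice(2)[OF i]])
  qed
  also have "(LINT a:{0..1}|lborel. ?w a) = traction i t"
    unfolding traction_def by (rule set_lebesgue_integral_cong) (simp, intro allI impI, erule eq)
  finally show ?thesis .
qed

lemma kinetic_rate_1:
  assumes t: "t \<in> {0..T}"
  shows "((\<lambda>t. LINT x:Omega P F 1 t|lborel. ke 1 t x) has_real_derivative
     - (1 / Rey P * (LINT x:Omega P F 1 t|lborel. 2 * eta P 1 * (norm (strain (vel F 1 t) x))\<^sup>2))
     - 1 / (Rey P * ls P) * (LINT x:wall P F 1 t|lborel. beta P 1 * \<bar>vel F 1 t (pt x 0) \<bullet> t_w\<bar>\<^sup>2)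
     - traction 1 t) (at t within {0..T})"
proof -
  interpret drop_in_box "X F t" "Xa t" "Lx P" "Ly P" by (rule drop'[OF t])
  have i: "(1::nat) \<in> {1, 2}" by simp
  have cf: "continuous_on UNIV (\<lambda>x. flux 1 t (pt x 0) $ 2)"
    by (intro continuous_intros continuous_on_compose2[OF Ck_imp_continuous_on[OF Ck_flux[OF i], of UNIV]]) auto
  \<comment> \<open>The divergence theorem integrates over the closed segment, the wall conditions
    hold on the open one; the two contact points are a null set.\<close>
  have "(LINT x:{X F t 0 $ 1..X F t 1 $ 1}|lborel. flux 1 t (pt x 0) $ 2) = (LINT x:wall P F 1 t|lborel. flux 1 t (pt x 0) $ 2)"
    by (rule set_integral_null_diff[of "{x_l F t, x_r F t}"])
      (use borel_measurable_continuous_onI[OF cf] in \<open>auto simp: wall_def x_lr finite_imp_null_set_lborel\<close>)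
  also have "\<dots> = (LINT x:wall P F 1 t|lborel. - (1 / (Rey P * ls P) * (beta P 1 * \<bar>vel F 1 t (pt x 0) \<bullet> t_w\<bar>\<^sup>2)))"
    by (rule set_lebesgue_integral_cong) (use wall_flux[OF t i] in \<open>auto simp: wall_def\<close>)
  also have "\<dots> = - (1 / (Rey P * ls P) * (LINT x:wall P F 1 t|lborel. beta P 1 * \<bar>vel F 1 t (pt x 0) \<bullet> t_w\<bar>\<^sup>2))"
    unfolding set_integral_minus by simp
  finally have w: "(LINT x:{X F t 0 $ 1..X F t 1 $ 1}|lborel. flux 1 t (pt x 0) $ 2)
    = - (1 / (Rey P * ls P) * (LINT x:wall P F 1 t|lborel. beta P 1 * \<bar>vel F 1 t (pt x 0) \<bullet> t_w\<bar>\<^sup>2))" .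
  have n: "nrm = N t" by (simp add: nrm_def N_def fun_eq_iff)
  have O: "Omega P F 1 t = D" by (rule Omega1[OF t])
  note dis = dissipation_integral[OF i t, unfolded O, OF D_meas bounded_D]
  have "((\<lambda>t. LINT x:D1 t|lborel. ke 1 t x) has_real_derivative
     - (1 / Rey P * (LINT x:Omega P F 1 t|lborel. 2 * eta P 1 * (norm (strain (vel F 1 t) x))\<^sup>2))
     - 1 / (Rey P * ls P) * (LINT x:wall P F 1 t|lborel. beta P 1 * \<bar>vel F 1 t (pt x 0) \<bullet> t_w\<bar>\<^sup>2)
     - traction 1 t) (at t within {0..T})"
  proof (rule DERIV_cong[OF reynolds_D[OF Ck_ke[OF i] t]])
    show "(LINT x:D|lborel. dt (ke 1) t x) + (LINT a:{0..1}|lborel. ke 1 t (X F t a) * (Xt t a \<bullet> N t a))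
      = - (1 / Rey P * (LINT x:Omega P F 1 t|lborel. 2 * eta P 1 * (norm (strain (vel F 1 t) x))\<^sup>2))
       - 1 / (Rey P * ls P) * (LINT x:wall P F 1 t|lborel. beta P 1 * \<bar>vel F 1 t (pt x 0) \<bullet> t_w\<bar>\<^sup>2) - traction 1 t"
      unfolding O using dis[unfolded divergence_D[OF Ck_flux[OF i]] n w flux_interface[OF t i]] by linarith
  qed
  then show ?thesis by (rule has_field_derivative_transform_within[of _ _ _ _ 1]) (use t Omega1 in auto)
qed

text \<open>The interface normal points into fluid 2, so the traction has the opposite sign to that
  of fluid 1. No-slip removes the flux through the upper wall, and periodicity that through the
  lateral sides.\<close>

lemma kinetic_rate_2:
  assumes t: "t \<in> {0..T}"
  shows "((\<lambda>t. LINT x:Omega P F 2 t|lborel. ke 2 t x) has_real_derivative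
     - (1 / Rey P * (LINT x:Omega P F 2 t|lborel. 2 * eta P 2 * (norm (strain (vel F 2 t) x))\<^sup>2))
     - 1 / (Rey P * ls P) * (LINT x:wall P F 2 t|lborel. beta P 2 * \<bar>vel F 2 t (pt x 0) \<bullet> t_w\<bar>\<^sup>2)
     + traction 2 t) (at t within {0..T})"
proof -
  interpret drop_in_box "X F t" "Xa t" "Lx P" "Ly P" by (rule drop'[OF t])
  have i: "(2::nat) \<in> {1, 2}" by simp
  have W: "wall P F 2 t = {- Lx P..<X F t 0 $ 1} \<union> {X F t 1 $ 1<..Lx P}" by (simp add: wall_def x_lr)
  have "(LINT x:wall P F 2 t|lborel. flux 2 t (pt x 0) $ 2)
     = (LINT x:wall P F 2 t|lborel. - (1 / (Rey P * ls P) * (beta P 2 * \<bar>vel F 2 t (pt x 0) \<bullet> t_w\<bar>\<^sup>2)))"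
    by (rule set_lebesgue_integral_cong) (use wall_flux[OF t i] in \<open>auto simp: wall_def\<close>)
  also have "\<dots> = - (1 / (Rey P * ls P) * (LINT x:wall P F 2 t|lborel. beta P 2 * \<bar>vel F 2 t (pt x 0) \<bullet> t_w\<bar>\<^sup>2))"
    unfolding set_integral_minus by simp
  finally have w: "(LINT x:wall P F 2 t|lborel. flux 2 t (pt x 0) $ 2)
    = - (1 / (Rey P * ls P) * (LINT x:wall P F 2 t|lborel. beta P 2 * \<bar>vel F 2 t (pt x 0) \<bullet> t_w\<bar>\<^sup>2))" .
  note bc = at_time(4)[OF t, unfolded boundary_conditions_def]
  have top: "(LINT x:{- Lx P..Lx P}|lborel. flux 2 t (pt x (Ly P)) $ 2) = (LINT x:{- Lx P..Lx P}|lborel. 0)"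
    by (rule set_lebesgue_integral_cong) (use bc in \<open>auto simp: flux_nth\<close>)
  have lat: "(LINT y:{0..Ly P}|lborel. flux 2 t (pt (Lx P) y) $ 1 - flux 2 t (pt (- Lx P) y) $ 1) = (LINT y:{0..Ly P}|lborel. 0)"
    by (rule set_lebesgue_integral_cong) (use bc in \<open>auto simp: flux_def ke_def\<close>)
  have n: "nrm = N t" by (simp add: nrm_def N_def fun_eq_iff)
  have O: "Omega P F 2 t = Out" by (rule Omega2[OF t])
  note dis = dissipation_integral[OF i t, unfolded O, OF Out_meas Out_bounded]
  have "((\<lambda>t. LINT x:D2 t|lborel. ke 2 t x) has_real_derivative
     - (1 / Rey P * (LINT x:Omega P F 2 t|lborel. 2 * eta P 2 * (norm (strain (vel F 2 t) x))\<^sup>2))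
     - 1 / (Rey P * ls P) * (LINT x:wall P F 2 t|lborel. beta P 2 * \<bar>vel F 2 t (pt x 0) \<bullet> t_w\<bar>\<^sup>2)
     + traction 2 t) (at t within {0..T})"
  proof (rule DERIV_cong[OF reynolds_Out[OF Ck_ke[OF i] t]])
    have z: "(LINT (x::real):A|lborel. 0::real) = 0" for A by (simp add: set_lebesgue_integral_def)
    show "(LINT x:Out|lborel. dt (ke 2) t x) - (LINT a:{0..1}|lborel. ke 2 t (X F t a) * (Xt t a \<bullet> N t a))
      = - (1 / Rey P * (LINT x:Omega P F 2 t|lborel. 2 * eta P 2 * (norm (strain (vel F 2 t) x))\<^sup>2))
       - 1 / (Rey P * ls P) * (LINT x:wall P F 2 t|lborel. beta P 2 * \<bar>vel F 2 t (pt x 0) \<bullet> t_w\<bar>\<^sup>2) + traction 2 t"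
      unfolding O using dis[unfolded divergence_Out[OF Ck_flux[OF i]] n W[symmetric] w top lat z flux_interface[OF t i]] by linarith
  qed
  then show ?thesis by (rule has_field_derivative_transform_within[of _ _ _ _ 1]) (use t Omega2 in auto)
qed

end

section \<open>Balance of surfactant and work of surface tension\<close>

context flow_solution
begin

lemma Phi_Suc: "Ck (Suc (Suc 0)) (\<lambda>(t, x). Phi F t x)" "Ck (Suc (Suc 0)) (Phi F t)" "Ck (Suc 0) (Phi F t)"
proof -
  show 1: "Ck (Suc (Suc 0)) (\<lambda>(t, x). Phi F t x)" using smooth(4) by (simp add: numeral_2_eq_2)
  show 2: "Ck (Suc (Suc 0)) (Phi F t)" by (rule Ck_slice[OF 1])
  show "Ck (Suc 0) (Phi F t)" by (rule Ck_Suc_imp[OF 2])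
qed

definition adsorption :: "real \<Rightarrow> real \<Rightarrow> real" where
  "adsorption t a = S_ads P (Phi F t (X F t a)) (Gam F t (X F t a))"

lemma adsorption_eqs:
  assumes "t \<in> {0..T}" "a \<in> {0..1}"
  shows "material_derivative (vel F 1) (Gam F) t (X F t a) = adsorption t a
      + (1 / Pe_Gamma P) * slaplacian (X F t) (Gam F t) a
      - Gam F t (X F t a) * sdvg (normal (X F t) a) (vel F 1 t) (X F t a)"
    and "normal (X F t) a \<bullet> grad (Phi F t) (X F t a) = - (Pe_Phi P * Da P * adsorption t a)"
proof -
  have e: "material_derivative (vel F 1) (Gam F) t (X F t a)
      + Gam F t (X F t a) * sdvg (normal (X F t) a) (vel F 1 t) (X F t a)
      - (1 / Pe_Gamma P) * slaplacian (X F t) (Gam F t) a = adsorption t a"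
    "(1 / Pe_Phi P) * (normal (X F t) a \<bullet> grad (Phi F t) (X F t a)) = - Da P * adsorption t a"
    using at_time(6)[OF assms(1)] assms(2) unfolding surfactant_eqs_def Let_def adsorption_def by blast+
  show "material_derivative (vel F 1) (Gam F) t (X F t a) = adsorption t a
      + (1 / Pe_Gamma P) * slaplacian (X F t) (Gam F t) a
      - Gam F t (X F t a) * sdvg (normal (X F t) a) (vel F 1 t) (X F t a)"
    using e(1) by linarith
  show "normal (X F t) a \<bullet> grad (Phi F t) (X F t a) = - (Pe_Phi P * Da P * adsorption t a)"
    using e(2) positive(8) by (simp add: field_simps)
qed

lemma cont_adsorption: "continuous_on A (adsorption t)"
proof -
  have "Ck (Suc 0) (Gam F t)" using Ck_mono[OF Ck_slice[OF smooth(5)], where j = "Suc 0"] by simp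
  then show ?thesis
    unfolding adsorption_def[abs_def] S_ads_def by (intro continuous_intros cont_X_comp[OF Phi_Suc(3)] cont_X_comp)
qed

text \<open>Stated for an arbitrary density \<open>fe\<close> of the concentration, with derivative
  \<open>h\<close>, so that free energy and mass are both instances. The bulk equation times
  \<open>h\<close> is a balance law for \<open>fe\<close>, and the flux condition at the interface
  turns diffusive outflow into adsorption.\<close>

lemma bulk_rate:
  assumes fe: "Ck 2 fe" "\<And>c. (fe has_real_derivative h c) (at c)"
    and h: "Ck (Suc 0) h" "\<And>c. (h has_real_derivative h' c) (at c)" and t: "t \<in> {0..T}"
  shows "((\<lambda>t. LINT x:Omega P F 1 t|lborel. fe (Phi F t x)) has_real_derivative
     - (1 / Pe_Phi P * (LINT x:Omega P F 1 t|lborel. h' (Phi F t x) * (norm (grad (Phi F t) x))\<^sup>2))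
     - Da P * arc_integral (X F t) (\<lambda>a. h (Phi F t (X F t a)) * adsorption t a)) (at t within {0..T})"
proof -
  interpret drop_in_box "X F t" "Xa t" "Lx P" "Ly P" by (rule drop'[OF t])
  let ?u = "vel F 1 t" and ?f = "Phi F t"
  have O: "Omega P F 1 t = D" by (rule Omega1[OF t])
  have n: "nrm = N t" by (simp add: nrm_def N_def fun_eq_iff)
  have C\<phi>: "Ck 2 (\<lambda>(t, x). fe (Phi F t x))" using Ck_compose[OF fe(1) smooth(4)] by (simp add: split_def)
  have C\<phi>S: "Ck (Suc (Suc 0)) (\<lambda>(t, x). fe (Phi F t x))" using C\<phi> by (simp add: numeral_2_eq_2)
  have Cfe: "Ck (Suc 0) (\<lambda>x. fe (?f x))" using Ck_mono[OF Ck_slice[OF C\<phi>], of "Suc 0" t] by simp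
  have Ch: "Ck (Suc 0) (\<lambda>x. h (?f x))" by (rule Ck_compose[OF h(1) Phi_Suc(3)])
  have Cg: "Ck (Suc 0) (\<lambda>x. grad ?f x $ k)" for k by (rule Ck_grad_nth[OF Phi_Suc(2)])
  have Cu: "Ck (Suc 0) ?u" by (rule vel_slice(2)) simp
  have Cuk: "Ck (Suc 0) (\<lambda>x. ?u x $ k)" for k by (rule Ck_vec_nth[OF Cu])
  \<comment> \<open>Convective plus diffusive flux of the density \<open>fe\<close>; its divergence
    contains the dissipation with a minus sign.\<close>
  define Z where "Z x = fe (?f x) *\<^sub>R ?u x + (- (1 / Pe_Phi P) * h (?f x)) *\<^sub>R grad ?f x" for x
  have Znth: "Z x $ k = fe (?f x) * ?u x $ k + - (1 / Pe_Phi P) * (h (?f x) * grad ?f x $ k)" for x k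
    by (simp add: Z_def)
  have CZ: "Ck (Suc 0) Z" by (rule Ck_vec2I, unfold Znth) (intro Ck_add Ck_mult Ck_const Cfe Ch Cg Cuk)
  have pointwise: "dt (\<lambda>t x. fe (Phi F t x)) t x + dvg Z x = - (1 / Pe_Phi P * (h' (?f x) * (norm (grad ?f x))\<^sup>2))"
    if x: "x \<in> D" for x
  proof -
    have "((\<lambda>s. Phi F s x) has_real_derivative dt (Phi F) t x) (at t)"
      using Ck_joint_derivs(1)[OF Phi_Suc(1)] by (simp add: has_real_derivative_iff_has_vector_derivative dt_def)
    from DERIV_chain2[OF fe(2) this]
    have dt: "dt (\<lambda>t x. fe (Phi F t x)) t x = h (?f x) * dt (Phi F) t x"
      by (simp add: has_real_derivative_iff_has_vector_derivative dt_def vector_derivative_at)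
    have "Ck (Suc 0) (grad ?f)" by (rule Ck_vec2I) (rule Cg)
    from dvg_eq[OF this, of x]
    have lap: "laplacian ?f x = grad (\<lambda>y. grad ?f y $ 1) x $ 1 + grad (\<lambda>y. grad ?f y $ 2) x $ 2"
      by (simp add: laplacian_def)
    have eq: "dt (Phi F) t x + ?u x \<bullet> grad ?f x - (1 / Pe_Phi P) * laplacian ?f x = 0"
      using at_time(6)[OF t] x unfolding surfactant_eqs_def O by blast
    have div: "grad (\<lambda>y. ?u y $ 1) x $ 1 + grad (\<lambda>y. ?u y $ 2) x $ 2 = 0"
    proof -
      have "dvg ?u x = 0"
        using at_time(2)[OF t] x unfolding fluid_eqs_def O[symmetric] by blast
      then show ?thesis unfolding dvg_eq[OF Cu] .
    qed
    have gZ: "grad (\<lambda>y. Z y $ k) x $ k = fe (?f x) * grad (\<lambda>y. ?u y $ k) x $ k + ?u x $ k * (h (?f x) * grad ?f x $ k)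
       + - (1 / Pe_Phi P) * (h (?f x) * grad (\<lambda>y. grad ?f y $ k) x $ k + grad ?f x $ k * (h' (?f x) * grad ?f x $ k))" for k
      unfolding Znth
      by (simp only: grad_add grad_cmult grad_mult Ck_add Ck_mult Ck_const Cfe Ch Cg Cuk
          grad_chain[OF Phi_Suc(3) fe(2)] grad_chain[OF Phi_Suc(3) h(2)]
          vector_add_component vector_scaleR_component real_scaleR_def)
    have nn: "(norm (grad ?f x))\<^sup>2 = grad ?f x $ 1 * grad ?f x $ 1 + grad ?f x $ 2 * grad ?f x $ 2"
      by (simp only: power2_norm_eq_inner inner_vec2)
    have "dt (\<lambda>t x. fe (Phi F t x)) t x + dvg Z x + 1 / Pe_Phi P * (h' (?f x) * (norm (grad ?f x))\<^sup>2)
       = h (?f x) * (dt (Phi F) t x + ?u x \<bullet> grad ?f x - (1 / Pe_Phi P) * laplacian ?f x)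
       + fe (?f x) * (grad (\<lambda>y. ?u y $ 1) x $ 1 + grad (\<lambda>y. ?u y $ 2) x $ 2)"
      unfolding dt dvg_eq[OF CZ] gZ lap nn inner_vec2 by (simp add: algebra_simps)
    then show ?thesis unfolding eq div by simp
  qed
  have cdt: "continuous_on UNIV (dt (\<lambda>t x. fe (Phi F t x)) t)"
    unfolding dt_def by (rule Ck_imp_continuous_on[OF Ck_slice[OF Ck_joint_derivs(2)[OF C\<phi>S]]])
  have "(LINT x:D|lborel. dt (\<lambda>t x. fe (Phi F t x)) t x) + (LINT x:D|lborel. dvg Z x)
     = (LINT x:D|lborel. dt (\<lambda>t x. fe (Phi F t x)) t x + dvg Z x)"
    by (intro set_integral_add'[symmetric] cdt Ck_imp_continuous_on[OF Ck_dvg[OF CZ]] D_meas bounded_D)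
  also have "\<dots> = (LINT x:D|lborel. - (1 / Pe_Phi P * (h' (?f x) * (norm (grad ?f x))\<^sup>2)))"
    by (rule set_lebesgue_integral_cong) (use D_meas pointwise in auto)
  also have "\<dots> = - (1 / Pe_Phi P * (LINT x:D|lborel. h' (?f x) * (norm (grad ?f x))\<^sup>2))"
    unfolding set_integral_minus by simp
  finally have 1: "(LINT x:D|lborel. dt (\<lambda>t x. fe (Phi F t x)) t x) + (LINT x:D|lborel. dvg Z x)
     = - (1 / Pe_Phi P * (LINT x:D|lborel. h' (?f x) * (norm (grad ?f x))\<^sup>2))" .
  have Zw: "Z (pt x 0) $ 2 = 0" if "x \<in> wall P F 1 t" for x
  proof -
    have "grad ?f (pt x 0) $ 2 = 0"
      using at_time(6)[OF t] that unfolding surfactant_eqs_def by (auto simp: n_w_def inner_vec2)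
    then show ?thesis using wall_vel(1)[OF t _ that] by (simp add: Znth)
  qed
  have cZ: "continuous_on UNIV (\<lambda>x. Z (pt x 0) $ 2)"
    by (intro continuous_intros continuous_on_compose2[OF Ck_imp_continuous_on[OF CZ, of UNIV]]) auto
  have "(LINT x:{X F t 0 $ 1..X F t 1 $ 1}|lborel. Z (pt x 0) $ 2) = (LINT x:wall P F 1 t|lborel. Z (pt x 0) $ 2)"
    by (rule set_integral_null_diff[of "{x_l F t, x_r F t}"])
      (use borel_measurable_continuous_onI[OF cZ] in \<open>auto simp: wall_def x_lr finite_imp_null_set_lborel\<close>)
  also have "\<dots> = (LINT x:wall P F 1 t|lborel. 0)"
    by (rule set_lebesgue_integral_cong) (use Zw in \<open>auto simp: wall_def\<close>)
  finally have 2: "(LINT x:{X F t 0 $ 1..X F t 1 $ 1}|lborel. Z (pt x 0) $ 2) = 0"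
    by (simp add: set_lebesgue_integral_def)
  have ZN: "Z (X F t a) \<bullet> N t a = fe (?f (X F t a)) * (Xt t a \<bullet> N t a) + Da P * (h (?f (X F t a)) * adsorption t a * norm (Xa t a))"
    if a: "a \<in> {0..1}" for a
  proof -
    have "grad ?f (X F t a) \<bullet> N t a = - (Pe_Phi P * Da P * adsorption t a * norm (Xa t a))"
      using adsorption_eqs(2)[OF t a] by (simp add: N_eq inner_commute)
    then show ?thesis
      unfolding Z_def inner_add_left inner_scaleR_left Xt_N[OF t a] using positive(8) by simp
  qed
  have "(LINT a:{0..1}|lborel. Z (X F t a) \<bullet> N t a)
     = (LINT a:{0..1}|lborel. fe (?f (X F t a)) * (Xt t a \<bullet> N t a) + Da P * (h (?f (X F t a)) * adsorption t a * norm (Xa t a)))"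
    by (rule set_lebesgue_integral_cong) (simp, intro allI impI, erule ZN)
  also have "\<dots> = (LINT a:{0..1}|lborel. fe (?f (X F t a)) * (Xt t a \<bullet> N t a))
     + (LINT a:{0..1}|lborel. Da P * (h (?f (X F t a)) * adsorption t a * norm (Xa t a)))"
    by (intro set_integral_add(2) borel_integrable_atLeastAtMost' continuous_intros
        cont_X cont_adsorption cont_X_comp[OF Cfe] cont_X_comp[OF Ch])
  also have "(LINT a:{0..1}|lborel. Da P * (h (?f (X F t a)) * adsorption t a * norm (Xa t a)))
     = Da P * arc_integral (X F t) (\<lambda>a. h (?f (X F t a)) * adsorption t a)"
    unfolding arc_integral_eq by simp
  finally have 3: "(LINT a:{0..1}|lborel. Z (X F t a) \<bullet> N t a) = (LINT a:{0..1}|lborel. fe (?f (X F t a)) * (Xt t a \<bullet> N t a))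
     + Da P * arc_integral (X F t) (\<lambda>a. h (?f (X F t a)) * adsorption t a)" .
  have "((\<lambda>t. LINT x:D1 t|lborel. fe (Phi F t x)) has_real_derivative
     - (1 / Pe_Phi P * (LINT x:Omega P F 1 t|lborel. h' (Phi F t x) * (norm (grad (Phi F t) x))\<^sup>2))
     - Da P * arc_integral (X F t) (\<lambda>a. h (Phi F t (X F t a)) * adsorption t a)) (at t within {0..T})"
  proof (rule DERIV_cong[OF reynolds_D[OF C\<phi> t]])
    show "(LINT x:D|lborel. dt (\<lambda>t x. fe (Phi F t x)) t x) + (LINT a:{0..1}|lborel. fe (?f (X F t a)) * (Xt t a \<bullet> N t a))
      = - (1 / Pe_Phi P * (LINT x:Omega P F 1 t|lborel. h' (Phi F t x) * (norm (grad (Phi F t) x))\<^sup>2))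
        - Da P * arc_integral (X F t) (\<lambda>a. h (Phi F t (X F t a)) * adsorption t a)"
      unfolding O using 1[unfolded divergence_D[OF CZ] n 2 3] by linarith
  qed
  then show ?thesis by (rule has_field_derivative_transform_within[of _ _ _ _ 1]) (use t Omega1 in auto)
qed

lemma Gam_curve: "t \<in> {0..T} \<Longrightarrow> a \<in> {0..1} \<Longrightarrow> Gam F t (X F t a) \<in> {0<..<1}"
  using Gam_range by (auto simp: Sigma_int_def)

text \<open>Also for an arbitrary density \<open>g\<close>. When the transport equation is inserted
  into \<open>surface_rate\<close>, its dilution term contributes -Gamma g' div_s u, which joins the
  stretching term g div_s u; diffusion is integrated by parts.\<close>

lemma surface_law:
  assumes g: "\<And>y. y \<in> {0<..<1} \<Longrightarrow> (g has_real_derivative g' y) (at y)"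
    and g': "\<And>y. y \<in> {0<..<1} \<Longrightarrow> (g' has_real_derivative g'' y) (at y)" "continuous_on {0<..<1} g''"
    and t: "t \<in> {0..T}"
  shows "((\<lambda>t. arc_integral (X F t) (\<lambda>a. g (Gam F t (X F t a)))) has_real_derivative
     arc_integral (X F t) (\<lambda>a. g' (Gam F t (X F t a)) * adsorption t a)
     - 1 / Pe_Gamma P * arc_integral (X F t) (\<lambda>a. g'' (Gam F t (X F t a)) * (norm (sgrad (normal (X F t) a) (Gam F t) (X F t a)))\<^sup>2)
     + arc_integral (X F t) (\<lambda>a. (g (Gam F t (X F t a)) - Gam F t (X F t a) * g' (Gam F t (X F t a)))
         * sdvg (normal (X F t) a) (vel F 1 t) (X F t a))) (at t within {0..T})"
proof -
  interpret R: regular_curve "X F t" by (rule curve[OF t])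
  let ?G = "\<lambda>a. Gam F t (X F t a)"
  let ?sd = "\<lambda>a. sdvg (normal (X F t) a) (vel F 1 t) (X F t a)"
  let ?sl = "\<lambda>a. slaplacian (X F t) (Gam F t) a"
  have CG: "Ck 2 (Gam F t)" by (rule Ck_slice[OF smooth(5)])
  have CG1: "Ck (Suc 0) (Gam F t)" using Ck_mono[OF CG, of "Suc 0"] by simp
  have Cu: "Ck (Suc 0) (vel F 1 t)" by (rule vel_slice(2)) simp
  have nu: "R.nu a = norm (Xa t a)" for a by (simp add: R.nu_def R.c'_def Xa_def)
  have cg': "continuous_on {0<..<1} g'" using g'(1) by (meson DERIV_isCont continuous_at_imp_continuous_on)
  have cg: "continuous_on {0<..<1} g" using g by (meson DERIV_isCont continuous_at_imp_continuous_on)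
  have cG: "continuous_on {0..1} ?G" by (rule cont_X_comp[OF CG1])
  have cgG: "continuous_on {0..1} (\<lambda>a. g (?G a))" "continuous_on {0..1} (\<lambda>a. g' (?G a))"
    by (rule continuous_on_compose2[OF cg cG], use Gam_curve[OF t] in blast,
        rule continuous_on_compose2[OF cg' cG], use Gam_curve[OF t] in blast)
  have rate: "((\<lambda>t. arc_integral (X F t) (\<lambda>a. g (Gam F t (X F t a)))) has_real_derivative
     arc_integral (X F t) (\<lambda>a. g' (?G a) * material_derivative (vel F 1) (Gam F) t (X F t a) + g (?G a) * ?sd a)) (at t within {0..T})"
    by (rule surface_rate[OF smooth(5) smooth(1) Gam_curve g cg' t kinematic(1)[OF t] contact_velocity[OF t] contact_velocity[OF t]]) auto
  define U' where "U' a = vector_derivative (\<lambda>a. vel F 1 t (X F t a)) (at a)" for a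
  have kU: "Ck (Suc 0) (\<lambda>a. vel F 1 t (X F t a))" using Ck_compose[OF Cu Ck_mono[OF R.C2, of "Suc 0"]] by simp
  have dU: "((\<lambda>a. vel F 1 t (X F t a)) has_vector_derivative U' a) (at a)" for a
    unfolding U'_def by (rule Ck_has_vector_derivative[OF kU])
  have cU': "continuous_on A U'" for A
    using Ck_imp_continuous_on[OF Ck_vector_derivative[OF kU]] by (simp add: U'_def[abs_def])
  have sd: "?sd a * norm (Xa t a) = U' a \<bullet> R.tau a" if "a \<in> {0..1}" for a
    using R.sdvg_eq[OF that Cu dU] by (simp add: nu)
  obtain q' where q': "\<And>a. a \<in> {0..1} \<Longrightarrow> (R.q (Gam F t) has_real_derivative q' a) (at a)" "continuous_on {0..1} q'"
    "\<And>a. a \<in> {0..1} \<Longrightarrow> ?sl a * R.nu a = q' a"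
    using R.q_deriv[OF CG] by blast
  have sl: "?sl a * norm (Xa t a) = q' a" if "a \<in> {0..1}" for a using q'(3)[OF that] by (simp add: nu)
  have ends: "R.q (Gam F t) a = 0" if "a \<in> {0, 1}" for a
  proof -
    have a: "a \<in> {0..1}" using that by auto
    have "tangent (X F t) a \<bullet> sgrad (normal (X F t) a) (Gam F t) (X F t a) = 0"
      using at_time(6)[OF t] that unfolding surfactant_eqs_def by blast
    then show ?thesis using R.tau_unit[OF a] by (simp add: R.sgrad_eq[OF a] R.q_def)
  qed
  have diff: "(LINT a:{0..1}|lborel. g' (?G a) * (?sl a * R.nu a)) = - (LINT a:{0..1}|lborel. g'' (?G a) * (R.q (Gam F t) a)\<^sup>2 * R.nu a)"
    by (rule R.surface_diffusion[OF CG Gam_curve[OF t] g']) (use ends in auto)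
  have nsq: "(norm (sgrad (normal (X F t) a) (Gam F t) (X F t a)))\<^sup>2 = (R.q (Gam F t) a)\<^sup>2" if "a \<in> {0..1}" for a
  proof -
    have "norm (R.tau a) = 1" using R.tau_unit[OF that] by (simp add: norm_eq_sqrt_inner)
    then show ?thesis by (simp add: R.sgrad_eq[OF that] R.q_def)
  qed
  have A: "arc_integral (X F t) (\<lambda>a. g'' (?G a) * (norm (sgrad (normal (X F t) a) (Gam F t) (X F t a)))\<^sup>2)
     = (LINT a:{0..1}|lborel. g'' (?G a) * (R.q (Gam F t) a)\<^sup>2 * R.nu a)"
    unfolding arc_integral_eq by (rule set_lebesgue_integral_cong) (auto simp: nsq nu)
  have B: "arc_integral (X F t) (\<lambda>a. (g (?G a) - ?G a * g' (?G a)) * ?sd a)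
     = (LINT a:{0..1}|lborel. (g (?G a) - ?G a * g' (?G a)) * (U' a \<bullet> R.tau a))"
    unfolding arc_integral_eq mult.assoc by (rule set_lebesgue_integral_cong) (simp, intro allI impI, simp only: sd)
  have C: "(LINT a:{0..1}|lborel. g' (?G a) * (?sl a * R.nu a)) = (LINT a:{0..1}|lborel. g' (?G a) * q' a)"
    by (rule set_lebesgue_integral_cong) (auto simp: q'(3))
  have "arc_integral (X F t) (\<lambda>a. g' (?G a) * material_derivative (vel F 1) (Gam F) t (X F t a) + g (?G a) * ?sd a)
     = (LINT a:{0..1}|lborel. (g' (?G a) * adsorption t a * norm (Xa t a) + 1 / Pe_Gamma P * (g' (?G a) * q' a))
         + (g (?G a) - ?G a * g' (?G a)) * (U' a \<bullet> R.tau a))"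
    unfolding arc_integral_eq
  proof (rule set_lebesgue_integral_cong, simp, intro allI impI)
    fix a :: real assume a: "a \<in> {0..1}"
    show "(g' (?G a) * material_derivative (vel F 1) (Gam F) t (X F t a) + g (?G a) * ?sd a) * norm (Xa t a)
      = (g' (?G a) * adsorption t a * norm (Xa t a) + 1 / Pe_Gamma P * (g' (?G a) * q' a))
         + (g (?G a) - ?G a * g' (?G a)) * (U' a \<bullet> R.tau a)"
      unfolding adsorption_eqs(1)[OF t a] sd[OF a, symmetric] sl[OF a, symmetric] by (simp add: algebra_simps)
  qed
  also have "\<dots> = ((LINT a:{0..1}|lborel. g' (?G a) * adsorption t a * norm (Xa t a)) + (LINT a:{0..1}|lborel. 1 / Pe_Gamma P * (g' (?G a) * q' a)))
     + (LINT a:{0..1}|lborel. (g (?G a) - ?G a * g' (?G a)) * (U' a \<bullet> R.tau a))"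
  proof -
    have s1: "set_integrable lborel {0..1} (\<lambda>a. g' (?G a) * adsorption t a * norm (Xa t a))"
      and s2: "set_integrable lborel {0..1} (\<lambda>a. 1 / Pe_Gamma P * (g' (?G a) * q' a))"
      and s3: "set_integrable lborel {0..1} (\<lambda>a. (g (?G a) - ?G a * g' (?G a)) * (U' a \<bullet> R.tau a))"
      by (intro borel_integrable_atLeastAtMost' continuous_on_mult continuous_on_diff continuous_on_inner
          continuous_on_norm continuous_on_const cgG cG cont_adsorption cont_X q'(2) cU' R.cont_tau)+
    show ?thesis using set_integral_add[OF s1 s2] set_integral_add(2)[OF set_integral_add(1)[OF s1 s2] s3] by simp
  qed
  also have "(LINT a:{0..1}|lborel. 1 / Pe_Gamma P * (g' (?G a) * q' a))
     = - (1 / Pe_Gamma P * arc_integral (X F t) (\<lambda>a. g'' (?G a) * (norm (sgrad (normal (X F t) a) (Gam F t) (X F t a)))\<^sup>2))"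
    unfolding A using diff unfolding C by simp
  finally show ?thesis using rate unfolding B arc_integral_eq[of t "\<lambda>a. g' (?G a) * adsorption t a"] by simp
qed

text \<open>The stress jump condition, multiplied by the velocity, makes the difference of the
  tractions the second integral of \<open>surface_tension_work\<close>. At the contact points the
  velocity is horizontal, so its tangential component is the contact point speed times the cosine of
  the contact angle.\<close>

lemma tension_work:
  assumes t: "t \<in> {0..T}"
  shows "arc_integral (X F t) (\<lambda>a. surface_tension P (Gam F t (X F t a)) * sdvg (normal (X F t) a) (vel F 1 t) (X F t a))
     + We P * (traction 2 t - traction 1 t)
     = surface_tension P (Gam F t (X F t 1)) * (deriv (x_r F) t * cos (theta_r F t))
       - surface_tension P (Gam F t (X F t 0)) * (deriv (x_l F) t * cos (theta_l F t))"
proof -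
  interpret R: regular_curve "X F t" by (rule curve[OF t])
  let ?st = "surface_tension P" and ?G = "\<lambda>a. Gam F t (X F t a)" and ?u = "vel F 1 t"
  have nu: "R.nu a = norm (Xa t a)" for a by (simp add: R.nu_def R.c'_def Xa_def)
  have CG: "Ck 2 (Gam F t)" by (rule Ck_slice[OF smooth(5)])
  have Cu: "Ck 2 ?u" by (rule Ck_slice[OF smooth(1)]) simp
  have d: "(?st has_real_derivative - (El P / (1 - y))) (at y)" if "y \<in> {0<..<1}" for y
    unfolding surface_tension_def[abs_def] using that by (auto intro!: derivative_eq_intros simp: field_simps)
  have c: "continuous_on {0<..<1} (\<lambda>y. - (El P / (1 - y)))" by (auto intro!: continuous_intros)
  note work = R.surface_tension_work[OF CG Cu Gam_curve[OF t] d c]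
  have "We P * (traction 2 t - traction 1 t)
     = (LINT a:{0..1}|lborel. We P * (norm (Xa t a) * (?u (X F t a) \<bullet> (stress P F 2 t (X F t a) *v normal (X F t) a))
         - norm (Xa t a) * (?u (X F t a) \<bullet> (stress P F 1 t (X F t a) *v normal (X F t) a))))"
  proof -
    have s: "set_integrable lborel {0..1} (\<lambda>a. norm (Xa t a) * (?u (X F t a) \<bullet> (stress P F i t (X F t a) *v normal (X F t) a)))"
      if i: "i \<in> {1, 2}" for i
    proof (rule borel_integrable_atLeastAtMost')
      have "continuous_on {0..1} (\<lambda>a. ?u (X F t a))" by (rule cont_X_comp[OF Cu])
      then show "continuous_on {0..1} (\<lambda>a. norm (Xa t a) * (?u (X F t a) \<bullet> (stress P F i t (X F t a) *v normal (X F t) a)))"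
        by (simp add: inner_vec2 matrix_vector_mult_def sum_2)
          (intro continuous_intros cont_X cont_X_comp[OF Ck_stress[OF i]] R.cont_tau)
    qed
    show ?thesis unfolding traction_def using set_integral_diff(2)[OF s s, of 2 1] by simp
  qed
  also have "\<dots> = (LINT a:{0..1}|lborel. R.nu a * (?u (X F t a) \<bullet> (- (?st (?G a) * curvature (X F t) a) *\<^sub>R normal (X F t) a
       + sgrad (normal (X F t) a) (\<lambda>y. ?st (Gam F t y)) (X F t a))))"
  proof (rule set_lebesgue_integral_cong, simp, intro allI impI)
    fix a :: real assume a: "a \<in> {0..1}"
    have "We P *\<^sub>R ((stress P F 2 t (X F t a) - stress P F 1 t (X F t a)) *v normal (X F t) a)
      = - (?st (?G a) * curvature (X F t) a) *\<^sub>R normal (X F t) a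
        + sgrad (normal (X F t) a) (\<lambda>y. ?st (Gam F t y)) (X F t a)"
      using at_time(3)[OF t] a unfolding interface_conditions_def Let_def by blast
    from arg_cong[OF this, of "\<lambda>v. R.nu a * (?u (X F t a) \<bullet> v)"]
    show "We P * (norm (Xa t a) * (?u (X F t a) \<bullet> (stress P F 2 t (X F t a) *v normal (X F t) a))
         - norm (Xa t a) * (?u (X F t a) \<bullet> (stress P F 1 t (X F t a) *v normal (X F t) a)))
       = R.nu a * (?u (X F t a) \<bullet> (- (?st (?G a) * curvature (X F t) a) *\<^sub>R normal (X F t) a
       + sgrad (normal (X F t) a) (\<lambda>y. ?st (Gam F t y)) (X F t a)))"
      by (simp only: nu matrix_vector_mult_diff_rdistrib inner_scaleR_right inner_diff_right right_diff_distrib mult.left_commute)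
  qed
  finally have 1: "We P * (traction 2 t - traction 1 t) = (LINT a:{0..1}|lborel. R.nu a * (?u (X F t a) \<bullet> (- (?st (?G a) * curvature (X F t) a) *\<^sub>R normal (X F t) a
       + sgrad (normal (X F t) a) (\<lambda>y. ?st (Gam F t y)) (X F t a))))" .
  have 2: "arc_integral (X F t) (\<lambda>a. ?st (?G a) * sdvg (normal (X F t) a) ?u (X F t a))
     = (LINT a:{0..1}|lborel. ?st (?G a) * (sdvg (normal (X F t) a) ?u (X F t a) * R.nu a))"
    unfolding arc_integral_eq by (simp add: nu mult.assoc)
  \<comment> \<open>The tangent has norm one, so the argument lies in [-1, 1] and \<open>cos\<close>
    undoes \<open>arccos\<close>.\<close>
  have cosine: "cos (arccos (tangent (X F t) a \<bullet> t_w)) = tangent (X F t) a $ 1" if "a \<in> {0..1}" for a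
  proof -
    have "norm (tangent (X F t) a) = 1" using R.tau_unit[OF that] by (simp add: norm_eq_sqrt_inner)
    then have "\<bar>tangent (X F t) a $ 1\<bar> \<le> 1" using component_le_norm_cart[of "tangent (X F t) a" 1] by simp
    then show ?thesis by (simp add: t_w_def inner_vec2 cos_arccos_abs)
  qed
  have dX: "deriv (\<lambda>t. X F t b $ 1) t = Xt t b $ 1" for b
    by (rule DERIV_imp_deriv[OF vec_nth_deriv[OF X_derivs(2)]])
  have ut: "?u (X F t a) \<bullet> tangent (X F t) a = Xt t a $ 1 * tangent (X F t) a $ 1" if "a = 0 \<or> a = 1" for a
    using contact_velocity[OF t that] Xt_wall[OF t that] by (simp add: inner_vec2)
  have "?u (X F t 1) \<bullet> tangent (X F t) 1 = deriv (x_r F) t * cos (theta_r F t)"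
    "?u (X F t 0) \<bullet> tangent (X F t) 0 = deriv (x_l F) t * cos (theta_l F t)"
    using ut[of 0] ut[of 1] cosine[of 0] cosine[of 1] dX[of 0] dX[of 1]
    by (simp_all add: theta_r_def theta_l_def x_l_def[abs_def] x_r_def[abs_def])
  then show ?thesis using work unfolding 1 2 by simp
qed

section \<open>Dissipation law and conservation of mass\<close>

lemma Phi_lower_bound:
  obtains m where "0 < m" "\<And>t x. t \<in> {0..T} \<Longrightarrow> x \<in> closure (Omega P F 1 t) \<Longrightarrow> m \<le> Phi F t x"
proof -
  have "continuous_on UNIV (\<lambda>(t, x). Phi F t x)" using Ck_imp_continuous_on[OF smooth(4)] .
  moreover have "0 < Phi F t x" if "t \<in> {0..T}" "x \<in> closure (D1 t)" for t x
    using Phi_pos that Omega1 by simp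
  ultimately obtain m where "0 < m" "\<And>t x. t \<in> {0..T} \<Longrightarrow> x \<in> closure (D1 t) \<Longrightarrow> m \<le> Phi F t x"
    using uniformly_positive by blast
  then show ?thesis using that Omega1 by simp
qed

lemma interface_subset_closure: "t \<in> {0..T} \<Longrightarrow> a \<in> {0..1} \<Longrightarrow> X F t a \<in> closure (Omega P F 1 t)"
proof -
  assume t: "t \<in> {0..T}" and a: "a \<in> {0..1}"
  interpret drop_in_box "X F t" "Xa t" "Lx P" "Ly P" by (rule drop'[OF t])
  show ?thesis unfolding Omega1[OF t] closure_D bnd_def using a by blast
qed

text \<open>The densities are the concentrations themselves: their second derivatives vanish, so
  diffusion produces nothing, and y - y * 1 = 0 removes the stretching term. The bulk loses
  \<open>Da\<close> times what the surface gains by adsorption.\<close>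

lemma mass_rate:
  assumes t: "t \<in> {0..T}"
  shows "(surfactant_mass P F has_real_derivative 0) (at t within {0..T})"
proof -
  have id: "Ck 2 (\<lambda>c::real. c)" "Ck (Suc 0) (\<lambda>_::real. 1::real)" by (intro Ck_intros)+
  have b: "((\<lambda>t. LINT x:Omega P F 1 t|lborel. Phi F t x) has_real_derivative
      - (Da P * arc_integral (X F t) (adsorption t))) (at t within {0..T})"
    using bulk_rate[OF id(1) DERIV_ident id(2) DERIV_const t] by (simp add: set_lebesgue_integral_def)
  have s: "((\<lambda>t. arc_integral (X F t) (\<lambda>a. Gam F t (X F t a))) has_real_derivative
      arc_integral (X F t) (adsorption t)) (at t within {0..T})"
    using surface_law[OF DERIV_ident DERIV_const continuous_on_const t]
    by (simp add: arc_integral_def set_lebesgue_integral_def)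
  show ?thesis
    unfolding surfactant_mass_def[abs_def] using DERIV_add[OF b DERIV_cmult[OF s, of "Da P"]] by simp
qed

text \<open>The kinetic, bulk and surface balances are added with the weights 1, 1 / (We Da) and 1 /
  We, under which the two adsorption terms combine into the difference of the chemical potentials.
  The wetting energy supplies the Young angle for the contact point terms.\<close>

lemma energy_rate:
  assumes t: "t \<in> {0..T}"
  shows "(energy P F has_real_derivative
     F_k P F t + F_Phi P F t + F_w P F t + F_Gamma P F t + F_S P F t + F_Lambda P F t) (at t within {0..T})"
proof -
  obtain m where m: "0 < m" "\<And>t x. t \<in> {0..T} \<Longrightarrow> x \<in> closure (Omega P F 1 t) \<Longrightarrow> m \<le> Phi F t x"
    using Phi_lower_bound by blast
  \<comment> \<open>\<open>Phi\<close> may leave the domain of the logarithm away from the closed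
    droplet; \<open>fe\<close> is smooth everywhere and has the same integral over the droplet as
    \<open>f_bulk\<close> at every time in [0, T].\<close>
  obtain fe h h' where fe: "Ck 2 fe" "Ck (Suc 0) h" "\<And>c. (fe has_real_derivative h c) (at c)"
    "\<And>c. (h has_real_derivative h' c) (at c)"
    and ext: "\<And>c. m \<le> c \<Longrightarrow> fe c = f_bulk P c" "\<And>c. m \<le> c \<Longrightarrow> h c = El P * ln (lam P * c)"
      "\<And>c. m \<le> c \<Longrightarrow> h' c = El P / c"
    using exists_f_bulk_extension[OF m(1) positive(10)] by blast
  have Om: "Omega P F 1 s \<in> sets borel" if "s \<in> {0..T}" for s
  proof -
    interpret drop_in_box "X F s" "Xa s" "Lx P" "Ly P" by (rule drop'[OF that])
    show ?thesis using D_meas by (simp only: Omega1[OF that])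
  qed
  have Phim: "m \<le> Phi F s x" if "s \<in> {0..T}" "x \<in> Omega P F 1 s" for s x
    using m(2)[OF that(1)] closure_subset that(2) by blast
  let ?G = "\<lambda>a. Gam F t (X F t a)" and ?Ph = "\<lambda>a. Phi F t (X F t a)"
  let ?g' = "\<lambda>y. El P * (ln y - ln (1 - y))" and ?g'' = "\<lambda>y. El P / (y * (1 - y))"
  have cg'': "continuous_on {0<..<1} ?g''" by (auto intro!: continuous_intros)
  let ?B' = "- (1 / Pe_Phi P * (LINT x:Omega P F 1 t|lborel. h' (Phi F t x) * (norm (grad (Phi F t) x))\<^sup>2))
     - Da P * arc_integral (X F t) (\<lambda>a. h (?Ph a) * adsorption t a)"
  have "((\<lambda>t. LINT x:Omega P F 1 t|lborel. fe (Phi F t x)) has_real_derivative ?B') (at t within {0..T})"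
    by (rule bulk_rate[OF fe(1,3,2,4) t])
  then have B: "((\<lambda>t. LINT x:Omega P F 1 t|lborel. f_bulk P (Phi F t x)) has_real_derivative ?B') (at t within {0..T})"
  proof (rule has_field_derivative_transform_within[of _ _ _ _ 1])
    fix s assume "s \<in> {0..T}"
    then show "(LINT x:Omega P F 1 s|lborel. fe (Phi F s x)) = (LINT x:Omega P F 1 s|lborel. f_bulk P (Phi F s x))"
      by (intro set_lebesgue_integral_cong) (use Om Phim ext(1) in auto)
  qed (use t in auto)
  have A: "((\<lambda>t. arc_integral (X F t) (\<lambda>a. g_surf P (Gam F t (X F t a)))) has_real_derivative
     arc_integral (X F t) (\<lambda>a. ?g' (?G a) * adsorption t a)
     - 1 / Pe_Gamma P * arc_integral (X F t) (\<lambda>a. ?g'' (?G a) * (norm (sgrad (normal (X F t) a) (Gam F t) (X F t a)))\<^sup>2)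
     + arc_integral (X F t) (\<lambda>a. (g_surf P (?G a) - ?G a * ?g' (?G a)) * sdvg (normal (X F t) a) (vel F 1 t) (X F t a)))
     (at t within {0..T})"
    by (rule surface_law[OF _ _ cg'' t]) (use g_surf_derivs in auto)
  \<comment> \<open>The terms in ln y cancel; this is the thermodynamic relation between surface
    energy and surface tension.\<close>
  have gam: "g_surf P y - y * ?g' y = surface_tension P y" for y
    by (simp add: g_surf_def surface_tension_def algebra_simps)
  have K: "((\<lambda>t. \<Sum>i\<in>{1, 2}. LINT x:Omega P F i t|lborel. (1/2) * rho P i * (norm (vel F i t x))\<^sup>2) has_real_derivative
     F_k P F t + F_w P F t + (traction 2 t - traction 1 t)) (at t within {0..T})"
  proof -
    have "((\<lambda>t. (LINT x:Omega P F 1 t|lborel. ke 1 t x) + (LINT x:Omega P F 2 t|lborel. ke 2 t x)) has_real_derivative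
       F_k P F t + F_w P F t + (traction 2 t - traction 1 t)) (at t within {0..T})"
    proof (rule DERIV_cong[OF DERIV_add[OF kinetic_rate_1[OF t] kinetic_rate_2[OF t]]])
      have sum12: "(\<Sum>i\<in>{1::nat, 2}. f i) = f 1 + f 2" for f :: "nat \<Rightarrow> real" by simp
      show "- (1 / Rey P * (LINT x:Omega P F 1 t|lborel. 2 * eta P 1 * (norm (strain (vel F 1 t) x))\<^sup>2))
         - 1 / (Rey P * ls P) * (LINT x:wall P F 1 t|lborel. beta P 1 * \<bar>vel F 1 t (pt x 0) \<bullet> t_w\<bar>\<^sup>2) - traction 1 t
         + (- (1 / Rey P * (LINT x:Omega P F 2 t|lborel. 2 * eta P 2 * (norm (strain (vel F 2 t) x))\<^sup>2))
         - 1 / (Rey P * ls P) * (LINT x:wall P F 2 t|lborel. beta P 2 * \<bar>vel F 2 t (pt x 0) \<bullet> t_w\<bar>\<^sup>2) + traction 2 t)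
         = F_k P F t + F_w P F t + (traction 2 t - traction 1 t)"
        unfolding F_k_def F_w_def sum12 by linarith
    qed
    then show ?thesis by (simp add: ke_def)
  qed
  have "(x_l F has_real_derivative Xt t 0 $ 1) (at t)" "(x_r F has_real_derivative Xt t 1 $ 1) (at t)"
    unfolding x_l_def[abs_def] x_r_def[abs_def] by (rule vec_nth_deriv[OF X_derivs(2)])+
  then have xl: "(x_l F has_real_derivative deriv (x_l F) t) (at t within {0..T})"
    and xr: "(x_r F has_real_derivative deriv (x_r F) t) (at t within {0..T})"
    using DERIV_imp_deriv has_field_derivative_at_within by metis+
  have FPhi: "F_Phi P F t = 1 / (We P * Da P) * - (1 / Pe_Phi P * (LINT x:Omega P F 1 t|lborel. h' (Phi F t x) * (norm (grad (Phi F t) x))\<^sup>2))"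
  proof -
    have "(LINT x:Omega P F 1 t|lborel. deriv (deriv (f_bulk P)) (Phi F t x) * (norm (grad (Phi F t) x))\<^sup>2)
      = (LINT x:Omega P F 1 t|lborel. h' (Phi F t x) * (norm (grad (Phi F t) x))\<^sup>2)"
    proof (rule set_lebesgue_integral_cong)
      show "\<forall>x. x \<in> Omega P F 1 t \<longrightarrow> deriv (deriv (f_bulk P)) (Phi F t x) * (norm (grad (Phi F t) x))\<^sup>2
          = h' (Phi F t x) * (norm (grad (Phi F t) x))\<^sup>2"
        using Phim[OF t] ext(3) m(1) deriv_f_bulk(2)[OF _ positive(10)] by (metis less_le_trans)
    qed (use Om[OF t] in simp)
    then show ?thesis unfolding F_Phi_def by simp
  qed
  have FGamma: "F_Gamma P F t = 1 / We P * - (1 / Pe_Gamma P * arc_integral (X F t) (\<lambda>a. ?g'' (?G a) * (norm (sgrad (normal (X F t) a) (Gam F t) (X F t a)))\<^sup>2))"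
  proof -
    have "arc_integral (X F t) (\<lambda>a. deriv (deriv (g_surf P)) (?G a) * (norm (sgrad (normal (X F t) a) (Gam F t) (X F t a)))\<^sup>2)
      = arc_integral (X F t) (\<lambda>a. ?g'' (?G a) * (norm (sgrad (normal (X F t) a) (Gam F t) (X F t a)))\<^sup>2)"
      unfolding arc_integral_def
      by (rule set_lebesgue_integral_cong) (use Gam_curve[OF t] deriv_g_surf(2) in auto)
    then show ?thesis unfolding F_Gamma_def by simp
  qed
  have FS: "F_S P F t = - (1 / We P) * (arc_integral (X F t) (\<lambda>a. h (?Ph a) * adsorption t a) - arc_integral (X F t) (\<lambda>a. ?g' (?G a) * adsorption t a))"
  proof -
    have CG1: "Ck (Suc 0) (Gam F t)" using Ck_mono[OF Ck_slice[OF smooth(5)], where j = "Suc 0"] by simp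
    have "continuous_on {0<..<1} ?g'" using g_surf_derivs(2)[where P = P] by (meson DERIV_isCont continuous_at_imp_continuous_on greaterThanLessThan_iff)
    then have cg: "continuous_on {0..1} (\<lambda>a. ?g' (?G a))"
      by (rule continuous_on_compose2[OF _ cont_X_comp[OF CG1]]) (use Gam_curve[OF t] in blast)
    have s: "set_integrable lborel {0..1} (\<lambda>a. h (?Ph a) * adsorption t a * norm (Xa t a))"
      "set_integrable lborel {0..1} (\<lambda>a. ?g' (?G a) * adsorption t a * norm (Xa t a))"
      by (intro borel_integrable_atLeastAtMost' continuous_on_mult continuous_on_norm cont_X cont_adsorption cg
          cont_X_comp[OF Ck_compose[OF fe(2) Phi_Suc(3)]])+
    have "arc_integral (X F t) (\<lambda>a. let x = X F t a in (deriv (f_bulk P) (Phi F t x) - deriv (g_surf P) (Gam F t x)) * S_ads P (Phi F t x) (Gam F t x))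
      = (LINT a:{0..1}|lborel. h (?Ph a) * adsorption t a * norm (Xa t a) - ?g' (?G a) * adsorption t a * norm (Xa t a))"
      unfolding arc_integral_eq
    proof (rule set_lebesgue_integral_cong, simp, intro allI impI)
      fix a :: real assume a: "a \<in> {0..1}"
      have p: "m \<le> ?Ph a" using m(2)[OF t interface_subset_closure[OF t a]] .
      then have "deriv (f_bulk P) (?Ph a) = h (?Ph a)"
        using deriv_f_bulk(1)[OF less_le_trans[OF m(1) p] positive(10)] ext(2) by simp
      moreover have "deriv (g_surf P) (?G a) = ?g' (?G a)" using deriv_g_surf(1) Gam_curve[OF t a] by simp
      ultimately show "(let x = X F t a in (deriv (f_bulk P) (Phi F t x) - deriv (g_surf P) (Gam F t x)) * S_ads P (Phi F t x) (Gam F t x)) * norm (Xa t a)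
        = h (?Ph a) * adsorption t a * norm (Xa t a) - ?g' (?G a) * adsorption t a * norm (Xa t a)"
        by (simp only: Let_def adsorption_def left_diff_distrib)
    qed
    also have "\<dots> = arc_integral (X F t) (\<lambda>a. h (?Ph a) * adsorption t a) - arc_integral (X F t) (\<lambda>a. ?g' (?G a) * adsorption t a)"
      unfolding arc_integral_eq by (rule set_integral_diff(2)[OF s])
    finally show ?thesis unfolding F_S_def by simp
  qed
  have FLambda: "1 / We P * (surface_tension P (?G 1) * (deriv (x_r F) t * cos (theta_r F t))
       - surface_tension P (?G 0) * (deriv (x_l F) t * cos (theta_l F t)))
     - cos (theta_Y P) / We P * (deriv (x_r F) t - deriv (x_l F) t) = F_Lambda P F t"
  proof -
    have c: "surface_tension P (?G 0) * cos (theta_l F t) = cos (theta_Y P) + Ca P * (beta_star P * deriv (x_l F) t)"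
      "surface_tension P (?G 1) * cos (theta_r F t) = cos (theta_Y P) - Ca P * (beta_star P * deriv (x_r F) t)"
      using at_time(5)[OF t] positive(4) unfolding contact_conditions_def by (auto simp: field_simps)
    have "surface_tension P (?G 1) * (deriv (x_r F) t * cos (theta_r F t)) - surface_tension P (?G 0) * (deriv (x_l F) t * cos (theta_l F t))
      = (surface_tension P (?G 1) * cos (theta_r F t)) * deriv (x_r F) t - (surface_tension P (?G 0) * cos (theta_l F t)) * deriv (x_l F) t"
      by simp
    also have "\<dots> = cos (theta_Y P) * (deriv (x_r F) t - deriv (x_l F) t)
        - Ca P * (beta_star P * ((deriv (x_l F) t)\<^sup>2 + (deriv (x_r F) t)\<^sup>2))"
      unfolding c by (simp add: power2_eq_square algebra_simps)
    finally have e: "surface_tension P (?G 1) * (deriv (x_r F) t * cos (theta_r F t)) - surface_tension P (?G 0) * (deriv (x_l F) t * cos (theta_l F t))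
      = cos (theta_Y P) * (deriv (x_r F) t - deriv (x_l F) t) - Ca P * (beta_star P * ((deriv (x_l F) t)\<^sup>2 + (deriv (x_r F) t)\<^sup>2))" .
    \<comment> \<open>The terms with the Young angle cancel, and Ca / We = 1 / Re gives the
      coefficient.\<close>
    show ?thesis unfolding e F_Lambda_def We_def using positive(3,4) by (simp add: diff_divide_distrib right_diff_distrib)
  qed
  \<comment> \<open>\<open>W\<close> occurs in the balance of the surface energy and, with the
    opposite sign, in the difference of the tractions; it cancels in the sum.\<close>
  define W where "W = arc_integral (X F t) (\<lambda>a. surface_tension P (?G a) * sdvg (normal (X F t) a) (vel F 1 t) (X F t a))"
  have tw: "traction 2 t - traction 1 t = 1 / We P * (surface_tension P (?G 1) * (deriv (x_r F) t * cos (theta_r F t))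
       - surface_tension P (?G 0) * (deriv (x_l F) t * cos (theta_l F t))) - 1 / We P * W"
  proof -
    have "x = 1 / w * r - 1 / w * v" if "v + w * x = r" "0 < w" for v w x r :: real
      using that by (auto simp: field_simps)
    from this[OF tension_work[OF t] positive(11)] show ?thesis unfolding W_def .
  qed
  note d = DERIV_diff[OF DERIV_add[OF DERIV_add[OF K DERIV_cmult[OF B, of "1 / (We P * Da P)"]] DERIV_cmult[OF A[unfolded gam W_def[symmetric]], of "1 / We P"]]
      DERIV_cmult[OF DERIV_diff[OF xr xl], of "cos (theta_Y P) / We P"]]
  show ?thesis
    unfolding energy_def[abs_def]
  proof (rule DERIV_cong[OF d])
    have DaWe: "1 / (We P * Da P) * (x - Da P * y) = 1 / (We P * Da P) * x - 1 / We P * y" for x y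
      using positive(6,11) by (simp add: field_simps)
    show "F_k P F t + F_w P F t + (traction 2 t - traction 1 t) + 1 / (We P * Da P) * ?B'
      + 1 / We P * (arc_integral (X F t) (\<lambda>a. ?g' (?G a) * adsorption t a)
         - 1 / Pe_Gamma P * arc_integral (X F t) (\<lambda>a. ?g'' (?G a) * (norm (sgrad (normal (X F t) a) (Gam F t) (X F t a)))\<^sup>2) + W)
      - cos (theta_Y P) / We P * (deriv (x_r F) t - deriv (x_l F) t)
      = F_k P F t + F_Phi P F t + F_w P F t + F_Gamma P F t + F_S P F t + F_Lambda P F t"
      unfolding DaWe FPhi FGamma FS FLambda[symmetric] tw
      by (simp only: distrib_left right_diff_distrib mult_minus_left mult_minus_right)
  qed
qed

end

lemma derivs_chemical_potential:
  assumes "admissible P" "0 < c" "0 < G" "G < 1"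
  shows "deriv (f_bulk P) c - deriv (g_surf P) G = El P * ln (lam P * c * (1 - G) / G)"
    and "deriv (deriv (f_bulk P)) c = El P / c" and "deriv (deriv (g_surf P)) G = El P / (G * (1 - G))"
proof -
  have lam: "0 < lam P" using assms(1) by (simp add: admissible_def)
  have "ln (lam P * c * (1 - G) / G) = ln (lam P * c) - (ln G - ln (1 - G))"
    using assms lam by (simp add: ln_div ln_mult)
  then show "deriv (f_bulk P) c - deriv (g_surf P) G = El P * ln (lam P * c * (1 - G) / G)"
    using deriv_f_bulk(1)[OF assms(2) lam] deriv_g_surf(1)[OF assms(3,4)] by (simp only: right_diff_distrib)
  show "deriv (deriv (f_bulk P)) c = El P / c" "deriv (deriv (g_surf P)) G = El P / (G * (1 - G))"
    using deriv_f_bulk(2)[OF assms(2) lam] deriv_g_surf(2)[OF assms(3,4)] by auto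
qed

theorem theorem3p1:
  fixes P :: params and F :: flow and T :: real
  assumes "admissible P"
    and "T > 0"
    and "smooth_solution P F T"
    and "\<forall>t\<in>{0..T}. \<forall>x\<in>closure (Omega P F 1 t). Phi F t x > 0"
    and "\<forall>t\<in>{0..T}. \<forall>x\<in>Sigma_int F t. 0 < Gam F t x \<and> Gam F t x < 1"
  shows "(\<forall>t\<in>{0..T}.
           (energy P F has_real_derivative
              F_k P F t + F_Phi P F t + F_w P F t + F_Gamma P F t + F_S P F t + F_Lambda P F t)
           (at t within {0..T})) \<and>
         (\<forall>c G. c > 0 \<longrightarrow> 0 < G \<longrightarrow> G < 1 \<longrightarrow>
           deriv (f_bulk P) c - deriv (g_surf P) G = El P * ln (lam P * c * (1 - G) / G) \<and>
           deriv (deriv (f_bulk P)) c = El P / c \<and>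
           deriv (deriv (g_surf P)) G = El P / (G * (1 - G))) \<and>
         (\<forall>t\<in>{0..T}. (surfactant_mass P F has_real_derivative 0) (at t within {0..T}))"
proof -
  have "flow_solution P F T" using assms by unfold_locales auto
  then interpret flow_solution P F T .
  show ?thesis
    using energy_rate mass_rate derivs_chemical_potential[OF assms(1)] by blast
qed

end
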